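(* Let $\Omega$, $\beta$, $r=1/\beta$ satisfy the curvature assumption $r<r_0/2$, and suppose the magnetic billiard flow in $\Omega$ admits a non-constant polynomial in momenta integral. Let $f_{\pm r}$ be the minimal (real) defining polynomial of the irreducible component in $\mathbb{C}^2$ of the algebraic curve containing $\gamma_{\pm r}$, and let $\tilde f_{\pm r}(x,y,z)$ be its homogenization. Then any non-singular point of intersection of the projective curve $\{\tilde f_{\pm r}=0\}\subset\mathbb{C}P^2$ with the line at infinity $\{z=0\}$, other than the isotropic points $(1:\pm i:0)$, is a point of tangency of the curve with the line at infinity.
   Context: $\Omega\subset\mathbb{R}^2$ is a bounded domain with boundary $\gamma$ a simple closed $C^\infty$ curve parametrized counterclockwise by arc length; $J$ is the counterclockwise rotation by $\pi/2$, $n=J\dot\gamma$, $\gamma_t=\gamma+t\,n$ is the parallel curve, and $r_0$ is the largest radius for which the tubular neighbourhood of $\gamma$ is diffeomorphic to its normal bundle. Magnetic billiard: a particle moves in $\Omega$ with unit speed along counterclockwise circles of radius $r$, reflected at $\gamma$ by $v\mapsto v-2\langle n,v\rangle n$; $g^t$ is the flow on unit tangent vectors. $\Omega_+$ is the closed annulus bounded by $\gamma$ and $\gamma_{+2r}$. A polynomial in momenta integral is $\Phi(x,v)=\sum_{0\le k+l\le N}a_{kl}(x)v_1^kv_2^l$ on unit tangent vectors over $\Omega_+$, $a_{kl}\in C^\infty(\overline{\Omega_+})$, such that (1) $\Phi(g^t(x,v))=\Phi(x,v)$ between collisions for $x\in\gamma$, $v$ inward unit, and (2) $\Phi(x,v)=\Phi(x,v-2\langle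 n,v\rangle n)$ for $x\in\partial\Omega$. (Under these hypotheses $\gamma_{\pm r}$ are contained in real algebraic curves.) *)

theory Defs
  imports "HOL-Complex_Analysis.Complex_Analysis" "HOL-Computational_Algebra.Polynomial_Factorial"
begin

text \<open>The plane R^2 is identified with the complex numbers; J is multiplication by i.\<close>

coinductive smooth_curve :: "(real \<Rightarrow> complex) \<Rightarrow> bool" where
  "(\<forall>t. (f has_vector_derivative g t) (at t)) \<Longrightarrow> smooth_curve g \<Longrightarrow> smooth_curve f"

coinductive smooth_on2 :: "complex set \<Rightarrow> (complex \<Rightarrow> real) \<Rightarrow> bool" for U where
  "(\<forall>z\<in>U. (f has_derivative (\<lambda>h. Re h * gx z + Im h * gy z)) (at z))
   \<Longrightarrow> smooth_on2 U gx \<Longrightarrow> smooth_on2 U gy \<Longrightarrow> smooth_on2 U f"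

definition smooth_on_closed :: "complex set \<Rightarrow> (complex \<Rightarrow> real) \<Rightarrow> bool" where
  "smooth_on_closed K f \<longleftrightarrow> (\<exists>U. open U \<and> K \<subseteq> U \<and> smooth_on2 U f)"

definition tangent :: "(real \<Rightarrow> complex) \<Rightarrow> real \<Rightarrow> complex" where
  "tangent \<gamma> s = vector_derivative \<gamma> (at s)"

definition normal :: "(real \<Rightarrow> complex) \<Rightarrow> real \<Rightarrow> complex" where
  "normal \<gamma> s = \<i> * tangent \<gamma> s"

definition parallel_curve :: "(real \<Rightarrow> complex) \<Rightarrow> real \<Rightarrow> real \<Rightarrow> complex" where
  "parallel_curve \<gamma> t s = \<gamma> s + of_real t * normal \<gamma> s"

definition smooth_jordan_ccw :: "(real \<Rightarrow> complex) \<Rightarrow> real \<Rightarrow> bool" where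
  "smooth_jordan_ccw \<gamma> L \<longleftrightarrow> L > 0 \<and> smooth_curve \<gamma> \<and> (\<forall>s. \<gamma> (s + L) = \<gamma> s)
     \<and> inj_on \<gamma> {0..<L} \<and> (\<forall>s. norm (tangent \<gamma> s) = 1)
     \<and> (\<forall>w \<in> inside (\<gamma> ` {0..L}). winding_number (\<lambda>u. \<gamma> (L * u)) w = 1)"

text \<open>The normal map (s,tau) |-> gamma(s) + tau n(s) is injective on the tube of radius t
  over the circle R/LZ and an immersion there (hence a diffeomorphism onto its open image).\<close>
definition tube_ok :: "(real \<Rightarrow> complex) \<Rightarrow> real \<Rightarrow> real \<Rightarrow> bool" where
  "tube_ok \<gamma> L t \<longleftrightarrow>
     inj_on (\<lambda>(s, \<tau>). parallel_curve \<gamma> \<tau> s) ({0..<L} \<times> {-t<..<t}) \<and>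
     (\<forall>s \<tau>. \<bar>\<tau>\<bar> < t \<longrightarrow>
        Im (cnj (tangent \<gamma> s + of_real \<tau> * (\<i> * vector_derivative (tangent \<gamma>) (at s)))
             * normal \<gamma> s) \<noteq> 0)"

definition tube_radius :: "(real \<Rightarrow> complex) \<Rightarrow> real \<Rightarrow> real" where
  "tube_radius \<gamma> L = Sup {t. t > 0 \<and> tube_ok \<gamma> L t}"

definition annulus_plus :: "(real \<Rightarrow> complex) \<Rightarrow> real \<Rightarrow> complex set" where
  "annulus_plus \<gamma> r = {parallel_curve \<gamma> \<tau> s | s \<tau>. 0 \<le> \<tau> \<and> \<tau> \<le> 2 * r}"

text \<open>Magnetic flow: unit-speed counterclockwise circles of radius r.\<close>
definition mag_pos :: "real \<Rightarrow> complex \<Rightarrow> complex \<Rightarrow> real \<Rightarrow> complex" where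
  "mag_pos r x v t = x + of_real r * (of_real (sin (t / r)) * v + of_real (1 - cos (t / r)) * (\<i> * v))"

definition mag_vel :: "real \<Rightarrow> complex \<Rightarrow> real \<Rightarrow> complex" where
  "mag_vel r v t = of_real (cos (t / r)) * v + of_real (sin (t / r)) * (\<i> * v)"

definition reflect :: "complex \<Rightarrow> complex \<Rightarrow> complex" where
  "reflect n v = v - of_real (2 * (n \<bullet> v)) * n"

definition poly_mom :: "nat \<Rightarrow> (nat \<Rightarrow> nat \<Rightarrow> complex \<Rightarrow> real) \<Rightarrow> complex \<Rightarrow> complex \<Rightarrow> real" where
  "poly_mom N a x v = (\<Sum>(k, l) \<in> {(k, l). k + l \<le> N}. a k l x * Re v ^ k * Im v ^ l)"

definition is_poly_integral ::
  "(real \<Rightarrow> complex) \<Rightarrow> real \<Rightarrow> real \<Rightarrow> nat \<Rightarrow> (nat \<Rightarrow> nat \<Rightarrow> complex \<Rightarrow> real) \<Rightarrow> bool" where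
  "is_poly_integral \<gamma> L r N a \<longleftrightarrow>
     (\<forall>k l. k + l \<le> N \<longrightarrow> smooth_on_closed (annulus_plus \<gamma> r) (a k l)) \<and>
     (\<forall>s v t. norm v = 1 \<longrightarrow> normal \<gamma> s \<bullet> v > 0 \<longrightarrow> t \<ge> 0 \<longrightarrow>
        (\<forall>u\<in>{0<..<t}. mag_pos r (\<gamma> s) v u \<in> inside (\<gamma> ` {0..L})) \<longrightarrow>
        poly_mom N a (mag_pos r (\<gamma> s) v t) (mag_vel r v t) = poly_mom N a (\<gamma> s) v) \<and>
     (\<forall>s v. norm v = 1 \<longrightarrow>
        poly_mom N a (\<gamma> s) (reflect (normal \<gamma> s) v) = poly_mom N a (\<gamma> s) v)"

definition nonconstant_on_UT ::
  "complex set \<Rightarrow> (complex \<Rightarrow> complex \<Rightarrow> real) \<Rightarrow> bool" where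
  "nonconstant_on_UT K \<Phi> \<longleftrightarrow> (\<exists>x v y w. x \<in> K \<and> y \<in> K \<and> norm v = 1 \<and> norm w = 1 \<and> \<Phi> x v \<noteq> \<Phi> y w)"

text \<open>Bivariate polynomials C[x,y] as complex poly poly (outer variable x, inner y).\<close>
definition eval2 :: "complex poly poly \<Rightarrow> complex \<Rightarrow> complex \<Rightarrow> complex" where
  "eval2 p x y = poly (map_poly (\<lambda>q. poly q y) p) x"

definition real_coeffs2 :: "complex poly poly \<Rightarrow> bool" where
  "real_coeffs2 p \<longleftrightarrow> (\<forall>i j. coeff (coeff p i) j \<in> \<real>)"

definition total_degree :: "complex poly poly \<Rightarrow> nat" where
  "total_degree p = Max {i + degree (coeff p i) | i. i \<le> degree p}"

definition homog :: "complex poly poly \<Rightarrow> complex \<Rightarrow> complex \<Rightarrow> complex \<Rightarrow> complex" where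
  "homog p x y z = (\<Sum>i\<le>degree p. \<Sum>j\<le>degree (coeff p i).
      coeff (coeff p i) j * x ^ i * y ^ j * z ^ (total_degree p - i - j))"

definition nonsingular_pt :: "(complex \<Rightarrow> complex \<Rightarrow> complex \<Rightarrow> complex) \<Rightarrow> complex \<Rightarrow> complex \<Rightarrow> complex \<Rightarrow> bool" where
  "nonsingular_pt F a b c \<longleftrightarrow>
     \<not> (deriv (\<lambda>x. F x b c) a = 0 \<and> deriv (\<lambda>y. F a y c) b = 0 \<and> deriv (\<lambda>z. F a b z) c = 0)"

text \<open>The line at infinity z=0 is the tangent line at (a:b:c), i.e. grad F is proportional to (0,0,1).\<close>
definition tangent_to_infinity_line :: "(complex \<Rightarrow> complex \<Rightarrow> complex \<Rightarrow> complex) \<Rightarrow> complex \<Rightarrow> complex \<Rightarrow> complex \<Rightarrow> bool" where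
  "tangent_to_infinity_line F a b c \<longleftrightarrow> deriv (\<lambda>x. F x b c) a = 0 \<and> deriv (\<lambda>y. F a y c) b = 0"

end

theory Submission
  imports Defs
begin

text \<open>Along the flow the Larmor center \<open>x + i r v\<close> is constant.  Expanding the integral in powers of
  \<open>v\<close> on the unit circle, conservation becomes a triangular system of Wirtinger equations for the
  coefficients; solving it upwards shows that they are polynomials in \<open>cnj z\<close> with holomorphic
  coefficients, solving it downwards that they are polynomials in \<open>z\<close> and \<open>cnj z\<close>.  Hence the
  integral is a polynomial \<open>F\<close> of the center.

  The centers of the Larmor circles through \<open>\<gamma> s\<close> form the circle of radius \<open>r\<close> about \<open>\<gamma> s\<close>, which is
  tangent to the parallel curve; the reflection law says that \<open>F\<close>, restricted to this circle, is
  symmetric about the normal line.  This is an algebraic relation between a point of the parallel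
  curve and its unit normal \<open>\<plusminus> grad f / \<surd>(f\<^sub>x\<^sup>2 + f\<^sub>y\<^sup>2)\<close>, so it persists on the whole complex curve
  \<open>f = 0\<close>.  If the curve met the line at infinity transversally at a non-isotropic point \<open>(p : q : 0)\<close>,
  it would have a branch asymptotic to a line there, and comparing leading terms along that branch
  would force \<open>F\<close> to depend on \<open>q x - p y\<close> only.  As \<open>F\<close> is also constant on the parallel curve, which
  is not contained in a line, \<open>F\<close> and with it the integral would be constant.\<close>

section \<open>Bivariate polynomials\<close>

text \<open>The conservation law is postulated only along arcs that start on the boundary with
  inward velocity and stay inside. The Wirtinger system is therefore available only at points and
  directions whose Larmor circle, followed backwards, reaches such a start. This confines the
  argument to a strip of depth \<open>2 * r\<close>, the diameter of a Larmor circle, and calls for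
  two geometric facts: the discs of radius \<open>r\<close> tangent to \<open>\<gamma>\<close> stay
  on one side of it, and \<open>normal\<close> points inwards. The second is present in the
  definitions only through the winding number 1 and has to be extracted from its jump across the
  curve. On the algebraic side the sign of the square root cannot be followed along the complex
  curve, so every relation is kept as an alternative between both signs. The contradiction then
  needs a position on the circle of centers at which both alternatives fail; a leading coefficient
  has finitely many zeros, so all but finitely many positions serve.\<close>

lemma eval2_eq: "eval2 p x y = poly (poly p [:x:]) y"
proof (induction p)
  case 0 then show ?case by (simp add: eval2_def)
next
  case (pCons a p)
  then show ?case by (simp add: eval2_def map_poly_pCons mult.commute)
qed

lemma eval2_add [simp]: "eval2 (p + q) x y = eval2 p x y + eval2 q x y"
  and eval2_diff [simp]: "eval2 (p - q) x y = eval2 p x y - eval2 q x y"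
  and eval2_minus [simp]: "eval2 (- p) x y = - eval2 p x y"
  and eval2_mult [simp]: "eval2 (p * q) x y = eval2 p x y * eval2 q x y"
  and eval2_0 [simp]: "eval2 0 x y = 0"
  and eval2_pCons [simp]: "eval2 (pCons a p) x y = poly a y + x * eval2 p x y"
  and eval2_smult [simp]: "eval2 (smult a p) x y = poly a y * eval2 p x y"
  by (simp_all add: eval2_eq)

lemma eval2_altdef: "eval2 p x y = (\<Sum>i\<le>degree p. poly (coeff p i) y * x ^ i)"
  by (simp add: eval2_eq poly_altdef[of p] poly_sum)

lemma eval2_altdef_lt:
  assumes "degree p < n"
  shows "eval2 p x y = (\<Sum>i<n. poly (coeff p i) y * x ^ i)"
proof -
  have "(\<Sum>i\<le>degree p. poly (coeff p i) y * x ^ i) = (\<Sum>i<n. poly (coeff p i) y * x ^ i)"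
    using assms by (intro sum.mono_neutral_left) (auto simp: coeff_eq_0)
  then show ?thesis by (simp add: eval2_altdef)
qed

text \<open>Under the convention \<open>eval2 p (cnj z) z\<close> used below, \<open>pderiv\<close>
  becomes the derivative in \<open>cnj z\<close> and \<open>pderiv2\<close> the one in
  \<open>z\<close>.\<close>

definition pderiv2 :: "complex poly poly \<Rightarrow> complex poly poly" where
  "pderiv2 p = map_poly pderiv p"

lemma pderiv2_pCons [simp]: "pderiv2 (pCons a p) = pCons (pderiv a) (pderiv2 p)"
  by (simp add: pderiv2_def map_poly_pCons)

lemma pderiv2_0 [simp]: "pderiv2 0 = 0"
  by (simp add: pderiv2_def)

lemma has_field_derivative_eval2:
  assumes "(g has_field_derivative g') (at t within S)" "(h has_field_derivative h') (at t within S)"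
  shows "((\<lambda>t. eval2 p (g t) (h t)) has_field_derivative
            (eval2 (pderiv p) (g t) (h t) * g' + eval2 (pderiv2 p) (g t) (h t) * h')) (at t within S)"
proof (induction p)
  case 0 then show ?case by simp
next
  case (pCons a p)
  show ?case
    using assms pCons
    by (auto intro!: derivative_eq_intros simp: pderiv_pCons algebra_simps)
qed

text \<open>The real version is wanted besides the complex one because the arguments will be
  \<open>cnj z\<close> or functions of a real parameter.\<close>

lemma has_derivative_eval2:
  assumes "(g has_derivative g') (at t within S)" "(h has_derivative h') (at t within S)"
  shows "((\<lambda>t. eval2 p (g t) (h t)) has_derivative
            (\<lambda>u. eval2 (pderiv p) (g t) (h t) * g' u + eval2 (pderiv2 p) (g t) (h t) * h' u)) (at t within S)"
proof (induction p)
  case 0 then show ?case by simp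
next
  case (pCons a p)
  have *: "((\<lambda>t. poly a (h t)) has_derivative (\<lambda>u. poly (pderiv a) (h t) * h' u)) (at t within S)"
    using has_derivative_compose[OF assms(2), of "poly a" "(*) (poly (pderiv a) (h t))"] poly_DERIV[of a "h t"]
    by (simp add: has_field_derivative_def)
  show ?case
    using assms pCons *
    by (auto intro!: derivative_eq_intros simp: pderiv_pCons algebra_simps)
qed

lemma continuous_on_eval2 [continuous_intros]:
  assumes "continuous_on S g" "continuous_on S h"
  shows "continuous_on S (\<lambda>t. eval2 p (g t) (h t))"
  unfolding eval2_altdef by (intro continuous_intros assms)

lemma tendsto_eval2 [tendsto_intros]:
  assumes "(g \<longlongrightarrow> a) A" "(h \<longlongrightarrow> b) A"
  shows "((\<lambda>t. eval2 p (g t) (h t)) \<longlongrightarrow> eval2 p a b) A"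
  unfolding eval2_altdef by (intro tendsto_intros assms)

text \<open>Closure under arithmetic and composition lets polynomiality be read off from the shape
  of an expression, without computing coefficients.\<close>

definition polyfun2 :: "(complex \<Rightarrow> complex \<Rightarrow> complex) \<Rightarrow> bool" where
  "polyfun2 g \<longleftrightarrow> (\<exists>p. g = eval2 p)"

lemma polyfun2_eval2 [intro]: "polyfun2 (eval2 p)"
  by (auto simp: polyfun2_def)

lemma polyfun2_const [intro]: "polyfun2 (\<lambda>x y. c)"
  unfolding polyfun2_def by (rule exI[of _ "[:[:c:]:]"]) (auto simp: fun_eq_iff)

lemma polyfun2_fst [intro]: "polyfun2 (\<lambda>x y. x)"
  unfolding polyfun2_def by (rule exI[of _ "[:0,1:]"]) (auto simp: fun_eq_iff)

lemma polyfun2_snd [intro]: "polyfun2 (\<lambda>x y. y)"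
  unfolding polyfun2_def by (rule exI[of _ "[:[:0,1:]:]"]) (auto simp: fun_eq_iff)

lemma polyfun2_add [intro]:
  assumes "polyfun2 g" "polyfun2 h" shows "polyfun2 (\<lambda>x y. g x y + h x y)"
proof -
  obtain p q where "g = eval2 p" "h = eval2 q" using assms by (auto simp: polyfun2_def)
  then show ?thesis unfolding polyfun2_def by (intro exI[of _ "p + q"]) (auto simp: fun_eq_iff)
qed

lemma polyfun2_mult [intro]:
  assumes "polyfun2 g" "polyfun2 h" shows "polyfun2 (\<lambda>x y. g x y * h x y)"
proof -
  obtain p q where "g = eval2 p" "h = eval2 q" using assms by (auto simp: polyfun2_def)
  then show ?thesis unfolding polyfun2_def by (intro exI[of _ "p * q"]) (auto simp: fun_eq_iff)
qed

lemma polyfun2_minus [intro]: "polyfun2 g \<Longrightarrow> polyfun2 (\<lambda>x y. - g x y)"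
  using polyfun2_mult[OF polyfun2_const[of "-1"], of g] by simp

lemma polyfun2_diff [intro]: "polyfun2 g \<Longrightarrow> polyfun2 h \<Longrightarrow> polyfun2 (\<lambda>x y. g x y - h x y)"
  using polyfun2_add[OF _ polyfun2_minus, of g h] by simp

lemma polyfun2_power [intro]: "polyfun2 g \<Longrightarrow> polyfun2 (\<lambda>x y. g x y ^ n)"
  by (induction n) auto

lemma polyfun2_sum [intro]: "(\<And>i. i \<in> A \<Longrightarrow> polyfun2 (g i)) \<Longrightarrow> polyfun2 (\<lambda>x y. \<Sum>i\<in>A. g i x y)"
  by (induction A rule: infinite_finite_induct) auto

lemma polyfun2_poly [intro]:
  assumes "polyfun2 h" shows "polyfun2 (\<lambda>x y. poly p (h x y))"
  unfolding poly_altdef using assms by (intro polyfun2_sum polyfun2_mult) auto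

lemma polyfun2_compose [intro]:
  assumes "polyfun2 g" "polyfun2 h"
  shows "polyfun2 (\<lambda>x y. eval2 p (g x y) (h x y))"
  unfolding eval2_altdef using assms by (intro polyfun2_sum polyfun2_mult) auto

text \<open>The outer variable stands for \<open>cnj z\<close>, so \<open>coeff p j\<close> plays
  the part of the holomorphic coefficient \<open>H j\<close> in
  \<open>polyanalytic_on\<close>.\<close>

definition wirtinger_poly :: "complex set \<Rightarrow> (complex \<Rightarrow> complex) \<Rightarrow> bool" where
  "wirtinger_poly W g \<longleftrightarrow> (\<exists>p. \<forall>z\<in>W. g z = eval2 p (cnj z) z)"

definition polyanalytic_on :: "complex set \<Rightarrow> (complex \<Rightarrow> complex) \<Rightarrow> bool" where
  "polyanalytic_on W g \<longleftrightarrow>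
     (\<exists>n H. (\<forall>j. H j holomorphic_on W) \<and> (\<forall>z\<in>W. g z = (\<Sum>j<n. H j z * cnj z ^ j)))"

lemma polyanalytic_on_0: "polyanalytic_on W (\<lambda>z. 0)"
  unfolding polyanalytic_on_def by (rule exI[of _ 0]) (auto intro!: exI[of _ "\<lambda>_ _. 0"])

lemma polyanalytic_on_cong:
  assumes "\<And>z. z \<in> W \<Longrightarrow> g z = h z" shows "polyanalytic_on W g = polyanalytic_on W h"
  using assms by (auto simp: polyanalytic_on_def)

lemma polyanalytic_pad:
  assumes "\<And>j. H j holomorphic_on W" "\<And>z. z \<in> W \<Longrightarrow> g z = (\<Sum>j<n. H j z * cnj z ^ j)" "n \<le> m"
  obtains H' where "\<And>j. H' j holomorphic_on W" "\<And>z. z \<in> W \<Longrightarrow> g z = (\<Sum>j<m. H' j z * cnj z ^ j)"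
proof
  let ?H = "\<lambda>j z. if j < n then H j z else 0"
  show "?H j holomorphic_on W" for j by (cases "j < n") (auto simp: assms(1))
  show "g z = (\<Sum>j<m. ?H j z * cnj z ^ j)" if "z \<in> W" for z
    unfolding assms(2)[OF that] using assms(3) by (intro sum.mono_neutral_cong_left) auto
qed

lemma polyanalytic_on_add:
  assumes "polyanalytic_on W g" "polyanalytic_on W h"
  shows "polyanalytic_on W (\<lambda>z. g z + h z)"
proof -
  obtain n G where G: "\<And>j. G j holomorphic_on W" "\<And>z. z \<in> W \<Longrightarrow> g z = (\<Sum>j<n. G j z * cnj z ^ j)"
    using assms(1) by (auto simp: polyanalytic_on_def)
  obtain m H where H: "\<And>j. H j holomorphic_on W" "\<And>z. z \<in> W \<Longrightarrow> h z = (\<Sum>j<m. H j z * cnj z ^ j)"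
    using assms(2) by (auto simp: polyanalytic_on_def)
  obtain G' where G': "\<And>j. G' j holomorphic_on W" "\<And>z. z \<in> W \<Longrightarrow> g z = (\<Sum>j<max n m. G' j z * cnj z ^ j)"
    using polyanalytic_pad[OF G, of "max n m"] by auto
  obtain H' where H': "\<And>j. H' j holomorphic_on W" "\<And>z. z \<in> W \<Longrightarrow> h z = (\<Sum>j<max n m. H' j z * cnj z ^ j)"
    using polyanalytic_pad[OF H, of "max n m"] by auto
  have "\<forall>j. (\<lambda>z. G' j z + H' j z) holomorphic_on W"
    using G' H' by (auto intro: holomorphic_on_add)
  moreover have "\<forall>z\<in>W. g z + h z = (\<Sum>j<max n m. (G' j z + H' j z) * cnj z ^ j)"
    using G' H' by (simp add: distrib_right sum.distrib)
  ultimately show ?thesis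
    unfolding polyanalytic_on_def by (intro exI[of _ "max n m"] exI[of _ "\<lambda>j z. G' j z + H' j z"]) auto
qed

lemma polyanalytic_on_cmult:
  assumes "polyanalytic_on W g"
  shows "polyanalytic_on W (\<lambda>z. c * g z)"
proof -
  obtain n G where G: "\<And>j. G j holomorphic_on W" "\<And>z. z \<in> W \<Longrightarrow> g z = (\<Sum>j<n. G j z * cnj z ^ j)"
    using assms(1) by (auto simp: polyanalytic_on_def)
  show ?thesis
    unfolding polyanalytic_on_def
    by (rule exI[of _ n], rule exI[of _ "\<lambda>j z. c * G j z"])
       (auto simp: G sum_distrib_left mult.assoc intro!: holomorphic_intros)
qed

text \<open>A real-linear map is determined by its values at 1 and \<i>. Hence \<open>d\<close> and
  \<open>e\<close> are well defined: they are the Wirtinger derivatives in \<open>z\<close> and in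
  \<open>cnj z\<close>.\<close>

lemma wirtinger_unique:
  assumes "(g has_derivative (\<lambda>h. d * h + e * cnj h)) (at z)"
    "(g has_derivative (\<lambda>h. d' * h + e' * cnj h)) (at z)"
  shows "d = d' \<and> e = e'"
proof -
  have eq: "(\<lambda>h. d * h + e * cnj h) = (\<lambda>h. d' * h + e' * cnj h)"
    using has_derivative_unique[OF assms] .
  have 1: "d + e = d' + e'" using fun_cong[OF eq, of 1] by simp
  have "\<i> * (d - e) = \<i> * (d' - e')" using fun_cong[OF eq, of \<i>] by (simp add: algebra_simps)
  then have "d - e = d' - e'" by simp
  then have "(d + e) + (d - e) = (d' + e') + (d' - e')" using 1 by (simp only:)
  then have "d = d'" by simp
  with 1 show ?thesis by simp
qed

lemma has_derivative_cnj_power: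
  assumes "(H has_field_derivative H') (at z)"
  shows "((\<lambda>z. H z * cnj z ^ n) has_derivative
           (\<lambda>h. (H' * cnj z ^ n) * h + (of_nat n * H z * cnj z ^ (n - 1)) * cnj h)) (at z)"
proof -
  have 1: "(H has_derivative (\<lambda>h. H' * h)) (at z)"
    using assms by (simp add: has_field_derivative_def)
  have 2: "((\<lambda>z. cnj z ^ n) has_derivative (\<lambda>h. of_nat n * cnj z ^ (n - 1) * cnj h)) (at z)"
    by (auto intro!: derivative_eq_intros has_derivative_cnj simp: algebra_simps)
  show ?thesis
    by (rule has_derivative_eq_rhs[OF has_derivative_mult[OF 1 2]]) (auto simp: algebra_simps)
qed

section \<open>Polyanalytic functions\<close>

text \<open>Termwise integration in \<open>cnj z\<close> gives a polyanalytic \<open>G\<close> with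
  the same derivative \<open>e\<close>. Then \<open>B - G\<close> satisfies the Cauchy-Riemann
  equations and enters the expansion as its coefficient of index 0.\<close>

lemma polyanalytic_on_antiderivative:
  assumes W: "open W"
    and B: "\<And>z. z \<in> W \<Longrightarrow> (B has_derivative (\<lambda>h. d z * h + e z * cnj h)) (at z)"
    and e: "polyanalytic_on W e"
  shows "polyanalytic_on W B"
proof -
  obtain n H where H: "\<And>j. H j holomorphic_on W" "\<And>z. z \<in> W \<Longrightarrow> e z = (\<Sum>j<n. H j z * cnj z ^ j)"
    using e by (auto simp: polyanalytic_on_def)
  define G where "G = (\<lambda>z. \<Sum>j<n. (H j z / of_nat (Suc j)) * cnj z ^ Suc j)"
  have G: "(G has_derivative (\<lambda>h. (\<Sum>j<n. deriv (H j) z / of_nat (Suc j) * cnj z ^ Suc j) * h + e z * cnj h)) (at z)"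
    if z: "z \<in> W" for z
  proof -
    have 1: "((\<lambda>z. H j z / of_nat (Suc j)) has_field_derivative (deriv (H j) z / of_nat (Suc j))) (at z)" for j
      using holomorphic_derivI[OF H(1) W z] by (intro DERIV_cdivide)
    have "(G has_derivative (\<lambda>h. \<Sum>j<n. deriv (H j) z / of_nat (Suc j) * cnj z ^ Suc j * h
         + of_nat (Suc j) * (H j z / of_nat (Suc j)) * cnj z ^ (Suc j - 1) * cnj h)) (at z)"
      unfolding G_def by (intro has_derivative_sum has_derivative_cnj_power 1)
    also have "(\<lambda>h. \<Sum>j<n. deriv (H j) z / of_nat (Suc j) * cnj z ^ Suc j * h
         + of_nat (Suc j) * (H j z / of_nat (Suc j)) * cnj z ^ (Suc j - 1) * cnj h) =
       (\<lambda>h. (\<Sum>j<n. deriv (H j) z / of_nat (Suc j) * cnj z ^ Suc j) * h + e z * cnj h)"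
      unfolding H(2)[OF z]
      by (simp only: sum.distrib sum_distrib_right) (simp del: of_nat_Suc)
    finally show ?thesis .
  qed
  have A: "(\<lambda>z. B z - G z) holomorphic_on W"
    unfolding holomorphic_on_open[OF W]
  proof (intro ballI)
    fix z assume z: "z \<in> W"
    have "((\<lambda>z. B z - G z) has_derivative
       (\<lambda>h. (d z - (\<Sum>j<n. deriv (H j) z / of_nat (Suc j) * cnj z ^ Suc j)) * h)) (at z)"
      by (rule has_derivative_eq_rhs[OF has_derivative_diff[OF B[OF z] G[OF z]]]) (auto simp: algebra_simps)
    then show "\<exists>f'. ((\<lambda>z. B z - G z) has_field_derivative f') (at z)"
      by (auto simp: has_field_derivative_def)
  qed
  define K where "K = (\<lambda>j. case j of 0 \<Rightarrow> (\<lambda>z. B z - G z) | Suc i \<Rightarrow> (\<lambda>z. H i z / of_nat (Suc i)))"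
  have "\<forall>j. K j holomorphic_on W"
    using A H(1) by (auto simp: K_def split: nat.split intro!: holomorphic_on_divide simp del: of_nat_Suc)
  moreover have "B z = (\<Sum>j<Suc n. K j z * cnj z ^ j)" for z
    unfolding sum.lessThan_Suc_shift by (simp add: K_def G_def)
  ultimately show ?thesis
    unfolding polyanalytic_on_def by (intro exI[of _ "Suc n"] exI[of _ K]) auto
qed

lemma polyanalytic_on_wirtinger_derivs:
  assumes W: "open W"
    and B: "\<And>z. z \<in> W \<Longrightarrow> (B has_derivative (\<lambda>h. d z * h + e z * cnj h)) (at z)"
    and H: "\<And>j. H j holomorphic_on W" "\<And>z. z \<in> W \<Longrightarrow> B z = (\<Sum>j<n. H j z * cnj z ^ j)"
    and z: "z \<in> W"
  shows "d z = (\<Sum>j<n. deriv (H j) z * cnj z ^ j)"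
    "e z = (\<Sum>j<n. of_nat j * H j z * cnj z ^ (j - 1))"
proof -
  have 1: "(H j has_field_derivative (deriv (H j) z)) (at z)" for j
    using holomorphic_derivI[OF H(1) W z] .
  have "((\<lambda>z. \<Sum>j<n. H j z * cnj z ^ j) has_derivative (\<lambda>h. \<Sum>j<n. deriv (H j) z * cnj z ^ j * h
         + of_nat j * H j z * cnj z ^ (j - 1) * cnj h)) (at z)"
    by (intro has_derivative_sum has_derivative_cnj_power 1)
  also have "(\<lambda>h. \<Sum>j<n. deriv (H j) z * cnj z ^ j * h + of_nat j * H j z * cnj z ^ (j - 1) * cnj h) =
       (\<lambda>h. (\<Sum>j<n. deriv (H j) z * cnj z ^ j) * h + (\<Sum>j<n. of_nat j * H j z * cnj z ^ (j - 1)) * cnj h)"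
    by (simp only: sum.distrib sum_distrib_right)
  finally have "(B has_derivative \<dots>) (at z)"
    by (rule has_derivative_transform_within_open[OF _ W z]) (simp add: H(2))
  from wirtinger_unique[OF B[OF z] this]
  show "d z = (\<Sum>j<n. deriv (H j) z * cnj z ^ j)"
    "e z = (\<Sum>j<n. of_nat j * H j z * cnj z ^ (j - 1))" by auto
qed

lemma polyanalytic_on_deriv:
  assumes W: "open W"
    and B: "\<And>z. z \<in> W \<Longrightarrow> (B has_derivative (\<lambda>h. d z * h + e z * cnj h)) (at z)"
    and "polyanalytic_on W B"
  shows "polyanalytic_on W d"
proof -
  obtain n H where H: "\<And>j. H j holomorphic_on W" "\<And>z. z \<in> W \<Longrightarrow> B z = (\<Sum>j<n. H j z * cnj z ^ j)"
    using assms(3) by (auto simp: polyanalytic_on_def)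
  show ?thesis
    unfolding polyanalytic_on_def
    by (rule exI[of _ n], rule exI[of _ "\<lambda>j. deriv (H j)"])
       (auto intro: holomorphic_deriv[OF H(1) W] polyanalytic_on_wirtinger_derivs(1)[OF W B H])
qed

text \<open>Induction on the number of terms: the derivative in \<open>cnj z\<close> drops the
  lowest term and shifts the others, so the induction hypothesis kills all coefficients but the
  first, and the relation itself kills that one.\<close>

lemma polyanalytic_coeffs_eq_0:
  assumes W: "open W" and H: "\<And>j. H j holomorphic_on W"
    and 0: "\<And>z. z \<in> W \<Longrightarrow> (\<Sum>j<n. H j z * cnj z ^ j) = 0"
  shows "z \<in> W \<Longrightarrow> j < n \<Longrightarrow> H j z = 0"
  using H 0
proof (induction n arbitrary: H j z)
  case 0 then show ?case by simp
next
  case (Suc n)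
  have "0 = (\<Sum>j<Suc n. of_nat j * H j z * cnj z ^ (j - 1))" if "z \<in> W" for z
    by (rule polyanalytic_on_wirtinger_derivs(2)[OF W _ Suc.prems(3) _ that, of "\<lambda>z. 0" "\<lambda>z. 0"])
       (use Suc.prems(4) in auto)
  then have "(\<Sum>j<n. (of_nat (Suc j) * H (Suc j) z) * cnj z ^ j) = 0" if "z \<in> W" for z
    using that unfolding sum.lessThan_Suc_shift by simp
  note shifted = this
  have *: "of_nat (Suc i) * H (Suc i) z = 0" if "i < n" "z \<in> W" for i z
    by (rule Suc.IH[of z i "\<lambda>j z. of_nat (Suc j) * H (Suc j) z"])
       (use that Suc.prems(3) shifted in \<open>auto intro!: holomorphic_on_mult simp del: of_nat_Suc\<close>)
  then have *: "H (Suc i) z = 0" if "i < n" "z \<in> W" for i z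
    using that by (metis mult_eq_0_iff of_nat_eq_0_iff nat.distinct(1))
  show ?case
  proof (cases j)
    case 0
    have "(\<Sum>j<Suc n. H j z * cnj z ^ j) = H 0 z"
      unfolding sum.lessThan_Suc_shift using * Suc.prems(1) by simp
    then show ?thesis using 0 Suc.prems by simp
  qed (use * Suc.prems in auto)
qed

text \<open>On an open set \<open>z\<close> and \<open>cnj z\<close> behave as independent
  variables; this converts identities valid on a region into identities between polynomials.\<close>

lemma eval2_cnj_eq_0:
  assumes W: "open W" "W \<noteq> {}" and 0: "\<And>z. z \<in> W \<Longrightarrow> eval2 p (cnj z) z = 0"
  shows "p = 0"
proof (rule poly_eqI)
  fix j
  show "coeff p j = coeff 0 j"
  proof (cases "j \<le> degree p")
    case True
    have "poly (coeff p j) z = 0" if "z \<in> W" for z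
    proof (rule polyanalytic_coeffs_eq_0[OF W(1), of "\<lambda>j. poly (coeff p j)" "Suc (degree p)"])
      show "poly (coeff p j) holomorphic_on W" for j
        by (auto intro!: holomorphic_intros)
      show "(\<Sum>j<Suc (degree p). poly (coeff p j) z * cnj z ^ j) = 0" if "z \<in> W" for z
        using 0[OF that] unfolding eval2_altdef lessThan_Suc_atMost by simp
    qed (use that True in auto)
    then have "W \<subseteq> {z. poly (coeff p j) z = 0}" by auto
    moreover have "infinite W"
      using W finite_imp_not_open by blast
    ultimately have "coeff p j = 0"
      using poly_roots_finite finite_subset by blast
    then show ?thesis by simp
  qed (auto simp: coeff_eq_0)
qed

lemma ex_antideriv_poly:
  fixes p :: "complex poly"
  obtains q where "pderiv q = p"
proof
  have "pderiv (\<Sum>i\<le>degree p. monom (coeff p i / of_nat (Suc i)) (Suc i)) = (\<Sum>i\<le>degree p. monom (coeff p i) i)"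
    using higher_pderiv_sum[of 1 "\<lambda>i. monom (coeff p i / of_nat (Suc i)) (Suc i)" "{..degree p}"]
    by (simp add: pderiv_monom del: of_nat_Suc)
  then show "pderiv (\<Sum>i\<le>degree p. monom (coeff p i / of_nat (Suc i)) (Suc i)) = p"
    by (simp add: poly_as_sum_of_monoms)
qed

lemma eval2_sum_monoms:
  "eval2 (\<Sum>j<n. monom (P j) j) w z = (\<Sum>j<n. poly (P j) z * w ^ j)"
  by (simp add: eval2_eq poly_monom poly_sum mult.commute)

text \<open>Comparing coefficients of \<open>cnj z\<close> shows that every holomorphic coefficient
  of \<open>B\<close> has a polynomial derivative, hence is a polynomial on the connected set.
  Polyanalyticity is essential: \<open>d\<close> alone determines \<open>B\<close> only up to an
  antiholomorphic function.\<close>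

lemma wirtinger_poly_antiderivative:
  assumes W: "open W" "connected W"
    and B: "\<And>z. z \<in> W \<Longrightarrow> (B has_derivative (\<lambda>h. d z * h + e z * cnj h)) (at z)"
    and pB: "polyanalytic_on W B" and d: "wirtinger_poly W d"
  shows "wirtinger_poly W B"
proof (cases "W = {}")
  case True then show ?thesis by (auto simp: wirtinger_poly_def)
next
  case False
  then obtain z0 where z0: "z0 \<in> W" by auto
  obtain n0 H0 where H0: "\<And>j. H0 j holomorphic_on W" "\<And>z. z \<in> W \<Longrightarrow> B z = (\<Sum>j<n0. H0 j z * cnj z ^ j)"
    using pB by (auto simp: polyanalytic_on_def)
  obtain p where p: "\<And>z. z \<in> W \<Longrightarrow> d z = eval2 p (cnj z) z"
    using d by (auto simp: wirtinger_poly_def)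
  define n where "n = max n0 (Suc (degree p))"
  obtain H where H: "\<And>j. H j holomorphic_on W" "\<And>z. z \<in> W \<Longrightarrow> B z = (\<Sum>j<n. H j z * cnj z ^ j)"
    using polyanalytic_pad[OF H0, of n] by (auto simp: n_def)
  have dH: "deriv (H j) z = poly (coeff p j) z" if "j < n" "z \<in> W" for j z
  proof -
    have "(\<lambda>z. deriv (H j) z - poly (coeff p j) z) z = 0"
    proof (rule polyanalytic_coeffs_eq_0[OF W(1), of "\<lambda>j z. deriv (H j) z - poly (coeff p j) z" n])
      show "(\<lambda>z. deriv (H j) z - poly (coeff p j) z) holomorphic_on W" for j
        by (intro holomorphic_intros holomorphic_deriv[OF H(1) W(1)])
      show "(\<Sum>j<n. (deriv (H j) z - poly (coeff p j) z) * cnj z ^ j) = 0" if "z \<in> W" for z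
      proof -
        have "eval2 p (cnj z) z = (\<Sum>j<n. poly (coeff p j) z * cnj z ^ j)"
          by (rule eval2_altdef_lt) (auto simp: n_def)
        then show ?thesis
          using polyanalytic_on_wirtinger_derivs(1)[OF W(1) B H that] p[OF that]
          by (simp add: left_diff_distrib sum_subtractf)
      qed
    qed (use that in auto)
    then show ?thesis by simp
  qed
  have "\<exists>P. \<forall>z\<in>W. H j z = poly P z" if j: "j < n" for j
  proof -
    obtain Q where Q: "pderiv Q = coeff p j" by (rule ex_antideriv_poly)
    have D: "((\<lambda>z. H j z - poly Q z) has_field_derivative 0) (at z)" if z: "z \<in> W" for z
      using DERIV_diff[OF holomorphic_derivI[OF H(1)[of j] W(1) z] poly_DERIV[of Q z]] dH[OF j z]
      by (simp add: Q)
    have "(\<lambda>z. H j z - poly Q z) constant_on W"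
      by (rule DERIV_zero_connected_constant_on[OF W(2,1), of "{}"])
         (use D in \<open>auto intro!: DERIV_continuous_on[OF has_field_derivative_at_within]\<close>)
    then obtain c where "\<forall>z\<in>W. H j z - poly Q z = c" by (auto simp: constant_on_def)
    then show ?thesis by (intro exI[of _ "Q + [:c:]"]) (auto simp: algebra_simps)
  qed
  then obtain P where P: "\<And>j z. j < n \<Longrightarrow> z \<in> W \<Longrightarrow> H j z = poly (P j) z" by metis
  have "\<forall>z\<in>W. B z = eval2 (\<Sum>j<n. monom (P j) j) (cnj z) z"
    unfolding eval2_sum_monoms using H(2) P by simp
  then show ?thesis unfolding wirtinger_poly_def by blast
qed

lemma wirtinger_poly_0: "(\<And>z. z \<in> W \<Longrightarrow> g z = 0) \<Longrightarrow> wirtinger_poly W g"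
  unfolding wirtinger_poly_def by (rule exI[of _ 0]) auto

lemma has_derivative_eval2_cnj:
  "((\<lambda>z. eval2 p (cnj z) z) has_derivative
     (\<lambda>h. eval2 (pderiv2 p) (cnj z) z * h + eval2 (pderiv p) (cnj z) z * cnj h)) (at z)"
  by (rule has_derivative_eq_rhs[OF has_derivative_eval2]) (auto intro!: derivative_eq_intros)

lemma wirtinger_derivs_eval2:
  assumes "open W" "z \<in> W" "\<And>z. z \<in> W \<Longrightarrow> B z = eval2 p (cnj z) z"
    "(B has_derivative (\<lambda>h. d * h + e * cnj h)) (at z)"
  shows "d = eval2 (pderiv2 p) (cnj z) z" "e = eval2 (pderiv p) (cnj z) z"
proof -
  have "(B has_derivative (\<lambda>h. eval2 (pderiv2 p) (cnj z) z * h + eval2 (pderiv p) (cnj z) z * cnj h)) (at z)"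
    by (rule has_derivative_transform_within_open[OF has_derivative_eval2_cnj assms(1,2)]) (simp add: assms(3))
  from wirtinger_unique[OF assms(4) this] show "d = eval2 (pderiv2 p) (cnj z) z" "e = eval2 (pderiv p) (cnj z) z"
    by auto
qed

text \<open>The system is triangular in both directions: \<open>r2\<close> gives
  \<open>e (k + 2)\<close> from lower indices and \<open>d k\<close> from higher ones. The first
  reading controls the dependence on \<open>cnj z\<close>, the second that on \<open>z\<close>,
  starting from the vanishing coefficients above \<open>M\<close>.\<close>

lemma wirtinger_poly_recursion:
  fixes B d e :: "nat \<Rightarrow> complex \<Rightarrow> complex"
  assumes W: "open W" "connected W"
    and B: "\<And>k z. z \<in> W \<Longrightarrow> (B k has_derivative (\<lambda>h. d k z * h + e k z * cnj h)) (at z)"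
    and bd: "\<And>k z. z \<in> W \<Longrightarrow> k > M \<Longrightarrow> B k z = 0"
    and r0: "\<And>z. z \<in> W \<Longrightarrow> e 0 z = 0"
    and r1: "\<And>z. z \<in> W \<Longrightarrow> e 1 z + c 0 * B 0 z = 0"
    and r2: "\<And>k z. z \<in> W \<Longrightarrow> d k z + e (k + 2) z + c (k + 1) * B (k + 1) z = 0"
  shows "wirtinger_poly W (B k)"
proof -
  \<comment> \<open>Two consecutive indices are carried because \<open>r2\<close> refers to two
    predecessors.\<close>
  have pa: "polyanalytic_on W (B k) \<and> polyanalytic_on W (B (Suc k))" for k :: nat
  proof (induction k)
    case 0
    have "polyanalytic_on W (e 0)"
      using polyanalytic_on_0[of W] polyanalytic_on_cong[of W "e 0" "\<lambda>z. 0"] r0 by auto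
    then have 0: "polyanalytic_on W (B 0)"
      using polyanalytic_on_antiderivative[OF W(1) B] by blast
    have "polyanalytic_on W (\<lambda>z. (- c 0) * B 0 z)"
      by (intro polyanalytic_on_cmult 0)
    then have "polyanalytic_on W (e 1)"
      by (subst polyanalytic_on_cong[of W "e 1" "\<lambda>z. (- c 0) * B 0 z"]) (use r1 in \<open>auto simp: eq_neg_iff_add_eq_0\<close>)
    then have "polyanalytic_on W (B 1)"
      using polyanalytic_on_antiderivative[OF W(1) B] by blast
    with 0 show ?case by simp
  next
    case (Suc k)
    have "polyanalytic_on W (d k)"
      using polyanalytic_on_deriv[OF W(1) B] Suc by blast
    then have "polyanalytic_on W (\<lambda>z. (-1) * d k z + (- c (k + 1)) * B (k + 1) z)"
      using Suc by (intro polyanalytic_on_add polyanalytic_on_cmult) auto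
    moreover have "e (k + 2) z = (-1) * d k z + (- c (k + 1)) * B (k + 1) z" if "z \<in> W" for z
      using r2[OF that, of k] by (simp add: algebra_simps add_eq_0_iff)
    ultimately have "polyanalytic_on W (e (k + 2))"
      using polyanalytic_on_cong[of W "e (k + 2)"] by simp
    then have "polyanalytic_on W (B (k + 2))"
      using polyanalytic_on_antiderivative[OF W(1) B] by blast
    with Suc show ?case by simp
  qed
  \<comment> \<open>Downward induction on \<open>k\<close>, phrased as upward induction on the
    distance \<open>j\<close> from the top.\<close>
  have "\<And>k. k + j > M \<Longrightarrow> wirtinger_poly W (B k)" for j
  proof (induction j)
    case 0 then show ?case using bd by (intro wirtinger_poly_0) auto
  next
    case (Suc j)
    have "wirtinger_poly W (B (k + 1))" "wirtinger_poly W (B (k + 2))"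
      using Suc.prems by (auto intro!: Suc.IH)
    then obtain p1 p2 where p: "\<And>z. z \<in> W \<Longrightarrow> B (k + 1) z = eval2 p1 (cnj z) z"
      "\<And>z. z \<in> W \<Longrightarrow> B (k + 2) z = eval2 p2 (cnj z) z"
      unfolding wirtinger_poly_def by metis
    have "e (k + 2) z = eval2 (pderiv p2) (cnj z) z" if "z \<in> W" for z
      using wirtinger_derivs_eval2(2)[OF W(1) that p(2) B[OF that]] .
    moreover have "d k z = - e (k + 2) z - c (k + 1) * B (k + 1) z" if "z \<in> W" for z
    proof -
      have "d k z = (d k z + e (k + 2) z + c (k + 1) * B (k + 1) z) - e (k + 2) z - c (k + 1) * B (k + 1) z"
        by simp
      then show ?thesis by (simp only: r2[OF that]) simp
    qed
    ultimately have "d k z = eval2 (- pderiv p2 - smult [:c (k + 1):] p1) (cnj z) z" if "z \<in> W" for z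
      using p(1)[OF that] that by simp
    then have "wirtinger_poly W (d k)" unfolding wirtinger_poly_def by blast
    then show ?case
      using wirtinger_poly_antiderivative[OF W B] pa by blast
  qed
  from this[of k "Suc M"] show ?thesis by simp
qed

section \<open>Comparing coefficients in the velocity\<close>

lemma sum_shift_recursion:
  fixes v :: "'a :: comm_ring_1"
  assumes "\<And>k. k > M \<Longrightarrow> e k = 0" "\<And>k. k > M \<Longrightarrow> C k = 0"
  shows "(\<Sum>k\<le>M. e k * v ^ k + d k * v ^ (k + 2) + C k * v ^ (k + 1)) =
    e 0 + (e 1 + C 0) * v + (\<Sum>k\<le>M. (d k + e (k + 2) + C (k + 1)) * v ^ (k + 2))"
proof -
  have "(\<Sum>k\<le>M. e k * v ^ k) = (\<Sum>k<Suc (Suc (Suc M)). e k * v ^ k)"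
    using assms(1) by (intro sum.mono_neutral_left) auto
  also have "\<dots> = e 0 + e 1 * v + (\<Sum>k\<le>M. e (k + 2) * v ^ (k + 2))"
    unfolding sum.lessThan_Suc_shift[of _ "Suc (Suc M)"] sum.lessThan_Suc_shift[of _ "Suc M"]
    unfolding lessThan_Suc_atMost
    by (simp add: algebra_simps)
  finally have 1: "(\<Sum>k\<le>M. e k * v ^ k) = \<dots>" .
  have "(\<Sum>k\<le>M. C k * v ^ (k + 1)) = (\<Sum>k<Suc (Suc M). C k * v ^ (k + 1))"
    using assms(2) by (intro sum.mono_neutral_left) auto
  also have "\<dots> = C 0 * v + (\<Sum>k\<le>M. C (k + 1) * v ^ (k + 2))"
    unfolding sum.lessThan_Suc_shift[of _ "Suc M"]
    unfolding lessThan_Suc_atMost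
    by (simp add: algebra_simps)
  finally show ?thesis by (simp add: sum.distrib 1 algebra_simps)
qed

text \<open>A polynomial in \<open>v\<close> with infinitely many zeros vanishes; its coefficients
  are exactly the three families of equations.\<close>

lemma recursion_from_roots:
  fixes d e C :: "nat \<Rightarrow> complex"
  assumes "\<And>k. k > M \<Longrightarrow> e k = 0" "\<And>k. k > M \<Longrightarrow> C k = 0" "\<And>k. k > M \<Longrightarrow> d k = 0"
    and "infinite V"
    and V: "\<And>v. v \<in> V \<Longrightarrow> (\<Sum>k\<le>M. e k * v ^ k + d k * v ^ (k + 2) + C k * v ^ (k + 1)) = 0"
  shows "e 0 = 0" "e 1 + C 0 = 0" "d k + e (k + 2) + C (k + 1) = 0"
proof -
  define P where "P = pCons (e 0) (pCons (e 1 + C 0) (\<Sum>k\<le>M. monom (d k + e (k + 2) + C (k + 1)) k))"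
  have "poly P v = 0" if "v \<in> V" for v
  proof -
    have "poly P v = e 0 + (e 1 + C 0) * v + (\<Sum>k\<le>M. (d k + e (k + 2) + C (k + 1)) * v ^ (k + 2))"
      by (simp add: P_def poly_sum poly_monom algebra_simps sum_distrib_left)
    also have "\<dots> = 0"
      using sum_shift_recursion[of M e C v d] assms(1,2) V[OF that] by simp
    finally show ?thesis .
  qed
  then have "V \<subseteq> {v. poly P v = 0}" by auto
  then have P: "P = 0" using \<open>infinite V\<close> poly_roots_finite finite_subset by blast
  have "e 0 = coeff P 0" by (simp add: P_def)
  then show "e 0 = 0" by (simp add: P)
  have "e 1 + C 0 = coeff P 1" by (simp add: P_def)
  then show "e 1 + C 0 = 0" by (simp add: P)
  show "d k + e (k + 2) + C (k + 1) = 0"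
  proof (cases "k \<le> M")
    case True
    have "d k + e (k + 2) + C (k + 1) = coeff P (k + 2)"
      using True by (simp add: P_def coeff_sum)
    then show ?thesis by (simp add: P)
  qed (use assms in auto)
qed

text \<open>The arguments are the position and its conjugate written through the center
  \<open>z\<close>, its conjugate \<open>w\<close> and the velocity, with \<open>1 / v\<close> for
  \<open>cnj v\<close>. With \<open>z\<close>, \<open>w\<close>, \<open>v\<close> as independent
  complex variables, the recursion says that the sum divided by \<open>v ^ N\<close> has zero
  derivative in \<open>v\<close> on the connected punctured plane, so it equals its value at
  \<open>v = 1\<close>.\<close>

lemma center_function:
  fixes p :: "nat \<Rightarrow> complex poly poly" and r :: real and N :: nat
  defines "c \<equiv> \<lambda>k. \<i> / of_real r * (of_nat k - of_nat N)"
  assumes r: "r \<noteq> 0"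
    and bd: "\<And>k. k > M \<Longrightarrow> p k = 0"
    and r0: "pderiv (p 0) = 0"
    and r1: "pderiv (p 1) + smult [:c 0:] (p 0) = 0"
    and r2: "\<And>k. pderiv2 (p k) + pderiv (p (k + 2)) + smult [:c (k + 1):] (p (k + 1)) = 0"
  obtains F where "polyfun2 F"
    "\<And>z w v. v \<noteq> 0 \<Longrightarrow> F z w * v ^ N =
       (\<Sum>k\<le>M. eval2 (p k) (w + \<i> * of_real r / v) (z - \<i> * of_real r * v) * v ^ k)"
proof
  define S where "S = (\<lambda>z w v. \<Sum>k\<le>M. eval2 (p k) (w + \<i> * of_real r / v) (z - \<i> * of_real r * v) * v ^ k)"
  show "polyfun2 (\<lambda>z w. S z w 1)"
    unfolding S_def
    by (intro polyfun2_sum polyfun2_mult polyfun2_compose polyfun2_add polyfun2_diff polyfun2_const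
        polyfun2_fst polyfun2_snd)
  fix z w v :: complex assume v: "v \<noteq> 0"
  have D: "((\<lambda>v. S z w v / v ^ N) has_field_derivative 0) (at v)" if v: "v \<noteq> 0" for v
  proof -
    define X Y where "X = (w + \<i> * of_real r / v)" and "Y = (z - \<i> * of_real r * v)"
    define S' where "S' = (\<Sum>k\<le>M. (eval2 (pderiv (p k)) X Y * (- \<i> * of_real r / v^2) +
        eval2 (pderiv2 (p k)) X Y * (- \<i> * of_real r)) * v ^ k + of_nat k * v ^ (k - 1) * eval2 (p k) X Y)"
    have "((\<lambda>v. S z w v) has_field_derivative S') (at v)"
      unfolding S_def S'_def
    proof (rule DERIV_sum)
      fix k
      have 1: "((\<lambda>v. w + \<i> * of_real r / v) has_field_derivative (- \<i> * of_real r / v^2)) (at v)"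
        using v by (auto intro!: derivative_eq_intros simp: power2_eq_square)
      have 2: "((\<lambda>v. z - \<i> * of_real r * v) has_field_derivative (- \<i> * of_real r)) (at v)"
        by (auto intro!: derivative_eq_intros)
      have 3: "((\<lambda>v. v ^ k) has_field_derivative (of_nat k * v ^ (k - 1))) (at v)"
        by (auto intro!: derivative_eq_intros)
      show "((\<lambda>v. eval2 (p k) (w + \<i> * of_real r / v) (z - \<i> * of_real r * v) * v ^ k) has_field_derivative
         (eval2 (pderiv (p k)) X Y * (- \<i> * of_real r / v^2) +
        eval2 (pderiv2 (p k)) X Y * (- \<i> * of_real r)) * v ^ k + of_nat k * v ^ (k - 1) * eval2 (p k) X Y) (at v)"
        using DERIV_mult[OF has_field_derivative_eval2[OF 1 2] 3] unfolding X_def Y_def .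
    qed
    then have "((\<lambda>v. S z w v / v ^ N) has_field_derivative
        (S' * v ^ N - S z w v * (of_nat N * v ^ (N - 1))) / (v ^ N * v ^ N)) (at v)"
      by (rule DERIV_divide) (auto intro!: derivative_eq_intros simp: v)
    moreover have "S' * v ^ N - S z w v * (of_nat N * v ^ (N - 1)) = 0"
    proof -
      let ?e = "\<lambda>k. eval2 (pderiv (p k)) X Y" and ?d = "\<lambda>k. eval2 (pderiv2 (p k)) X Y"
      let ?C = "\<lambda>k. c k * eval2 (p k) X Y"
      have ev: "eval2 (q :: complex poly poly) X Y = 0" if "q = 0" for q using that by simp
      have "(\<Sum>k\<le>M. ?e k * v ^ k + ?d k * v ^ (k + 2) + ?C k * v ^ (k + 1)) = 
         ?e 0 + (?e 1 + ?C 0) * v + (\<Sum>k\<le>M. (?d k + ?e (k + 2) + ?C (k + 1)) * v ^ (k + 2))"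
        by (rule sum_shift_recursion) (auto simp: bd)
      also have "\<dots> = 0"
        using ev[OF r0] ev[OF r1] ev[OF r2] by simp
      finally have 0: "(\<Sum>k\<le>M. ?e k * v ^ k + ?d k * v ^ (k + 2) + ?C k * v ^ (k + 1)) = 0" .
      have k: "of_nat k * v ^ (k - 1) * v = of_nat k * v ^ k" for k :: nat
        by (cases k) auto
      \<comment> \<open>The factor \<open>v * v\<close> in front of \<open>S'\<close> clears the
        denominator in the derivative of \<open>X\<close> and produces the summands of the
        recursion.\<close>
      have "v * (S' * v - of_nat N * S z w v) = (\<Sum>k\<le>M. v * (((?e k * (- \<i> * of_real r / v^2) +
        ?d k * (- \<i> * of_real r)) * v ^ k + of_nat k * v ^ (k - 1) * eval2 (p k) X Y) * v
        - of_nat N * (eval2 (p k) X Y * v ^ k)))"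
        by (simp add: S'_def S_def X_def[symmetric] Y_def[symmetric] sum_distrib_left sum_distrib_right sum_subtractf right_diff_distrib)
      also have "\<dots> = (\<Sum>k\<le>M. (- \<i> * of_real r) * (?e k * v ^ k + ?d k * v ^ (k + 2) + ?C k * v ^ (k + 1)))"
      proof (intro sum.cong refl)
        fix k
        have "v * (((?e k * (- \<i> * of_real r / v^2) + ?d k * (- \<i> * of_real r)) * v ^ k
           + of_nat k * v ^ (k - 1) * eval2 (p k) X Y) * v - of_nat N * (eval2 (p k) X Y * v ^ k))
          = v * v * (?e k * (- \<i> * of_real r / v^2) + ?d k * (- \<i> * of_real r)) * v ^ k
           + v * (of_nat k * v ^ (k - 1) * v) * eval2 (p k) X Y - v * of_nat N * (eval2 (p k) X Y * v ^ k)"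
          by (simp add: algebra_simps)
        also have "\<dots> = (- \<i> * of_real r) * (?e k * v ^ k + ?d k * v ^ (k + 2) + ?C k * v ^ (k + 1))"
          unfolding k c_def using v r by (simp add: field_simps power2_eq_square)
        finally show "v * (((?e k * (- \<i> * of_real r / v^2) + ?d k * (- \<i> * of_real r)) * v ^ k
           + of_nat k * v ^ (k - 1) * eval2 (p k) X Y) * v - of_nat N * (eval2 (p k) X Y * v ^ k)) = \<dots>" .
      qed
      also have "\<dots> = 0" unfolding sum_distrib_left[symmetric] 0 by simp
      finally have SV: "S' * v = of_nat N * S z w v" using v by simp
      have NV: "(of_nat N * v ^ (N - 1)) * v = of_nat N * v ^ N" by (cases N) auto
      have "S' * v * v ^ N - S z w v * ((of_nat N * v ^ (N - 1)) * v) = 0"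
        unfolding SV NV by simp
      then have "(S' * v ^ N - S z w v * (of_nat N * v ^ (N - 1))) * v = 0"
        by (simp only: left_diff_distrib mult.assoc mult.commute[of "v ^ N" v])
      then show ?thesis using v by simp
    qed
    ultimately show ?thesis by simp
  qed
  have "(\<lambda>v. S z w v / v ^ N) constant_on (- {0})"
  proof (rule DERIV_zero_connected_constant_on[where K = "{}"])
    show "connected (- {0 :: complex})"
      by (intro connected_punctured_universe) simp
  qed (use D in \<open>auto intro!: DERIV_continuous_on[OF has_field_derivative_at_within]\<close>)
  then obtain K where K: "\<And>v. v \<noteq> 0 \<Longrightarrow> S z w v / v ^ N = K" by (auto simp: constant_on_def)
  have "S z w v / v ^ N = S z w 1 / 1 ^ N" using K[OF v] K[OF one_neq_zero] by (rule trans[OF _ sym])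
  then have "S z w v = S z w 1 * v ^ N"
    using nonzero_divide_eq_eq[of "v ^ N" "S z w v" "S z w 1"] v by simp
  then show "S z w 1 * v ^ N = (\<Sum>k\<le>M. eval2 (p k) (w + \<i> * of_real r / v) (z - \<i> * of_real r * v) * v ^ k)"
    by (simp only: S_def)
qed

section \<open>The billiard boundary and its parallel curves\<close>

lemma smooth_curveD:
  assumes "smooth_curve g"
  shows "(g has_vector_derivative vector_derivative g (at s)) (at s)"
    "smooth_curve (\<lambda>s. vector_derivative g (at s))"
proof -
  from assms obtain g' where g': "\<And>t. (g has_vector_derivative g' t) (at t)" "smooth_curve g'"
    by (cases rule: smooth_curve.cases) auto
  then have "(\<lambda>s. vector_derivative g (at s)) = g'"
    by (auto simp: fun_eq_iff vector_derivative_at)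
  then show "(g has_vector_derivative vector_derivative g (at s)) (at s)"
    "smooth_curve (\<lambda>s. vector_derivative g (at s))"
    using g' by (auto simp: fun_eq_iff)
qed

locale jordan_ccw =
  fixes \<gamma> :: "real \<Rightarrow> complex" and L :: real
  assumes ccw: "smooth_jordan_ccw \<gamma> L"
begin

abbreviation "T \<equiv> tangent \<gamma>"
abbreviation "nu \<equiv> normal \<gamma>"
abbreviation "par \<equiv> parallel_curve \<gamma>"
abbreviation "crv \<equiv> \<gamma> ` {0..L}"

definition "kvec s = vector_derivative T (at s)"

lemma L_pos: "L > 0" using ccw by (simp add: smooth_jordan_ccw_def)
lemma periodic: "\<gamma> (s + L) = \<gamma> s" using ccw by (simp add: smooth_jordan_ccw_def)
lemma norm_T [simp]: "norm (T s) = 1" using ccw by (simp add: smooth_jordan_ccw_def)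
lemma T_neq_0 [simp]: "T s \<noteq> 0" by (metis norm_T norm_zero zero_neq_one)
lemma norm_nu [simp]: "norm (nu s) = 1" by (simp add: normal_def norm_mult)

lemma T_deriv: "(\<gamma> has_vector_derivative T s) (at s)"
  using ccw smooth_curveD(1) by (auto simp: smooth_jordan_ccw_def tangent_def)

lemma smooth_T: "smooth_curve T"
  using ccw smooth_curveD(2) by (auto simp: smooth_jordan_ccw_def tangent_def[abs_def])

lemma kvec_deriv: "(T has_vector_derivative kvec s) (at s)"
  unfolding kvec_def by (rule smooth_curveD(1)[OF smooth_T])

lemma smooth_kvec: "smooth_curve kvec"
  using smooth_curveD(2)[OF smooth_T] by (simp add: kvec_def[abs_def])

lemma nu_deriv: "(nu has_vector_derivative \<i> * kvec s) (at s)"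
  unfolding normal_def[abs_def] by (intro derivative_intros kvec_deriv)

lemma par_deriv: "(par \<tau> has_vector_derivative (T s + of_real \<tau> * (\<i> * kvec s))) (at s)"
  unfolding parallel_curve_def[abs_def] by (intro derivative_intros T_deriv nu_deriv)

lemma cont_\<gamma>: "continuous_on S \<gamma>" and cont_T: "continuous_on S T" and cont_kvec: "continuous_on S kvec"
  using T_deriv kvec_deriv smooth_curveD(1)[OF smooth_kvec]
  by (meson continuous_at_imp_continuous_on has_vector_derivative_continuous)+

lemma cont_nu: "continuous_on S nu"
  unfolding normal_def[abs_def] by (intro continuous_intros cont_T)

lemma cont_par: "continuous_on S (\<lambda>(s, \<tau>). par \<tau> s)"
  unfolding parallel_curve_def case_prod_unfold
  by (intro continuous_intros continuous_on_compose2[OF cont_\<gamma>] continuous_on_compose2[OF cont_nu]) auto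

lemma shift_deriv: "((\<lambda>s. s + L) has_vector_derivative 1) (at s)"
  by (auto intro!: derivative_eq_intros)

lemma periodic_T: "T (s + L) = T s"
proof -
  have "((\<lambda>s. \<gamma> (s + L)) has_vector_derivative T (s + L)) (at s)"
    using vector_diff_chain_at[OF shift_deriv T_deriv] by (simp add: o_def)
  then have "(\<gamma> has_vector_derivative T (s + L)) (at s)" by (simp add: periodic)
  then show ?thesis using T_deriv vector_derivative_at by metis
qed

lemma periodic_kvec: "kvec (s + L) = kvec s"
proof -
  have "((\<lambda>s. T (s + L)) has_vector_derivative kvec (s + L)) (at s)"
    using vector_diff_chain_at[OF shift_deriv kvec_deriv] by (simp add: o_def)
  then have "(T has_vector_derivative kvec (s + L)) (at s)" by (simp add: periodic_T)
  then show ?thesis using kvec_deriv vector_derivative_at by metis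
qed

lemma periodic_int:
  "\<gamma> (s + of_int k * L) = \<gamma> s \<and> T (s + of_int k * L) = T s \<and> kvec (s + of_int k * L) = kvec s"
proof (induction k rule: int_induct[where k = 0])
  case (step1 i)
  then show ?case
    using periodic[of "s + of_int i * L"] periodic_T[of "s + of_int i * L"] periodic_kvec[of "s + of_int i * L"]
    by (simp add: algebra_simps)
next
  case (step2 i)
  then show ?case
    using periodic[of "s + of_int (i - 1) * L"] periodic_T[of "s + of_int (i - 1) * L"] periodic_kvec[of "s + of_int (i - 1) * L"]
    by (simp add: algebra_simps)
qed auto

lemma reduce:
  obtains u where "u \<in> {0..<L}" "\<gamma> s = \<gamma> u" "T s = T u" "kvec s = kvec u"
proof -
  let ?k = "- \<lfloor>s / L\<rfloor>"
  have "s + of_int ?k * L \<in> {0..<L}"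
    using L_pos floor_divide_lower[of L s] floor_divide_upper[of L s] by (auto simp: algebra_simps)
  then show ?thesis using periodic_int[of s ?k] that by metis
qed

lemma inj: "inj_on \<gamma> {0..<L}" using ccw by (simp add: smooth_jordan_ccw_def)

lemma crv_range: "crv = range \<gamma>"
proof -
  have "\<gamma> s \<in> crv" for s by (metis (full_types) atLeastAtMost_iff atLeastLessThan_iff imageI less_le reduce)
  then show ?thesis by auto
qed

lemma compact_crv: "compact crv" by (intro compact_continuous_image cont_\<gamma>) auto
lemma crv_ne: "crv \<noteq> {}" using L_pos by auto

lemma same_T: assumes "\<gamma> s = \<gamma> s'" shows "T s = T s'"
proof -
  obtain u where u: "u \<in> {0..<L}" "\<gamma> s = \<gamma> u" "T s = T u" by (rule reduce[of s]) auto
  obtain u' where u': "u' \<in> {0..<L}" "\<gamma> s' = \<gamma> u'" "T s' = T u'" by (rule reduce[of s']) auto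
  show ?thesis using inj_onD[OF inj, of u u'] u u' assms by simp
qed

text \<open>At a parameter minimizing the squared distance to \<open>w\<close> the derivative
  vanishes, so the connecting vector is normal. This is how arbitrary points acquire tubular
  coordinates.\<close>

lemma nearest_point:
  obtains s \<tau> where "w = par \<tau> s" "\<bar>\<tau>\<bar> = infdist w crv"
proof -
  obtain y where y: "y \<in> crv" "infdist w crv = dist w y"
    using infdist_attains_inf[OF compact_imp_closed[OF compact_crv] crv_ne, of w] by auto
  then obtain s where s: "y = \<gamma> s" by auto
  have D: "((\<lambda>s. (w - \<gamma> s) \<bullet> (w - \<gamma> s)) has_real_derivative (- 2 * ((w - \<gamma> s) \<bullet> T s))) (at s)"
  proof -
    have "((\<lambda>s. (w - \<gamma> s) \<bullet> (w - \<gamma> s)) has_vector_derivative ((w - \<gamma> s) \<bullet> (0 - T s) + (0 - T s) \<bullet> (w - \<gamma> s))) (at s)"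
      by (intro bounded_bilinear.has_vector_derivative[OF bounded_bilinear_inner]
          has_vector_derivative_diff has_vector_derivative_const T_deriv)
    then show ?thesis by (simp add: has_real_derivative_iff_has_vector_derivative inner_commute)
  qed
  have "(w - \<gamma> s) \<bullet> (w - \<gamma> s) \<le> (w - \<gamma> u) \<bullet> (w - \<gamma> u)" for u
  proof -
    have "dist w (\<gamma> s) \<le> dist w (\<gamma> u)"
      using infdist_le[of "\<gamma> u" crv w] y s by (auto simp: crv_range)
    then show ?thesis by (simp add: dist_norm norm_eq_sqrt_inner)
  qed
  then have "- 2 * ((w - \<gamma> s) \<bullet> T s) = 0"
    using DERIV_local_min[OF D, of 1] by auto
  then have orth: "(w - \<gamma> s) \<bullet> T s = 0" by simp
  define \<tau> where "\<tau> = (w - \<gamma> s) \<bullet> nu s"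
  have "w - \<gamma> s = of_real ((w - \<gamma> s) \<bullet> T s) * T s + of_real \<tau> * nu s"
  proof -
    have "T s * cnj (T s) = 1" by (simp add: complex_norm_square[symmetric])
    then have "w - \<gamma> s = (w - \<gamma> s) * cnj (T s) * T s" by (simp add: mult.assoc mult.commute)
    moreover have "(w - \<gamma> s) * cnj (T s) = of_real ((w - \<gamma> s) \<bullet> T s) + \<i> * of_real \<tau>"
      by (auto simp: complex_eq_iff \<tau>_def normal_def inner_complex_def algebra_simps)
    ultimately have "w - \<gamma> s = (of_real ((w - \<gamma> s) \<bullet> T s) + \<i> * of_real \<tau>) * T s" by simp
    then show ?thesis by (simp add: normal_def algebra_simps)
  qed
  then have w: "w = par \<tau> s"
    unfolding orth parallel_curve_def by (metis add.commute add_0 diff_add_cancel mult_zero_left of_real_0)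
  moreover have "dist w (\<gamma> s) = \<bar>\<tau>\<bar>" by (simp add: w parallel_curve_def dist_norm norm_mult)
  ultimately show ?thesis using that y s by metis
qed

lemma kvec_bound: obtains M where "M > 0" "\<And>s. norm (kvec s) \<le> M"
proof -
  have "compact (kvec ` {0..L})" by (intro compact_continuous_image cont_kvec) auto
  then obtain M where M: "M > 0" "\<And>x. x \<in> kvec ` {0..L} \<Longrightarrow> norm x \<le> M"
    using compact_imp_bounded bounded_pos by metis
  have *: "norm (kvec s) \<le> M" for s
  proof -
    obtain u where u: "u \<in> {0..<L}" "kvec s = kvec u" by (rule reduce[of s]) auto
    then have "kvec s \<in> kvec ` {0..L}" by auto
    then show ?thesis by (rule M(2))
  qed
  show ?thesis by (rule that[OF M(1) *])
qed

text \<open>Displays the immersion determinant as a perturbation of 1 that is small with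
  \<open>\<tau>\<close>.\<close>

lemma immersion_eq:
  "Im (cnj (T s + of_real \<tau> * (\<i> * kvec s)) * nu s) = 1 + Re (of_real \<tau> * (\<i> * kvec s) * cnj (T s))"
proof -
  have "(Re (T s))^2 + (Im (T s))^2 = 1" using cmod_power2[of "T s"] by simp
  then show ?thesis by (simp add: normal_def power2_eq_square algebra_simps)
qed

text \<open>Ensures that the supremum in \<open>tube_radius\<close> is taken over a nonempty set.
  Parameters less than \<open>\<delta>\<close> apart are separated by the tangential motion of
  \<open>\<gamma>\<close>, the others by compactness.\<close>

lemma ex_tube_ok: "\<exists>t>0. tube_ok \<gamma> L t"
proof -
  obtain M where M: "M > 0" "\<And>s. norm (kvec s) \<le> M" by (rule kvec_bound) blast
  have lip: "norm (T u - T s) \<le> M * \<bar>u - s\<bar>" for u s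
  proof -
    have "norm (T u - T s) \<le> M * norm (u - s)"
    proof (rule differentiable_bound[of UNIV T "\<lambda>s h. h *\<^sub>R kvec s"])
      show "(T has_derivative (\<lambda>h. h *\<^sub>R kvec x)) (at x within UNIV)" for x
        using kvec_deriv by (simp add: has_vector_derivative_def)
      show "onorm (\<lambda>h. h *\<^sub>R kvec x) \<le> M" for x
        by (rule onorm_le) (use mult_right_mono[OF M(2)[of x] abs_ge_zero] in \<open>simp add: mult.commute\<close>)
    qed auto
    then show ?thesis by simp
  qed
  \<comment> \<open>\<open>M * \<delta> \<le> 1 / 2\<close> keeps the tangent within 1/2 of its
    value at the base point, so the tangential displacement is at least half the parameter
    difference.\<close>
  define \<delta> where "\<delta> = min (1 / (2 * M)) (L / 2)"
  have \<delta>: "\<delta> > 0" "M * \<delta> \<le> 1/2" "\<delta> \<le> L / 2"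
    using M L_pos by (auto simp: \<delta>_def min_def field_simps)
  have mono: "\<bar>h\<bar> / 2 \<le> \<bar>(\<gamma> (s + h) - \<gamma> s) \<bullet> T s\<bar>" if "\<bar>h\<bar> \<le> \<delta>" for s h
  proof -
    have "norm (\<gamma> (s + h) - \<gamma> s - (s + h - s) *\<^sub>R T s) \<le> norm (s + h - s) * (1 / 2)"
    proof (rule vector_differentiable_bound_linearization[where S = "closed_segment s (s + h)"])
      show "norm (T x - T s) \<le> 1 / 2" if "x \<in> closed_segment s (s + h)" for x
      proof -
        have "\<bar>x - s\<bar> \<le> \<bar>h\<bar>" using that by (auto simp: closed_segment_eq_real_ivl split: if_splits)
        then have "M * \<bar>x - s\<bar> \<le> M * \<delta>" using \<open>\<bar>h\<bar> \<le> \<delta>\<close> M(1) by (intro mult_left_mono) auto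
        then show ?thesis using lip[of x s] \<delta>(2) by linarith
      qed
    qed (auto intro: has_vector_derivative_at_within T_deriv)
    then have "\<bar>(\<gamma> (s + h) - \<gamma> s - h *\<^sub>R T s) \<bullet> T s\<bar> \<le> \<bar>h\<bar> / 2"
      using Cauchy_Schwarz_ineq2[of "\<gamma> (s + h) - \<gamma> s - h *\<^sub>R T s" "T s"] by simp
    moreover have "(\<gamma> (s + h) - \<gamma> s - h *\<^sub>R T s) \<bullet> T s = (\<gamma> (s + h) - \<gamma> s) \<bullet> T s - h"
      by (simp add: inner_diff_left dot_square_norm)
    ultimately show ?thesis by linarith
  qed
  define C where "C = {0..L} \<times> {h. \<delta> \<le> \<bar>h\<bar> \<and> \<bar>h\<bar> \<le> L / 2}"
  have neq: "\<gamma> (s + h) \<noteq> \<gamma> s" if "0 < \<bar>h\<bar>" "\<bar>h\<bar> \<le> L / 2" for s h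
  proof
    assume eq: "\<gamma> (s + h) = \<gamma> s"
    have aux: False if "0 < h" "h \<le> L / 2" "\<gamma> (s + h) = \<gamma> s" for s h
    proof -
      define k where "k = \<lfloor>s / L\<rfloor>"
      define u where "u = s - of_int k * L"
      have u: "0 \<le> u" "u < L"
        using L_pos floor_divide_lower[of L s] floor_divide_upper[of L s] by (auto simp: u_def k_def algebra_simps)
      have gu: "\<gamma> u = \<gamma> s" using periodic_int[of s "-k"] by (simp add: u_def)
      have guh: "\<gamma> (u + h) = \<gamma> (s + h)" using periodic_int[of "s + h" "-k"] by (simp add: u_def algebra_simps)
      show False
      proof (cases "u + h < L")
        case True
        then have "u + h = u" using inj_onD[OF inj, of "u + h" u] gu guh that u by auto
        then show False using that by simp
      next
        case False
        have "\<gamma> (u + h - L) = \<gamma> (u + h)" using periodic[of "u + h - L"] by simp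
        then have "u + h - L = u" using inj_onD[OF inj, of "u + h - L" u] gu guh that u False by auto
        then show False using that L_pos by simp
      qed
    qed
    show False
    proof (cases "h > 0")
      case True then show False using aux[of h s] eq that by simp
    next
      case False
      then show False using aux[of "-h" "s + h"] eq that by simp
    qed
  qed
  have "closed {h :: real. \<delta> \<le> \<bar>h\<bar> \<and> \<bar>h\<bar> \<le> L / 2}"
    by (intro closed_Collect_conj closed_Collect_le continuous_intros)
  moreover have "bounded {h :: real. \<delta> \<le> \<bar>h\<bar> \<and> \<bar>h\<bar> \<le> L / 2}"
    by (rule boundedI[of _ "L / 2"]) auto
  ultimately have "compact C" unfolding C_def by (intro compact_Times) (auto simp: compact_eq_bounded_closed)
  moreover have "C \<noteq> {}" using \<delta> L_pos by (auto simp: C_def intro!: exI[of _ \<delta>])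
  moreover have "continuous_on C (\<lambda>(s, h). norm (\<gamma> (s + h) - \<gamma> s))"
    unfolding case_prod_unfold
    by (intro continuous_intros continuous_on_compose2[OF cont_\<gamma>]) auto
  ultimately obtain x where x: "x \<in> C" "\<And>y. y \<in> C \<Longrightarrow> (\<lambda>(s, h). norm (\<gamma> (s + h) - \<gamma> s)) x \<le> (\<lambda>(s, h). norm (\<gamma> (s + h) - \<gamma> s)) y"
    using continuous_attains_inf[of C] by blast
  define c where "c = (\<lambda>(s, h). norm (\<gamma> (s + h) - \<gamma> s)) x"
  have c: "c > 0" using x(1) neq \<delta>(1) by (auto simp: c_def C_def case_prod_unfold)
  have cl: "c \<le> norm (\<gamma> (s + h) - \<gamma> s)" if "s \<in> {0..L}" "\<delta> \<le> \<bar>h\<bar>" "\<bar>h\<bar> \<le> L / 2" for s h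
    using x(2)[of "(s, h)"] that by (auto simp: c_def C_def)
  \<comment> \<open>The bound \<open>1 / (4 * M)\<close> limits the tangential drift of the normals
    to |h| / 4, against at least |h| / 2 for \<open>\<gamma>\<close>; the bound \<open>c / 2\<close>
    keeps two normal segments together shorter than the gap \<open>c\<close>.\<close>
  define t where "t = min (1 / (4 * M)) (c / 2)"
  have t: "t > 0" "t * M \<le> 1 / 4" "2 * t \<le> c" using M c by (auto simp: t_def min_def field_simps)
  have "tube_ok \<gamma> L t"
    unfolding tube_ok_def
  proof (intro conjI allI impI)
    fix s \<tau> :: real assume \<tau>: "\<bar>\<tau>\<bar> < t"
    have "\<bar>Re (of_real \<tau> * (\<i> * kvec s) * cnj (T s))\<bar> \<le> norm (of_real \<tau> * (\<i> * kvec s) * cnj (T s))"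
      by (rule abs_Re_le_cmod)
    also have "\<dots> = \<bar>\<tau>\<bar> * norm (kvec s)" by (simp add: norm_mult)
    also have "\<dots> \<le> t * M" using \<tau> M t by (intro mult_mono) auto
    finally show "Im (cnj (T s + of_real \<tau> * (\<i> * vector_derivative T (at s))) * nu s) \<noteq> 0"
      using t unfolding kvec_def[symmetric] immersion_eq by linarith
  next
    show "inj_on (\<lambda>(s, \<tau>). par \<tau> s) ({0..<L} \<times> {- t<..<t})"
    proof (rule inj_onI, clarsimp)
      fix s \<tau> s' \<tau>' :: real
      assume s: "0 \<le> s" "s < L" "0 \<le> s'" "s' < L" and \<tau>: "- t < \<tau>" "\<tau> < t" "- t < \<tau>'" "\<tau>' < t"
        and eq: "par \<tau> s = par \<tau>' s'"
      \<comment> \<open>The signed parameter difference is reduced modulo \<open>L\<close>, since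
        parameters near 0 and near \<open>L\<close> are neighbours on the curve.\<close>
      obtain h where h: "\<bar>h\<bar> \<le> L / 2" "\<gamma> (s + h) = \<gamma> s'"
      proof -
        consider "\<bar>s' - s\<bar> \<le> L / 2" | "s' - s > L / 2" | "s' - s < - L / 2" by linarith
        then show ?thesis
        proof cases
          case 1 then show ?thesis using that[of "s' - s"] by simp
        next
          case 2 then show ?thesis using that[of "s' - s - L"] s periodic[of "s' - L"] by simp
        next
          case 3 then show ?thesis using that[of "s' - s + L"] s periodic[of "s'"] by (simp add: add_ac)
        qed
      qed
      have nu: "nu (s + h) = nu s'" using same_T[OF h(2)] by (simp add: normal_def)
      have diff: "\<gamma> (s + h) - \<gamma> s = of_real \<tau> * nu s - of_real \<tau>' * nu (s + h)"
        using eq h(2) nu by (simp add: parallel_curve_def algebra_simps)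
      have "\<bar>h\<bar> < \<delta>"
      proof (rule ccontr)
        assume "\<not> ?thesis"
        then have "c \<le> norm (\<gamma> (s + h) - \<gamma> s)" using h s by (intro cl) auto
        also have "\<dots> \<le> \<bar>\<tau>\<bar> + \<bar>\<tau>'\<bar>"
          unfolding diff by (rule order_trans[OF norm_triangle_ineq4]) (simp add: norm_mult)
        finally show False using \<tau> t by linarith
      qed
      moreover have "(\<gamma> (s + h) - \<gamma> s) \<bullet> T s = - \<tau>' * ((nu (s + h) - nu s) \<bullet> T s)"
      proof -
        have "nu s \<bullet> T s = 0" by (simp add: normal_def inner_complex_def)
        then show ?thesis unfolding diff
          by (simp add: inner_diff_left scaleR_conv_of_real[symmetric])
      qed
      moreover have "\<bar>\<tau>' * ((nu (s + h) - nu s) \<bullet> T s)\<bar> \<le> t * (M * \<bar>h\<bar>)"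
      proof -
        have "\<bar>(nu (s + h) - nu s) \<bullet> T s\<bar> \<le> norm (nu (s + h) - nu s)"
          using Cauchy_Schwarz_ineq2[of "nu (s + h) - nu s" "T s"] by simp
        also have "\<dots> = norm (T (s + h) - T s)"
          by (simp add: normal_def right_diff_distrib[symmetric] norm_mult)
        also have "\<dots> \<le> M * \<bar>h\<bar>" using lip[of "s + h" s] by simp
        finally show ?thesis unfolding abs_mult using \<tau> by (intro mult_mono) auto
      qed
      moreover have "t * (M * \<bar>h\<bar>) \<le> \<bar>h\<bar> / 4"
        using mult_right_mono[OF t(2), of "\<bar>h\<bar>"] by (simp add: mult.assoc)
      ultimately have "\<bar>h\<bar> / 2 \<le> \<bar>h\<bar> / 4" using mono[of h s] by (simp add: abs_mult)
      then have "h = 0" by simp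
      then have "s = s'" using h(2) inj_onD[OF inj, of s s'] s by simp
      moreover have "\<tau> = \<tau>'"
      proof -
        have "of_real \<tau> * nu s = of_real \<tau>' * nu s" using diff \<open>h = 0\<close> by simp
        moreover have "nu s \<noteq> 0" by (simp add: normal_def)
        ultimately show ?thesis by simp
      qed
      ultimately show "s = s' \<and> \<tau> = \<tau>'" by simp
    qed
  qed
  with t(1) show ?thesis by blast
qed

section \<open>Winding number of the boundary and its jump\<close>

definition "loop u = \<gamma> (L * u)"

lemma path_image_loop: "path_image loop = crv"
proof -
  have "path_image loop = \<gamma> ` ((*) L ` {0..1})" by (simp add: path_image_def loop_def image_image)
  then show ?thesis using L_pos by (simp add: image_mult_atLeastAtMost)
qed

lemma loop_deriv: "(loop has_vector_derivative L *\<^sub>R T (L * u)) (at u)"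
proof -
  have "((\<lambda>u. L * u) has_vector_derivative L) (at u)" by (auto intro!: derivative_eq_intros)
  from vector_diff_chain_at[OF this T_deriv] show ?thesis by (simp add: o_def loop_def[abs_def])
qed

lemma valid_path_loop: "valid_path loop"
proof -
  have "continuous_on {0..1} (\<lambda>u. L *\<^sub>R T (L * u))"
    by (intro continuous_intros continuous_on_compose2[OF cont_T]) auto
  then show ?thesis
    unfolding valid_path_def using loop_deriv
    by (intro C1_differentiable_imp_piecewise, unfold C1_differentiable_on_def)
       (intro exI[of _ "\<lambda>u. L *\<^sub>R T (L * u)"] conjI ballI)
qed

lemma loop_closed: "pathfinish loop = pathstart loop"
  using periodic[of 0] by (simp add: pathfinish_def pathstart_def loop_def)

lemma simple_path_loop: "simple_path loop"
proof (rule simple_pathI)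
  show "path loop" by (rule valid_path_imp_path[OF valid_path_loop])
  fix x y :: real assume xy: "0 \<le> x" "x < y" "y \<le> 1" "loop x = loop y"
  show "x = 0 \<and> y = 1"
  proof (cases "y = 1")
    case True
    then have "\<gamma> (L * x) = \<gamma> 0" using xy periodic[of 0] by (simp add: loop_def)
    then have "L * x = 0" using inj_onD[OF inj, of "L * x" 0] xy L_pos by auto
    then show ?thesis using True L_pos by simp
  next
    case False
    then have "L * x = L * y" using inj_onD[OF inj, of "L * x" "L * y"] xy L_pos by (auto simp: loop_def)
    then show ?thesis using L_pos xy by simp
  qed
qed

lemmas jordan = Jordan_inside_outside[OF simple_path_loop loop_closed, unfolded path_image_loop]

lemma open_in: "open (inside crv)" and open_out: "open (outside crv)"
  and in_out: "inside crv \<inter> outside crv = {}" "inside crv \<union> outside crv = - crv"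
  and frontier_in: "frontier (inside crv) = crv" and frontier_out: "frontier (outside crv) = crv"
  using jordan by auto

lemma wn_inside: "w \<in> inside crv \<Longrightarrow> winding_number loop w = 1"
  using ccw by (simp add: smooth_jordan_ccw_def loop_def[abs_def])

lemma wn_outside: "w \<in> outside crv \<Longrightarrow> winding_number loop w = 0"
  using winding_number_zero_in_outside[OF simple_path_imp_path[OF simple_path_loop] loop_closed]
  by (simp add: path_image_loop)

lemma winding_number_loop:
  assumes "w \<notin> crv"
  shows "(\<lambda>u. 1 / (loop u - w) * (L *\<^sub>R T (L * u))) integrable_on {0..1}"
    "Re (winding_number loop w) = Im (integral {0..1} (\<lambda>u. 1 / (loop u - w) * (L *\<^sub>R T (L * u)))) / (2 * pi)"
proof -
  have vd: "vector_derivative loop (at u) = L *\<^sub>R T (L * u)" for u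
    by (rule vector_derivative_at[OF loop_deriv])
  have w: "w \<notin> path_image loop" using assms by (simp add: path_image_loop)
  show "(\<lambda>u. 1 / (loop u - w) * (L *\<^sub>R T (L * u))) integrable_on {0..1}"
    using contour_integrable_inversediff[OF valid_path_loop w] by (simp add: contour_integrable_on vd)
  show "Re (winding_number loop w) = Im (integral {0..1} (\<lambda>u. 1 / (loop u - w) * (L *\<^sub>R T (L * u)))) / (2 * pi)"
    using Re_winding_number[OF valid_path_loop w] by (simp add: contour_integral_integral vd)
qed

text \<open>\<open>B\<close> will be a quotient of tangents and \<open>h * E\<close> a chord, both
  relative to a base point. When both are nearly real the quotient resembles the Poisson kernel. The
  bound 1/8 leaves \<open>B * cnj (E\<^sup>2)\<close> within 1/2 of 1.\<close>

lemma Re_div_nonneg_near_1: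
  fixes B E :: complex and h \<epsilon> :: real
  assumes B: "norm (B - 1) \<le> 1 / 8" and E: "norm (E - 1) \<le> 1 / 8"
  shows "0 \<le> Re (B / ((of_real h * E)^2 + of_real \<epsilon> ^ 2))"
proof -
  have "norm (E\<^sup>2 - 1) \<le> 17 / 64"
  proof -
    have tri: "norm (x * x + 2 * x) \<le> norm x * norm x + 2 * norm x" for x :: complex
      by (rule order_trans[OF norm_triangle_ineq]) (simp add: norm_mult)
    have "E\<^sup>2 - 1 = (E - 1) * (E - 1) + 2 * (E - 1)" by (simp add: power2_eq_square algebra_simps)
    also have "norm \<dots> \<le> norm (E - 1) * norm (E - 1) + 2 * norm (E - 1)"
      by (rule tri)
    finally have "norm (E\<^sup>2 - 1) \<le> norm (E - 1) * norm (E - 1) + 2 * norm (E - 1)" .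
    moreover have "norm (E - 1) * norm (E - 1) \<le> (1/8) * (1/8)" using E by (intro mult_mono) auto
    ultimately show ?thesis using E by linarith
  qed
  then have E2: "norm (cnj (E\<^sup>2) - 1) \<le> 17 / 64"
    by (metis complex_cnj_diff complex_cnj_one complex_mod_cnj)
  have "norm (B * cnj (E\<^sup>2) - 1) \<le> 1 / 2"
  proof -
    have "B * cnj (E\<^sup>2) - 1 = (B - 1) * (cnj (E\<^sup>2) - 1) + (B - 1) + (cnj (E\<^sup>2) - 1)" by (simp add: algebra_simps)
    then have "norm (B * cnj (E\<^sup>2) - 1) \<le> norm (B - 1) * norm (cnj (E\<^sup>2) - 1) + norm (B - 1) + norm (cnj (E\<^sup>2) - 1)"
      using norm_triangle_ineq[of "(B - 1) * (cnj (E\<^sup>2) - 1) + (B - 1)" "cnj (E\<^sup>2) - 1"]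
        norm_triangle_ineq[of "(B - 1) * (cnj (E\<^sup>2) - 1)" "B - 1"]
      by (simp only: norm_mult)
    moreover have "norm (B - 1) * norm (cnj (E\<^sup>2) - 1) \<le> (1/8) * (17/64)" using B E2 by (intro mult_mono) auto
    ultimately show ?thesis using B E2 by linarith
  qed
  then have 1: "0 \<le> Re (B * cnj (E\<^sup>2))"
    using abs_Re_le_cmod[of "B * cnj (E\<^sup>2) - 1"] by simp
  have 2: "0 \<le> Re B" using B abs_Re_le_cmod[of "B - 1"] by simp
  have "Re (B * cnj ((of_real h * E)^2 + of_real \<epsilon> ^ 2)) = h\<^sup>2 * Re (B * cnj (E\<^sup>2)) + \<epsilon>\<^sup>2 * Re B"
  proof -
    have "B * cnj ((of_real h * E)^2 + of_real \<epsilon> ^ 2) = of_real (h\<^sup>2) * (B * cnj (E\<^sup>2)) + of_real (\<epsilon>\<^sup>2) * B"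
      by (simp add: power_mult_distrib algebra_simps)
    then show ?thesis by (simp only: plus_complex.sel Re_complex_of_real times_complex.sel Im_complex_of_real)
  qed
  then have "0 \<le> Re (B * cnj ((of_real h * E)^2 + of_real \<epsilon> ^ 2))"
    using 1 2 by simp
  then show ?thesis
    unfolding Re_complex_div_ge_0 .
qed

text \<open>Up to a rotation the two winding kernels differ by 2 \<i> \<epsilon> / (A^2 +
  \<epsilon>^2), whose contribution is nonnegative near the base point and O(\<epsilon>) elsewhere.
  A crossing with the inside on the wrong side would give a difference of -1, so this crude bound
  already decides the orientation.\<close>

lemma winding_number_jump:
  obtains e s where "e > 0"
    "\<And>\<epsilon>. \<lbrakk>0 < \<epsilon>; \<epsilon> < e; par \<epsilon> s \<notin> crv; par (- \<epsilon>) s \<notin> crv\<rbrakk> \<Longrightarrow>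
      Re (winding_number loop (par \<epsilon> s)) - Re (winding_number loop (par (- \<epsilon>) s)) > - 1 / 2"
proof -
  \<comment> \<open>The midpoint avoids the seam: within \<open>{0..L}\<close> only
    \<open>s0\<close> itself is mapped to \<open>\<gamma> s0\<close>.\<close>
  define s0 where "s0 = L / 2"
  have "isCont T s0" using cont_T[of UNIV] by (simp add: continuous_on_eq_continuous_at)
  then obtain \<delta> where \<delta>: "\<delta> > 0" "\<And>s. \<bar>s - s0\<bar> < \<delta> \<Longrightarrow> norm (T s - T s0) < 1 / 8"
    unfolding continuous_at_eps_delta dist_norm real_norm_def by (metis zero_less_divide_1_iff zero_less_numeral)
  have near: "norm (\<gamma> s - \<gamma> s0 - (s - s0) *\<^sub>R T s0) \<le> \<bar>s - s0\<bar> * (1 / 8)" if "\<bar>s - s0\<bar> < \<delta>" for s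
  proof -
    have "norm (\<gamma> s - \<gamma> s0 - (s - s0) *\<^sub>R T s0) \<le> norm (s - s0) * (1 / 8)"
    proof (rule vector_differentiable_bound_linearization[where S = "closed_segment s0 s"])
      show "norm (T x - T s0) \<le> 1 / 8" if "x \<in> closed_segment s0 s" for x
      proof -
        have "\<bar>x - s0\<bar> < \<delta>" using that \<open>\<bar>s - s0\<bar> < \<delta>\<close>
          by (auto simp: closed_segment_eq_real_ivl split: if_splits)
        then show ?thesis using \<delta>(2)[of x] by simp
      qed
    qed (auto intro: has_vector_derivative_at_within T_deriv)
    then show ?thesis by simp
  qed
  have "\<exists>c>0. \<forall>s\<in>{0..L}. \<delta> \<le> \<bar>s - s0\<bar> \<longrightarrow> c \<le> norm (\<gamma> s - \<gamma> s0)"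
  proof (cases "{s \<in> {0..L}. \<delta> \<le> \<bar>s - s0\<bar>} = {}")
    case True then show ?thesis by (intro exI[of _ 1]) auto
  next
    case False
    have "closed {s. \<delta> \<le> \<bar>s - s0\<bar>}" by (intro closed_Collect_le continuous_intros)
    then have "compact ({0..L} \<inter> {s. \<delta> \<le> \<bar>s - s0\<bar>})" by (intro compact_Int_closed) auto
    moreover have "{0..L} \<inter> {s. \<delta> \<le> \<bar>s - s0\<bar>} = {s \<in> {0..L}. \<delta> \<le> \<bar>s - s0\<bar>}" by auto
    ultimately have "compact {s \<in> {0..L}. \<delta> \<le> \<bar>s - s0\<bar>}" by simp
    moreover have "continuous_on {s \<in> {0..L}. \<delta> \<le> \<bar>s - s0\<bar>} (\<lambda>s. norm (\<gamma> s - \<gamma> s0))"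
      by (intro continuous_intros cont_\<gamma>)
    ultimately obtain u where u: "u \<in> {0..L}" "\<delta> \<le> \<bar>u - s0\<bar>"
      and *: "\<And>s. s \<in> {0..L} \<Longrightarrow> \<delta> \<le> \<bar>s - s0\<bar> \<Longrightarrow> norm (\<gamma> u - \<gamma> s0) \<le> norm (\<gamma> s - \<gamma> s0)"
      using continuous_attains_inf[of "{s \<in> {0..L}. \<delta> \<le> \<bar>s - s0\<bar>}"] False by blast
    have "\<gamma> u \<noteq> \<gamma> s0"
    proof
      assume eq: "\<gamma> u = \<gamma> s0"
      show False
      proof (cases "u = L")
        case True
        then have "\<gamma> 0 = \<gamma> s0" using eq periodic[of 0] by simp
        then have "0 = s0" using inj_onD[OF inj, of 0 s0] L_pos by (auto simp: s0_def)
        then show False using L_pos by (simp add: s0_def)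
      next
        case False
        then have "u = s0" using inj_onD[OF inj eq] u L_pos by (auto simp: s0_def)
        then show False using u \<delta>(1) by simp
      qed
    qed
    then show ?thesis using * by (intro exI[of _ "norm (\<gamma> u - \<gamma> s0)"]) auto
  qed
  then obtain c where c: "c > 0" "\<And>s. s \<in> {0..L} \<Longrightarrow> \<delta> \<le> \<bar>s - s0\<bar> \<Longrightarrow> c \<le> norm (\<gamma> s - \<gamma> s0)" by auto
  \<comment> \<open>The bound \<open>c / 2\<close> keeps the denominator at least
    \<open>c\<^sup>2 / 2\<close> away from the base point; \<open>c\<^sup>2 / (4 * L)\<close> makes
    the whole far contribution larger than -1, which after division by 2 pi exceeds -1/2.\<close>
  define e where "e = min (c / 2) (c\<^sup>2 / (4 * L))"
  have e: "e > 0" using c L_pos by (simp add: e_def)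
  have "Re (winding_number loop (par \<epsilon> s0)) - Re (winding_number loop (par (- \<epsilon>) s0)) > - 1 / 2"
    if \<epsilon>: "0 < \<epsilon>" "\<epsilon> < e" and w: "par \<epsilon> s0 \<notin> crv" "par (- \<epsilon>) s0 \<notin> crv" for \<epsilon>
  proof -
    have pt: "- (4 * \<epsilon> / c\<^sup>2) \<le> Im (T s * (1 / (\<gamma> s - par \<epsilon> s0) - 1 / (\<gamma> s - par (- \<epsilon>) s0)))"
      if s: "s \<in> {0..L}" for s
    proof -
      define A B where "A = (\<gamma> s - \<gamma> s0) / T s0" and "B = T s / T s0"
      have nB: "norm B = 1" by (simp add: B_def norm_divide)
      have 1: "\<gamma> s - par \<epsilon> s0 = T s0 * (A - \<i> * of_real \<epsilon>)" "\<gamma> s - par (- \<epsilon>) s0 = T s0 * (A + \<i> * of_real \<epsilon>)"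
        by (simp_all add: A_def parallel_curve_def normal_def field_simps)
      have ne: "A - \<i> * of_real \<epsilon> \<noteq> 0" "A + \<i> * of_real \<epsilon> \<noteq> 0"
        using w 1 s by (metis imageI mult_zero_right right_minus_eq)+
      have pr: "(A - \<i> * of_real \<epsilon>) * (A + \<i> * of_real \<epsilon>) = A\<^sup>2 + of_real \<epsilon> ^ 2"
        by (simp add: power2_eq_square algebra_simps)
      have "T s * (1 / (\<gamma> s - par \<epsilon> s0) - 1 / (\<gamma> s - par (- \<epsilon>) s0)) =
          B * (1 / (A - \<i> * of_real \<epsilon>) - 1 / (A + \<i> * of_real \<epsilon>))"
        unfolding 1 by (simp add: B_def diff_divide_distrib right_diff_distrib)
      also have "\<dots> = 2 * \<i> * of_real \<epsilon> * (B / (A\<^sup>2 + of_real \<epsilon> ^ 2))"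
        unfolding pr[symmetric] using ne by (simp add: field_simps)
      finally have eq: "T s * (1 / (\<gamma> s - par \<epsilon> s0) - 1 / (\<gamma> s - par (- \<epsilon>) s0)) = \<dots>" .
      have im: "Im \<dots> = 2 * \<epsilon> * Re (B / (A\<^sup>2 + of_real \<epsilon> ^ 2))"
        by (simp only: times_complex.sel) simp
      show ?thesis
      proof (cases "\<bar>s - s0\<bar> < \<delta>")
        case True
        \<comment> \<open>The default 1 is the limit of the quotient as \<open>s\<close> tends to
          \<open>s0\<close>.\<close>
        define E where "E = (if s = s0 then 1 else A / of_real (s - s0))"
        have A: "A = of_real (s - s0) * E" by (simp add: E_def A_def)
        have "norm (B - 1) \<le> 1 / 8"
        proof -
          have "B - 1 = (T s - T s0) / T s0" by (simp add: B_def field_simps)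
          then show ?thesis using \<delta>(2)[OF True] by (simp add: norm_divide)
        qed
        moreover have "norm (E - 1) \<le> 1 / 8"
        proof (cases "s = s0")
          case False
          have "E - 1 = (\<gamma> s - \<gamma> s0 - (s - s0) *\<^sub>R T s0) / (of_real (s - s0) * T s0)"
            using False by (simp add: E_def A_def scaleR_conv_of_real field_simps)
          then have "norm (E - 1) = norm (\<gamma> s - \<gamma> s0 - (s - s0) *\<^sub>R T s0) / \<bar>s - s0\<bar>"
            by (simp only: norm_divide norm_mult norm_of_real norm_T mult_1_right)
          also have "\<dots> \<le> \<bar>s - s0\<bar> * (1 / 8) / \<bar>s - s0\<bar>"
            by (intro divide_right_mono near[OF True]) simp
          finally show ?thesis using False by simp
        qed (simp add: E_def)
        ultimately have "0 \<le> Re (B / (A\<^sup>2 + of_real \<epsilon> ^ 2))"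
          unfolding A by (rule Re_div_nonneg_near_1)
        then show ?thesis unfolding eq im using \<epsilon> by (smt (verit, best) divide_nonneg_nonneg mult_nonneg_nonneg zero_le_power2)
      next
        case False
        then have "c \<le> norm A" using c(2)[OF s] by (simp add: A_def norm_divide)
        then have "c\<^sup>2 \<le> (norm A)\<^sup>2" using c by (intro power_mono) auto
        moreover have "\<epsilon>\<^sup>2 \<le> (c / 2)\<^sup>2" using \<epsilon> by (intro power_mono) (auto simp: e_def)
        moreover have "(norm A)\<^sup>2 - \<epsilon>\<^sup>2 \<le> norm (A\<^sup>2 + of_real \<epsilon> ^ 2)"
          using norm_diff_ineq[of "A\<^sup>2" "of_real \<epsilon> ^ 2"] by (simp add: norm_power)
        moreover have "(c / 2)\<^sup>2 \<le> c\<^sup>2 / 2" by (simp add: power_divide)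
        ultimately have D: "c\<^sup>2 / 2 \<le> norm (A\<^sup>2 + of_real \<epsilon> ^ 2)" by linarith
        have "\<bar>Re (B / (A\<^sup>2 + of_real \<epsilon> ^ 2))\<bar> \<le> norm (B / (A\<^sup>2 + of_real \<epsilon> ^ 2))" by (rule abs_Re_le_cmod)
        also have "\<dots> \<le> 1 / (c\<^sup>2 / 2)"
          unfolding norm_divide nB using D c by (intro divide_left_mono mult_pos_pos) (auto intro: less_le_trans[OF _ D])
        finally have "2 * \<epsilon> * (- (2 / c\<^sup>2)) \<le> 2 * \<epsilon> * Re (B / (A\<^sup>2 + of_real \<epsilon> ^ 2))"
          using \<epsilon> by (intro mult_left_mono) auto
        then show ?thesis unfolding eq im by simp
      qed
    qed
    define G where "G = (\<lambda>z u. 1 / (loop u - z) * (L *\<^sub>R T (L * u)))"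
    have int: "(\<lambda>u. G (par \<epsilon> s0) u - G (par (- \<epsilon>) s0) u) integrable_on {0..1}"
      unfolding G_def by (intro integrable_diff winding_number_loop w)
    have "(- (L * (4 * \<epsilon> / c\<^sup>2))) * measure lborel {0..1::real} \<le> integral {0..1} (\<lambda>u. G (par \<epsilon> s0) u - G (par (- \<epsilon>) s0) u) \<bullet> \<i>"
    proof (rule integral_component_lbound_real[OF int])
      show "\<forall>u\<in>{0..1}. - (L * (4 * \<epsilon> / c\<^sup>2)) \<le> (G (par \<epsilon> s0) u - G (par (- \<epsilon>) s0) u) \<bullet> \<i>"
      proof
        fix u :: real assume u: "u \<in> {0..1}"
        have "G (par \<epsilon> s0) u - G (par (- \<epsilon>) s0) u =
           of_real L * (T (L * u) * (1 / (\<gamma> (L * u) - par \<epsilon> s0) - 1 / (\<gamma> (L * u) - par (- \<epsilon>) s0)))"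
          by (simp add: G_def loop_def scaleR_conv_of_real algebra_simps)
        then have "(G (par \<epsilon> s0) u - G (par (- \<epsilon>) s0) u) \<bullet> \<i> =
           L * Im (T (L * u) * (1 / (\<gamma> (L * u) - par \<epsilon> s0) - 1 / (\<gamma> (L * u) - par (- \<epsilon>) s0)))"
          by (simp add: inner_complex_def del: times_divide_eq_right)
        moreover have "L * - (4 * \<epsilon> / c\<^sup>2) \<le> L * Im (T (L * u) * (1 / (\<gamma> (L * u) - par \<epsilon> s0) - 1 / (\<gamma> (L * u) - par (- \<epsilon>) s0)))"
          using u L_pos mult_left_mono[of u 1 L] by (intro mult_left_mono pt) auto
        ultimately show "- (L * (4 * \<epsilon> / c\<^sup>2)) \<le> (G (par \<epsilon> s0) u - G (par (- \<epsilon>) s0) u) \<bullet> \<i>" by simp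
      qed
      show "\<i> \<in> Basis" by (simp add: Basis_complex_def)
    qed
    also have "integral {0..1} (\<lambda>u. G (par \<epsilon> s0) u - G (par (- \<epsilon>) s0) u) =
       integral {0..1} (G (par \<epsilon> s0)) - integral {0..1} (G (par (- \<epsilon>) s0))"
      unfolding G_def by (intro integral_diff winding_number_loop w)
    finally have "- (L * (4 * \<epsilon> / c\<^sup>2)) \<le> Im (integral {0..1} (G (par \<epsilon> s0))) - Im (integral {0..1} (G (par (- \<epsilon>) s0)))"
      by (simp add: inner_complex_def)
    moreover have "L * (4 * \<epsilon> / c\<^sup>2) < 1"
    proof -
      have "\<epsilon> < c\<^sup>2 / (4 * L)" using \<epsilon> by (simp add: e_def)
      then show ?thesis using L_pos c by (simp add: field_simps)
    qed
    moreover have "Re (winding_number loop (par \<epsilon> s0)) - Re (winding_number loop (par (- \<epsilon>) s0)) =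
      (Im (integral {0..1} (G (par \<epsilon> s0))) - Im (integral {0..1} (G (par (- \<epsilon>) s0)))) / (2 * pi)"
      unfolding winding_number_loop(2)[OF w(1)] winding_number_loop(2)[OF w(2)] G_def by (simp add: diff_divide_distrib)
    moreover have "x / (2 * pi) > - 1 / 2" if "x > - 1" for x
    proof -
      have "- pi < x" using that pi_gt3 by linarith
      then show ?thesis by (simp add: field_simps)
    qed
    ultimately show ?thesis by simp
  qed
  with e that show ?thesis by blast
qed

end

locale tubular_jordan = jordan_ccw +
  fixes t :: real
  assumes t_pos: "t > 0" and tube: "tube_ok \<gamma> L t"
begin

lemma tube_inj:
  assumes "\<bar>\<tau>\<bar> < t" "\<bar>\<tau>'\<bar> < t" "par \<tau> s = par \<tau>' s'"
  shows "\<tau> = \<tau>'" "\<gamma> s = \<gamma> s'"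
proof -
  obtain u where u: "u \<in> {0..<L}" "\<gamma> s = \<gamma> u" "T s = T u" by (rule reduce[of s]) auto
  obtain u' where u': "u' \<in> {0..<L}" "\<gamma> s' = \<gamma> u'" "T s' = T u'" by (rule reduce[of s']) auto
  have "par \<tau> u = par \<tau>' u'" using assms(3) u u' by (simp add: parallel_curve_def normal_def)
  then have "(u, \<tau>) = (u', \<tau>')"
    using tube u(1) u'(1) assms(1,2) unfolding tube_ok_def
    by (intro inj_onD[of "\<lambda>(s, \<tau>). par \<tau> s" "{0..<L} \<times> {-t<..<t}"]) (auto simp: abs_less_iff)
  then show "\<tau> = \<tau>'" "\<gamma> s = \<gamma> s'" using u u' by auto
qed

lemma immersion: "\<bar>\<tau>\<bar> < t \<Longrightarrow> T s + of_real \<tau> * (\<i> * kvec s) \<noteq> 0"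
proof
  assume "\<bar>\<tau>\<bar> < t" and 0: "T s + of_real \<tau> * (\<i> * kvec s) = 0"
  then have "Im (cnj (T s + of_real \<tau> * (\<i> * kvec s)) * nu s) \<noteq> 0"
    using tube unfolding tube_ok_def kvec_def by blast
  then show False unfolding 0 by simp
qed

text \<open>The nearest point supplies a second pair of tubular coordinates whose offset is at most
  |\<tau>|, hence still within the tube; injectivity identifies the two pairs.\<close>

lemma infdist_par: assumes "\<bar>\<tau>\<bar> < t" shows "infdist (par \<tau> s) crv = \<bar>\<tau>\<bar>"
proof -
  obtain s' \<tau>' where n: "par \<tau> s = par \<tau>' s'" "\<bar>\<tau>'\<bar> = infdist (par \<tau> s) crv"
    by (rule nearest_point[of "par \<tau> s"])
  have "infdist (par \<tau> s) crv \<le> dist (par \<tau> s) (\<gamma> s)"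
    by (rule infdist_le) (simp add: crv_range)
  also have "\<dots> = \<bar>\<tau>\<bar>" by (simp add: parallel_curve_def dist_norm norm_mult)
  finally have "\<tau> = \<tau>'" using tube_inj(1)[of \<tau> \<tau>' s s'] assms n by simp
  then show ?thesis using n by simp
qed

lemma infdist_crv_0: "w \<in> crv \<Longrightarrow> infdist w crv = 0" by simp

lemma connected_dichotomy:
  assumes "connected S" "S \<inter> crv = {}"
  shows "S \<subseteq> inside crv \<or> S \<subseteq> outside crv"
proof (rule ccontr)
  assume "\<not> ?thesis"
  then obtain x y where xy: "x \<in> S" "x \<notin> inside crv" "y \<in> S" "y \<notin> outside crv" by blast
  then have "y \<in> inside crv" using assms(2) equalityD2[OF in_out(2)] by blast
  then have "S \<inter> inside crv \<noteq> {}" "S - inside crv \<noteq> {}" using xy by auto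
  from connected_Int_frontier[OF assms(1) this] show False using frontier_in assms(2) by simp
qed

lemma strip_connected: "connected J \<Longrightarrow> connected {par \<tau> s | \<tau> s. \<tau> \<in> J}"
proof -
  assume J: "connected J"
  have "{par \<tau> s | \<tau> s. \<tau> \<in> J} = (\<lambda>(s, \<tau>). par \<tau> s) ` (UNIV \<times> J)" by auto
  then show ?thesis
    using connected_continuous_image[OF cont_par, of "UNIV \<times> J"] J by (simp add: connected_Times)
qed

lemma near_point_in_strip:
  assumes "w \<notin> crv" "infdist w crv < t"
  obtains \<tau> s where "w = par \<tau> s" "0 < \<bar>\<tau>\<bar>" "\<bar>\<tau>\<bar> = infdist w crv"
proof -
  obtain s \<tau> where n: "w = par \<tau> s" "\<bar>\<tau>\<bar> = infdist w crv" by (rule nearest_point[of w])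
  have "\<tau> \<noteq> 0" using n(1) assms(1) by (auto simp: parallel_curve_def crv_range)
  then show ?thesis using that[OF n(1) _ n(2)] by simp
qed

text \<open>Both half-strips are connected and miss the curve, so each lies on one side. Since the
  inside and the outside both accumulate at the curve, the half-strips lie on different sides, and
  the winding number jump excludes the exchanged assignment.\<close>

lemma orientation:
  assumes "0 < \<tau>" "\<tau> < t"
  shows "par \<tau> s \<in> inside crv" "par (- \<tau>) s \<in> outside crv"
proof -
  define P where "P = {par \<tau> s | \<tau> s. \<tau> \<in> {0<..<t}}"
  define Q where "Q = {par \<tau> s | \<tau> s. \<tau> \<in> {-t<..<0}}"
  have disj: "par \<tau> s \<notin> crv" if "0 < \<bar>\<tau>\<bar>" "\<bar>\<tau>\<bar> < t" for \<tau> s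
    using infdist_par[OF that(2), of s] infdist_crv_0[of "par \<tau> s"] that(1) by auto
  have "P \<inter> crv = {}" "Q \<inter> crv = {}"
  proof -
    have "par \<tau> s \<notin> crv" if "0 < \<tau>" "\<tau> < t" for \<tau> s using disj[of \<tau> s] that by simp
    then show "P \<inter> crv = {}" unfolding P_def greaterThanLessThan_iff by blast
    have "par \<tau> s \<notin> crv" if "-t < \<tau>" "\<tau> < 0" for \<tau> s using disj[of \<tau> s] that by simp
    then show "Q \<inter> crv = {}" unfolding Q_def greaterThanLessThan_iff by blast
  qed
  then have P: "P \<subseteq> inside crv \<or> P \<subseteq> outside crv" and Q: "Q \<subseteq> inside crv \<or> Q \<subseteq> outside crv"
    unfolding P_def Q_def by (intro connected_dichotomy strip_connected; simp)+
  have meets: "\<exists>w\<in>S. w \<in> P \<union> Q" if fr: "frontier S = crv" "S \<inter> crv = {}" for S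
  proof -
    have "\<gamma> 0 \<in> closure S" using that(1) crv_range by (auto simp: frontier_def)
    then obtain w where w: "w \<in> S" "dist w (\<gamma> 0) < t" using t_pos closure_approachable by blast
    have "infdist w crv < t" using infdist_le[of "\<gamma> 0" crv w] w(2) crv_range by auto
    then obtain \<tau> s where "w = par \<tau> s" "0 < \<bar>\<tau>\<bar>" "\<bar>\<tau>\<bar> = infdist w crv"
      using near_point_in_strip[of w] w(1) fr(2) by blast
    then have "w \<in> P \<union> Q" using \<open>infdist w crv < t\<close> by (cases "\<tau> > 0") (auto simp: P_def Q_def)
    then show ?thesis using w(1) by blast
  qed
  have not_both: "\<not> (P \<subseteq> outside crv \<and> Q \<subseteq> outside crv)" "\<not> (P \<subseteq> inside crv \<and> Q \<subseteq> inside crv)"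
    using meets[OF frontier_in] meets[OF frontier_out] in_out by blast+
  have "P \<subseteq> inside crv"
  proof (rule ccontr)
    assume "\<not> ?thesis"
    then have PQ: "P \<subseteq> outside crv" "Q \<subseteq> inside crv" using P Q not_both by auto
    obtain e u where e: "e > 0"
    "\<And>\<epsilon>. \<lbrakk>0 < \<epsilon>; \<epsilon> < e; par \<epsilon> u \<notin> crv; par (- \<epsilon>) u \<notin> crv\<rbrakk> \<Longrightarrow>
      Re (winding_number loop (par \<epsilon> u)) - Re (winding_number loop (par (- \<epsilon>) u)) > - 1 / 2"
      by (rule winding_number_jump) blast
    define \<epsilon> where "\<epsilon> = min e t / 2"
    have \<epsilon>: "0 < \<epsilon>" "\<epsilon> < e" "\<epsilon> < t" using e t_pos by (auto simp: \<epsilon>_def min_def)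
    have "par \<epsilon> u \<in> outside crv" "par (- \<epsilon>) u \<in> inside crv"
      using PQ \<epsilon> by (force simp: P_def Q_def)+
    then show False
      using e(2)[OF \<epsilon>(1,2) disj disj] \<epsilon> wn_outside wn_inside by simp
  qed
  moreover from this have "Q \<subseteq> outside crv" using Q not_both by auto
  ultimately show "par \<tau> s \<in> inside crv" "par (- \<tau>) s \<in> outside crv"
    using assms by (force simp: P_def Q_def)+
qed

end

section \<open>Larmor circles\<close>

lemma mag_pos_cis: "mag_pos r x v u = x + of_real r * \<i> * (1 - cis (u / r)) * v"
  by (simp add: mag_pos_def complex_eq_iff algebra_simps)

lemma mag_vel_cis: "mag_vel r v u = cis (u / r) * v"
  by (simp add: mag_vel_def complex_eq_iff algebra_simps)

lemma norm_mag_vel [simp]: "norm (mag_vel r v u) = norm v"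
  by (simp add: mag_vel_cis norm_mult)

lemma mag_pos_add: "mag_pos r (mag_pos r x v a) (mag_vel r v a) b = mag_pos r x v (a + b)"
  by (simp add: mag_pos_cis mag_vel_cis add_divide_distrib cis_mult[symmetric] algebra_simps)

lemma mag_vel_add: "mag_vel r (mag_vel r v a) b = mag_vel r v (a + b)"
  by (simp add: mag_vel_cis add_divide_distrib cis_mult[symmetric] algebra_simps)

lemma mag_pos_0 [simp]: "mag_pos r x v 0 = x"
  by (simp add: mag_pos_cis)

lemma mag_vel_0 [simp]: "mag_vel r v 0 = v"
  by (simp add: mag_vel_cis)

lemma larmor_center: "mag_pos r x v u + \<i> * of_real r * mag_vel r v u = x + \<i> * of_real r * v"
  by (simp add: mag_pos_cis mag_vel_cis algebra_simps)

lemma mag_pos_periodic: "r \<noteq> 0 \<Longrightarrow> mag_pos r x v (u - 2 * pi * r * of_int k) = mag_pos r x v u"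
proof -
  assume r: "r \<noteq> 0"
  have "(u - 2 * pi * r * of_int k) / r = u / r - 2 * pi * of_int k" using r by (simp add: field_simps)
  then show ?thesis by (simp add: mag_pos_cis cis_divide[symmetric] cis_multiple_2pi)
qed

lemma mag_pos_deriv: "r \<noteq> 0 \<Longrightarrow> (mag_pos r x v has_vector_derivative mag_vel r v u) (at u)"
  unfolding mag_pos_def[abs_def] mag_vel_def
  by (auto intro!: derivative_eq_intros simp: scaleR_conv_of_real algebra_simps)

lemma mag_vel_deriv: "r \<noteq> 0 \<Longrightarrow> (mag_vel r v has_vector_derivative (\<i> / of_real r * mag_vel r v u)) (at u)"
  unfolding mag_vel_def
  by (auto intro!: derivative_eq_intros simp: scaleR_conv_of_real field_simps)

lemma continuous_on_mag_pos: "r \<noteq> 0 \<Longrightarrow> continuous_on S (mag_pos r x v)"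
  by (meson continuous_at_imp_continuous_on has_vector_derivative_continuous mag_pos_deriv)

lemma norm_one_minus_cis:
  assumes "0 \<le> d" "d \<le> 2"
  obtains \<theta> where "norm (1 - cis \<theta>) = d"
proof -
  have "continuous_on {0..pi} (\<lambda>\<theta>. norm (1 - cis \<theta>))" by (intro continuous_intros)
  moreover have "norm (1 - cis pi) = 2" by simp
  ultimately show ?thesis using IVT'[of "\<lambda>\<theta>. norm (1 - cis \<theta>)" 0 d pi] assms that by auto
qed

lemma infinite_arc:
  assumes "v \<noteq> 0" "0 < \<eta>"
  shows "infinite ((\<lambda>\<psi>. cis \<psi> * v) ` {0<..<\<eta>})"
proof -
  \<comment> \<open>The cap 1 keeps the angles in a range where \<open>sin\<close> is
    injective.\<close>
  define S where "S = {0<..<min \<eta> 1}"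
  have "inj_on (\<lambda>\<psi>. cis \<psi> * v) S"
  proof (rule inj_onI)
    fix a b assume ab: "a \<in> S" "b \<in> S" and "cis a * v = cis b * v"
    then have "cis a = cis b" using assms by simp
    then have sin: "sin a = sin b" by (simp add: complex_eq_iff)
    show "a = b" by (rule sin_inj_pi[OF _ _ _ _ sin]) (use ab pi_gt3 in \<open>auto simp: S_def\<close>)
  qed
  moreover have "infinite S" using assms by (simp add: S_def)
  ultimately have "infinite ((\<lambda>\<psi>. cis \<psi> * v) ` S)" using finite_image_iff by blast
  then show ?thesis by (rule infinite_super[rotated]) (auto simp: S_def)
qed

section \<open>Orbits through the strip and their starting points on the boundary\<close>

locale magnetic_table = tubular_jordan +
  fixes r :: real
  assumes r_pos: "r > 0" and r_tube: "2 * r < t"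
begin

text \<open>Points at depth less than \<open>2 * r\<close> are those from which an arc of radius
  \<open>r\<close> can run along the normal line's chord to the boundary and beyond. The edges are
  left out so that \<open>W\<close> is open.\<close>

definition "W = {par \<tau> s | \<tau> s. \<tau> \<in> {0<..<2 * r}}"

text \<open>Off the curve, the sign of \<open>\<tau>\<close> is the side and its modulus the
  distance. In this form openness is visible.\<close>

lemma W_eq: "W = inside crv \<inter> {w. infdist w crv < 2 * r}"
proof (intro equalityI subsetI)
  fix w assume "w \<in> W"
  then obtain \<tau> s where w: "w = par \<tau> s" "0 < \<tau>" "\<tau> < 2 * r" by (auto simp: W_def)
  then show "w \<in> inside crv \<inter> {w. infdist w crv < 2 * r}"
    using orientation(1)[of \<tau> s] infdist_par[of \<tau> s] r_tube by simp
next
  fix w assume w: "w \<in> inside crv \<inter> {w. infdist w crv < 2 * r}"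
  then have "w \<notin> crv" using in_out(2) by blast
  then obtain \<tau> s where s: "w = par \<tau> s" "0 < \<bar>\<tau>\<bar>" "\<bar>\<tau>\<bar> = infdist w crv"
    using near_point_in_strip[of w] w r_tube by auto
  have "\<tau> > 0"
  proof (rule ccontr)
    assume "\<not> \<tau> > 0"
    then have "w \<in> outside crv" using orientation(2)[of "-\<tau>" s] s w r_tube by auto
    then show False using w in_out(1) by blast
  qed
  then show "w \<in> W" using s w by (auto simp: W_def)
qed

lemma open_W: "open W"
proof -
  have "open {w. infdist w crv < 2 * r}"
    by (intro open_Collect_less continuous_intros)
  then show ?thesis unfolding W_eq by (intro open_Int open_in)
qed

lemma connected_W: "connected W"
  unfolding W_def by (rule strip_connected) simp

lemma W_ne: "W \<noteq> {}"
  unfolding W_def using r_pos by (auto intro!: exI[of _ r])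

text \<open>The center has distance exactly \<open>r\<close> from the curve, so the open disc misses
  it and stays on the side of its center. These discs are bounded by the Larmor circles tangent to
  the boundary at \<open>\<gamma> s\<close>.\<close>

lemma ball_par:
  shows "ball (par r s) r \<subseteq> inside crv" "ball (par (- r) s) r \<subseteq> outside crv"
proof -
  have c: "par r s \<in> ball (par r s) r" "par (- r) s \<in> ball (par (- r) s) r" using r_pos by auto
  have "ball (par \<rho> s) r \<inter> crv = {}" if "\<bar>\<rho>\<bar> = r" for \<rho>
  proof (rule equals0I)
    fix y assume y: "y \<in> ball (par \<rho> s) r \<inter> crv"
    then have "infdist (par \<rho> s) crv \<le> dist (par \<rho> s) y" by (intro infdist_le) auto
    then show False using y infdist_par[of \<rho> s] that r_tube r_pos by auto
  qed
  then have "ball (par r s) r \<subseteq> inside crv \<or> ball (par r s) r \<subseteq> outside crv"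
    "ball (par (- r) s) r \<subseteq> inside crv \<or> ball (par (- r) s) r \<subseteq> outside crv"
    using r_pos by (intro connected_dichotomy connected_ball; simp)+
  moreover have "par r s \<in> inside crv" "par (- r) s \<in> outside crv"
    using orientation[of r s] r_pos r_tube by auto
  ultimately show "ball (par r s) r \<subseteq> inside crv" "ball (par (- r) s) r \<subseteq> outside crv"
    using c in_out(1) by blast+
qed

text \<open>The last time before 0 at which the orbit is not inside is the wanted start. An outward
  velocity there would carry the orbit straight into the outer tangent disc; a tangential one would
  keep the whole circle on one closed side of the curve, although it meets both open sides.\<close>

lemma backward_orbit:
  assumes x: "x \<in> inside crv" and v: "norm v = 1" and b: "mag_pos r x v b \<in> outside crv"
  obtains s w t1 \<delta> where "norm w = 1" "nu s \<bullet> w > 0" "t1 > 0" "\<delta> > 0"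
    "\<And>u. mag_pos r (\<gamma> s) w (t1 + u) = mag_pos r x v u"
    "\<And>u. mag_vel r w (t1 + u) = mag_vel r v u"
    "\<And>u. 0 < u \<Longrightarrow> u < t1 + \<delta> \<Longrightarrow> mag_pos r (\<gamma> s) w u \<in> inside crv"
proof -
  let ?X = "mag_pos r x v"
  have r0: "r \<noteq> 0" using r_pos by simp
  define S where "S = {..0} \<inter> ?X -` (- inside crv)"
  have "closed S" unfolding S_def
    by (intro continuous_closed_preimage continuous_on_mag_pos r0) (auto simp: open_in closed_def)
  moreover have "S \<noteq> {}"
  proof -
    \<comment> \<open>Full turns move the exterior time \<open>b\<close> to a time that is at most
      0.\<close>
    obtain k :: nat where k: "b / (2 * pi * r) \<le> real k" using real_arch_simple by blast
    have "b - 2 * pi * r * of_int (int k) \<le> 0" using k r_pos by (simp add: field_simps)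
    moreover have "?X (b - 2 * pi * r * of_int (int k)) \<notin> inside crv"
      unfolding mag_pos_periodic[OF r0] using b in_out(1) by blast
    ultimately have "b - 2 * pi * r * of_int (int k) \<in> S" by (simp add: S_def)
    then show ?thesis by blast
  qed
  moreover have bdd: "bdd_above S" by (auto simp: S_def)
  ultimately have "Sup S \<in> S" by (intro closed_contains_Sup)
  define u0 where "u0 = Sup S"
  have u0: "u0 \<le> 0" "?X u0 \<notin> inside crv" using \<open>Sup S \<in> S\<close> by (auto simp: S_def u0_def)
  have "u0 \<noteq> 0" using u0(2) x by auto
  with u0 have u0_neg: "u0 < 0" by simp
  have ins: "?X u \<in> inside crv" if "u0 < u" "u \<le> 0" for u
    using cSup_upper[OF _ bdd, of u] that by (fastforce simp: u0_def S_def)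
  have "?X u0 \<in> closure (inside crv)"
  proof (rule closure_sequential[THEN iffD2], intro exI conjI allI)
    show "?X (u0 + (- u0) / real (Suc n)) \<in> inside crv" for n
    proof (rule ins)
      have "- u0 / real (Suc n) \<le> - u0" using u0_neg divide_right_mono[of 1 "real (Suc n)" 1]
        by (simp add: field_simps mult_nonpos_nonneg)
      then show "u0 + - u0 / real (Suc n) \<le> 0" by simp
    qed (use u0_neg in \<open>simp add: field_simps\<close>)
    have "(\<lambda>n. u0 + (- u0) / real (Suc n)) \<longlonglongrightarrow> u0 + 0"
      by (intro tendsto_intros LIMSEQ_Suc[OF lim_const_over_n])
    moreover have "isCont ?X u0"
      using mag_pos_deriv[OF r0] has_vector_derivative_continuous by blast
    ultimately show "(\<lambda>n. ?X (u0 + (- u0) / real (Suc n))) \<longlonglongrightarrow> ?X u0"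
      using isCont_tendsto_compose by fastforce
  qed
  then have "?X u0 \<in> crv"
    using u0(2) frontier_in open_in interior_open unfolding frontier_def by blast
  then obtain s where s: "?X u0 = \<gamma> s" by auto
  define w where "w = mag_vel r v u0"
  have w1: "norm w = 1" using v by (simp add: w_def)
  have pos: "mag_pos r (\<gamma> s) w u = ?X (u0 + u)" for u
    unfolding w_def s[symmetric] by (rule mag_pos_add)
  have vel: "mag_vel r w u = mag_vel r v (u0 + u)" for u
    unfolding w_def by (rule mag_vel_add)
  have center: "\<gamma> s + \<i> * of_real r * w = x + \<i> * of_real r * v"
    using larmor_center[of r x v u0] by (simp add: s w_def)
  have on_circle: "?X u \<in> cball (x + \<i> * of_real r * v) r" for u
  proof -
    have "(x + \<i> * of_real r * v) - ?X u = \<i> * of_real r * mag_vel r v u"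
      using larmor_center[of r x v u] by (simp add: algebra_simps)
    then show ?thesis using v r_pos by (simp add: dist_norm norm_mult)
  qed
  have "\<not> nu s \<bullet> w < 0"
  proof
    assume neg: "nu s \<bullet> w < 0"
    let ?c = "par (- r) s"
    have gc: "\<gamma> s - ?c = of_real r * nu s" by (simp add: parallel_curve_def)
    \<comment> \<open>The squared distance to the center of the outer tangent disc equals
      \<open>r\<^sup>2\<close> at \<open>u0\<close> and decreases if the velocity points
      outwards.\<close>
    define \<phi> where "\<phi> = (\<lambda>u. (?X u - ?c) \<bullet> (?X u - ?c))"
    have "(\<phi> has_vector_derivative ((?X u0 - ?c) \<bullet> (mag_vel r v u0 - 0) + (mag_vel r v u0 - 0) \<bullet> (?X u0 - ?c))) (at u0)"
      unfolding \<phi>_def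
      by (intro bounded_bilinear.has_vector_derivative[OF bounded_bilinear_inner]
          has_vector_derivative_diff has_vector_derivative_const mag_pos_deriv r0)
    then have "(\<phi> has_real_derivative (2 * r * (nu s \<bullet> w))) (at u0)"
      unfolding s w_def[symmetric] gc
      by (simp add: has_real_derivative_iff_has_vector_derivative inner_commute scaleR_conv_of_real[symmetric] mult.assoc)
    from DERIV_neg_dec_right[OF this] neg r_pos obtain d
      where d: "d > 0" "\<And>h. 0 < h \<Longrightarrow> h < d \<Longrightarrow> \<phi> (u0 + h) < \<phi> u0"
      by (auto simp: mult_pos_neg)
    define h where "h = min (d / 2) (- u0)"
    have h: "0 < h" "h < d" "u0 + h \<le> 0" using d u0_neg by (auto simp: h_def min_def)
    have "\<phi> u0 = r\<^sup>2" unfolding \<phi>_def s gc by (simp add: dot_square_norm norm_mult)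
    then have "(norm (?X (u0 + h) - ?c))\<^sup>2 < r\<^sup>2"
      using d(2)[OF h(1,2)] by (simp add: \<phi>_def dot_square_norm)
    then have "?X (u0 + h) \<in> ball ?c r"
      using r_pos power_less_imp_less_base[of "norm (?X (u0 + h) - ?c)" 2 r] by (simp add: dist_norm norm_minus_commute)
    then have "?X (u0 + h) \<in> outside crv" using ball_par(2) by blast
    moreover have "?X (u0 + h) \<in> inside crv" using ins h by simp
    ultimately show False using in_out(1) by blast
  qed
  moreover have "nu s \<bullet> w \<noteq> 0"
  proof
    assume 0: "nu s \<bullet> w = 0"
    have "w = T s \<or> w = - T s"
    proof -
      have "Im (cnj (T s) * w) = 0" using 0 by (simp add: normal_def inner_complex_def algebra_simps)
      moreover have "norm (cnj (T s) * w) = 1" using w1 by (simp add: norm_mult)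
      ultimately have "cnj (T s) * w = 1 \<or> cnj (T s) * w = -1"
        by (auto simp: complex_eq_iff cmod_eq_Re abs_if split: if_splits)
      moreover have "T s * (cnj (T s) * w) = w"
        by (simp add: mult.assoc[symmetric] complex_norm_square[symmetric])
      ultimately show ?thesis by (metis mult.right_neutral mult_minus_right)
    qed
    then show False
    proof
      assume "w = T s"
      then have "par r s = x + \<i> * of_real r * v"
        using center by (simp add: parallel_curve_def normal_def algebra_simps)
      then have "?X b \<in> closure (ball (par r s) r)" using on_circle[of b] r_pos by simp
      then have "?X b \<in> closure (inside crv)" using closure_mono[OF ball_par(1)[of s]] by blast
      moreover have "closure (inside crv) \<inter> outside crv = {}"
        using in_out(1) open_Int_closure_eq_empty[OF open_out, of "inside crv"] by blast
      ultimately show False using b by blast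
    next
      assume "w = - T s"
      then have "par (- r) s = x + \<i> * of_real r * v"
        using center by (simp add: parallel_curve_def normal_def algebra_simps)
      then have "x \<in> closure (ball (par (- r) s) r)" using on_circle[of 0] r_pos by simp
      then have "x \<in> closure (outside crv)" using closure_mono[OF ball_par(2)[of s]] by blast
      moreover have "closure (outside crv) \<inter> inside crv = {}"
        using in_out(1) open_Int_closure_eq_empty[OF open_in, of "outside crv"] by blast
      ultimately show False using x by blast
    qed
  qed
  ultimately have nw: "nu s \<bullet> w > 0" by linarith
  \<comment> \<open>The orbit stays inside a little beyond \<open>x\<close>, so the conserved time
    interval contains the time of \<open>x\<close> in its interior and can be used for
    differentiation there.\<close>
  have "open (?X -` inside crv)"
    using continuous_open_preimage[OF continuous_on_mag_pos[OF r0] open_UNIV open_in] by simp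
  then obtain \<delta> where \<delta>: "\<delta> > 0" "ball 0 \<delta> \<subseteq> ?X -` inside crv"
    using x unfolding open_contains_ball by (metis mag_pos_0 vimageI)
  show ?thesis
  proof (rule that[OF w1 nw, of "- u0" \<delta>])
    fix u assume u: "0 < u" "u < - u0 + \<delta>"
    show "mag_pos r (\<gamma> s) w u \<in> inside crv"
    proof (cases "u0 + u \<le> 0")
      case True then show ?thesis using ins u by (simp add: pos)
    next
      case False
      then have "u0 + u \<in> ball 0 \<delta>" using u by (simp add: dist_norm)
      then show ?thesis using \<delta>(2) by (auto simp: pos)
    qed
  qed (use u0_neg \<delta> pos vel in auto)
qed

text \<open>An exterior point on the normal through \<open>x\<close>, at distance less than
  \<open>2 * r\<close>, is joined to \<open>x\<close> by an arc of radius \<open>r\<close>; rotating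
  the initial velocity slightly keeps the end point outside. This feeds the infinite set of
  \<open>recursion_from_roots\<close>.\<close>

lemma infinite_orbit_directions:
  assumes "x \<in> W"
  shows "infinite {v. norm v = 1 \<and> (\<exists>b. mag_pos r x v b \<in> outside crv)}"
proof -
  obtain \<tau> s where x: "x = par \<tau> s" "0 < \<tau>" "\<tau> < 2 * r" using assms by (auto simp: W_def)
  define \<epsilon> where "\<epsilon> = (2 * r - \<tau>) / 2"
  have \<epsilon>: "0 < \<epsilon>" "\<epsilon> < t" "\<tau> + \<epsilon> < 2 * r" using x r_pos r_tube by (auto simp: \<epsilon>_def field_simps)
  define y where "y = par (- \<epsilon>) s"
  have y: "y \<in> outside crv" using orientation(2) \<epsilon> by (simp add: y_def)
  have yx: "norm (y - x) = \<tau> + \<epsilon>"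
  proof -
    have "y - x = - of_real (\<tau> + \<epsilon>) * nu s" by (simp add: x(1) y_def parallel_curve_def algebra_simps)
    then show ?thesis using x \<epsilon> by (simp only: norm_mult norm_minus_cancel norm_of_real norm_nu) simp
  qed
  obtain \<theta> where \<theta>: "norm (1 - cis \<theta>) = (\<tau> + \<epsilon>) / r"
    using norm_one_minus_cis[of "(\<tau> + \<epsilon>) / r"] \<epsilon> x r_pos by (auto simp: field_simps)
  define v where "v = (y - x) / (of_real r * \<i> * (1 - cis \<theta>))"
  have ne: "1 - cis \<theta> \<noteq> 0" using \<theta> \<epsilon> x r_pos by (metis add_pos_pos divide_pos_pos less_irrefl norm_zero)
  have v1: "norm v = 1" unfolding v_def norm_divide norm_mult yx \<theta> using r_pos \<epsilon> x by simp
  have pv: "mag_pos r x v (r * \<theta>) = y" using r_pos ne by (simp add: mag_pos_cis v_def)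
  have "continuous_on UNIV (\<lambda>\<psi>. mag_pos r x (cis \<psi> * v) (r * \<theta>))"
    unfolding mag_pos_cis by (intro continuous_intros)
  then have "open ((\<lambda>\<psi>. mag_pos r x (cis \<psi> * v) (r * \<theta>)) -` outside crv)"
    using continuous_open_preimage[OF _ open_UNIV open_out, of "\<lambda>\<psi>. mag_pos r x (cis \<psi> * v) (r * \<theta>)"]
    by simp
  moreover have "0 \<in> (\<lambda>\<psi>. mag_pos r x (cis \<psi> * v) (r * \<theta>)) -` outside crv"
    by (rule vimageI[OF _ y]) (simp add: pv)
  ultimately obtain \<eta> where \<eta>: "\<eta> > 0" "ball 0 \<eta> \<subseteq> (\<lambda>\<psi>. mag_pos r x (cis \<psi> * v) (r * \<theta>)) -` outside crv"
    unfolding open_contains_ball by blast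
  have "(\<lambda>\<psi>. cis \<psi> * v) ` {0<..<\<eta>} \<subseteq> {v. norm v = 1 \<and> (\<exists>b. mag_pos r x v b \<in> outside crv)}"
  proof (intro image_subsetI CollectI conjI exI)
    fix \<psi> assume "\<psi> \<in> {0<..<\<eta>}"
    then have "\<psi> \<in> ball 0 \<eta>" by simp
    then show "mag_pos r x (cis \<psi> * v) (r * \<theta>) \<in> outside crv" using \<eta>(2) by blast
  qed (simp add: norm_mult v1)
  moreover have "infinite ((\<lambda>\<psi>. cis \<psi> * v) ` {0<..<\<eta>})"
    using v1 by (intro infinite_arc \<eta>) auto
  ultimately show ?thesis using finite_subset by blast
qed

end

section \<open>Relations along an irreducible plane curve\<close>

lemma prime_elem_linear:
  fixes \<alpha> :: complex
  shows "prime_elem [:[:- \<alpha>, 1:]:]"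
proof -
  have "prime_elem [:- \<alpha>, 1:]"
    by (rule prime_elemI) (auto simp: is_unit_poly_iff poly_eq_0_iff_dvd[symmetric])
  then show ?thesis by (rule lift_prime_elem_poly)
qed

lemma linear_not_dvd_irreducible:
  fixes f :: "complex poly poly"
  assumes f: "irreducible f" "degree f > 0"
  shows "\<not> [:[:- \<alpha>, 1:]:] dvd f"
proof
  assume "[:[:- \<alpha>, 1:]:] dvd f"
  then obtain u where u: "f = [:[:- \<alpha>, 1:]:] * u" by (rule dvdE)
  have "\<not> [:[:- \<alpha>, 1:]:] dvd 1" using prime_elem_linear by (auto simp: prime_elem_def)
  then have "u dvd 1" using irreducibleD[OF f(1) u] by blast
  then have "degree u = 0" by (auto simp: is_unit_poly_iff)
  moreover have "degree f \<le> degree [:[:- \<alpha>, 1:]:] + degree u" unfolding u by (rule degree_mult_le)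
  ultimately show False using f(2) by simp
qed

lemma constant_unit_or_linear_factor:
  fixes a :: "complex poly"
  assumes "a \<noteq> 0"
  obtains c where "c \<noteq> 0" "a = [:c:]" | \<alpha> a' where "a = [:- \<alpha>, 1:] * a'" "degree a = Suc (degree a')" "a' \<noteq> 0"
proof (cases "degree a = 0")
  case True
  then obtain c where "a = [:c:]" by (rule degree_eq_zeroE)
  then show ?thesis using that(1) assms by auto
next
  case False
  then have "\<exists>i\<in>{1..degree a}. coeff a i \<noteq> 0"
    by (intro bexI[of _ "degree a"]) auto
  then obtain \<alpha> where "(\<Sum>i\<le>degree a. coeff a i * \<alpha> ^ i) = 0"
    using fundamental_theorem_of_algebra[of "coeff a" "degree a"] by blast
  then have "poly a \<alpha> = 0" by (simp add: poly_altdef)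
  then obtain a' where a': "a = [:- \<alpha>, 1:] * a'" using poly_eq_0_iff_dvd by (metis dvdE)
  then have "a' \<noteq> 0" using assms by auto
  moreover have "degree a = Suc (degree a')"
    unfolding a' using \<open>a' \<noteq> 0\<close> by (subst degree_mult_eq) auto
  ultimately show ?thesis using that(2) a' by blast
qed

text \<open>One linear factor of \<open>a\<close> is removed at a time: it is prime in C[y][x] and
  cannot divide \<open>f\<close>, so it divides \<open>h\<close> and cancels.\<close>

lemma irreducible_dvd_cancel_const:
  fixes f g h :: "complex poly poly"
  assumes f: "irreducible f" "degree f > 0" and "a \<noteq> 0" "[:a:] * g = f * h"
  shows "f dvd g"
  using assms(3,4)
proof (induction "degree a" arbitrary: a h rule: less_induct)
  case less
  show ?case
  proof (cases rule: constant_unit_or_linear_factor[OF less.prems(1)])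
    case (1 c)
    have "g = [:[:1 / c:]:] * ([:a:] * g)" using 1 by (simp flip: one_pCons)
    then have "g = f * ([:[:1 / c:]:] * h)" unfolding less.prems(2) by (simp only: mult.left_commute)
    then show ?thesis by (rule dvdI)
  next
    case (2 \<alpha> a')
    define \<pi> where "\<pi> = [:[:- \<alpha>, 1:]:]"
    have a: "[:a:] = \<pi> * [:a':]" by (simp add: \<pi>_def 2)
    have "\<pi> dvd f * h" unfolding less.prems(2)[symmetric] a by (simp only: mult.assoc dvd_triv_left)
    then have "\<pi> dvd h"
      using prime_elem_dvd_multD[OF prime_elem_linear] linear_not_dvd_irreducible[OF f] unfolding \<pi>_def by blast
    then obtain h' where h': "h = \<pi> * h'" by (rule dvdE)
    have "\<pi> * ([:a':] * g) = \<pi> * (f * h')"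
      using less.prems(2) unfolding a h' by (simp only: ac_simps)
    then have "[:a':] * g = f * h'" by (simp add: \<pi>_def del: mult_pCons_left)
    then show ?thesis using less.hyps[of a' h'] 2 by auto
  qed
qed

text \<open>The Gauss lemma in elementary form: every prime factor of \<open>c\<close> divides
  \<open>g\<close> or \<open>q\<close> and is split off there without changing the degree in
  \<open>x\<close>, so a factorization over C(y) descends to C[y].\<close>

lemma factorization_cancel_const:
  fixes f g q :: "complex poly poly"
  assumes "c \<noteq> 0" "g * q = [:c:] * f"
  obtains g' q' where "f = g' * q'" "degree g' = degree g" "degree q' = degree q"
proof -
  have "\<exists>g' q'. f = g' * q' \<and> degree g' = degree g \<and> degree q' = degree q"
    using assms
  proof (induction "degree c" arbitrary: c g q rule: less_induct)
    case less
    show ?case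
    proof (cases rule: constant_unit_or_linear_factor[OF less.prems(1)])
      case (1 d)
      have "f = [:[:1 / d:]:] * ([:c:] * f)" using 1 by (simp flip: one_pCons)
      then have "f = ([:[:1 / d:]:] * g) * q" unfolding less.prems(2)[symmetric] by (simp only: mult.assoc)
      moreover have "degree ([:[:1 / d:]:] * g) = degree g" using 1 by simp
      ultimately show ?thesis by blast
    next
      case (2 \<alpha> c')
      define \<pi> where "\<pi> = [:[:- \<alpha>, 1:]:]"
      have c: "[:c:] = \<pi> * [:c':]" by (simp add: \<pi>_def 2)
      have deg: "degree (\<pi> * u) = degree u" for u by (simp add: \<pi>_def)
      have canc: "\<pi> * u = \<pi> * w \<Longrightarrow> u = w" for u w
        by (simp add: \<pi>_def del: mult_pCons_left)
      have lt: "degree c' < degree c" using 2 by simp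
      have "\<pi> dvd g * q" unfolding less.prems(2) c by (simp only: mult.assoc dvd_triv_left)
      then have "\<pi> dvd g \<or> \<pi> dvd q"
        using prime_elem_dvd_multD[OF prime_elem_linear] unfolding \<pi>_def by blast
      then show ?thesis
      proof
        assume "\<pi> dvd g"
        then obtain u where u: "g = \<pi> * u" by (rule dvdE)
        have "\<pi> * (u * q) = \<pi> * ([:c':] * f)" using less.prems(2) unfolding c u by (simp only: ac_simps)
        then have "u * q = [:c':] * f" by (rule canc)
        from less.hyps[OF lt 2(3) this] show ?thesis unfolding u deg .
      next
        assume "\<pi> dvd q"
        then obtain u where u: "q = \<pi> * u" by (rule dvdE)
        have "\<pi> * (g * u) = \<pi> * ([:c':] * f)" using less.prems(2) unfolding c u by (simp only: ac_simps)
        then have "g * u = [:c':] * f" by (rule canc)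
        from less.hyps[OF lt 2(3) this] show ?thesis unfolding u deg .
      qed
    qed
  qed
  then show ?thesis using that by blast
qed

text \<open>Takes the place of a resultant. Among the members of the ideal (f, R) not divisible by
  \<open>f\<close>, one of least degree in \<open>x\<close> has degree below that of
  \<open>f\<close>. Pseudo-division shows that it has degree 0 or divides a multiple of
  \<open>f\<close> by an element of C[y], and irreducibility again leaves degree 0.\<close>

lemma irreducible_eliminant:
  fixes f R :: "complex poly poly"
  assumes f: "irreducible f" "degree f > 0" and R: "\<not> f dvd R"
  obtains A B d where "d \<noteq> 0" "A * f + B * R = [:d:]"
proof -
  define I where "I = {g. (\<exists>A B. g = A * f + B * R) \<and> \<not> f dvd g}"
  have "R = 0 * f + 1 * R" by simp
  then have "R \<in> I" using R unfolding I_def by blast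
  then obtain g where g: "g \<in> I" and min: "\<And>h. h \<in> I \<Longrightarrow> degree g \<le> degree h"
    using ex_has_least_nat[of "\<lambda>g. g \<in> I" R degree] by blast
  obtain A B where AB: "g = A * f + B * R" and ng: "\<not> f dvd g" using g by (auto simp: I_def)
  have f0: "f \<noteq> 0" and g0: "g \<noteq> 0" using f(2) ng by auto
  have deg_g: "degree g < degree f"
  proof -
    obtain a q where aq: "a \<noteq> 0" "smult a g = f * q + pseudo_mod g f"
      using pseudo_mod(1)[OF f0] by blast
    have deg: "pseudo_mod g f = 0 \<or> degree (pseudo_mod g f) < degree f"
      using pseudo_mod(2)[OF f0] .
    define c where "c = [:a:]"
    have eq: "pseudo_mod g f = c * g - f * q" using aq(2) by (simp add: c_def)
    have nd: "\<not> f dvd pseudo_mod g f"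
    proof
      assume "f dvd pseudo_mod g f"
      then have "f dvd pseudo_mod g f + f * q" by simp
      then have "f dvd c * g" by (simp add: eq)
      then obtain h where "c * g = f * h" by (rule dvdE)
      then show False using irreducible_dvd_cancel_const[OF f aq(1)] ng unfolding c_def by blast
    qed
    moreover have "pseudo_mod g f = (c * A - q) * f + (c * B) * R"
      unfolding eq unfolding AB by (simp add: algebra_simps)
    ultimately have "pseudo_mod g f \<in> I" unfolding I_def by blast
    then have "degree g \<le> degree (pseudo_mod g f)" by (rule min)
    moreover have "pseudo_mod g f \<noteq> 0" using nd by auto
    ultimately show ?thesis using deg by simp
  qed
  obtain a q where aq: "a \<noteq> 0" "smult a f = g * q + pseudo_mod f g"
    using pseudo_mod(1)[OF g0] by blast
  have deg: "pseudo_mod f g = 0 \<or> degree (pseudo_mod f g) < degree g"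
    using pseudo_mod(2)[OF g0] .
  define c where "c = [:a:]"
  have eq: "pseudo_mod f g = c * f - g * q" using aq(2) by (simp add: c_def)
  have "pseudo_mod f g = (c - A * q) * f + (- B * q) * R"
    unfolding eq unfolding AB by (simp add: algebra_simps)
  then have "pseudo_mod f g \<in> I \<or> f dvd pseudo_mod f g" unfolding I_def by blast
  then have "f dvd pseudo_mod f g \<or> degree g = 0"
  proof
    assume pI: "pseudo_mod f g \<in> I"
    then have "degree g \<le> degree (pseudo_mod f g)" by (rule min)
    moreover have "pseudo_mod f g \<noteq> 0" using pI unfolding I_def by (metis (no_types, lifting) dvd_0_right mem_Collect_eq)
    ultimately show ?thesis using deg by simp
  qed simp
  then have "degree g = 0"
  proof
    assume "f dvd pseudo_mod f g"
    then have "pseudo_mod f g = 0"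
      using deg deg_g dvd_imp_degree_le[of f "pseudo_mod f g"] by (cases "pseudo_mod f g = 0") auto
    then have gq: "g * q = c * f" using eq by simp
    obtain g' q' where gq': "f = g' * q'" "degree g' = degree g" "degree q' = degree q"
      using factorization_cancel_const[OF aq(1) gq[unfolded c_def]] by blast
    have "degree f \<le> degree g' + degree q'" unfolding gq'(1) by (rule degree_mult_le)
    then have "degree q' \<noteq> 0" using deg_g gq' by simp
    then have "\<not> q' dvd 1" by (auto simp: is_unit_poly_iff)
    then have "g' dvd 1" using irreducibleD[OF f(1) gq'(1)] by blast
    then show ?thesis using gq'(2) by (auto simp: is_unit_poly_iff)
  qed
  then obtain d where d: "g = [:d:]" by (rule degree_eq_zeroE)
  have "d \<noteq> 0"
  proof
    assume "d = 0"
    with d have "g = 0" by (simp only: pCons_0_0)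
    with g0 show False by contradiction
  qed
  moreover have "A * f + B * R = [:d:]" by (rule trans[OF AB[symmetric] d])
  ultimately show ?thesis using that by blast
qed

text \<open>Otherwise the eliminant, or \<open>f\<close> itself if it is free of \<open>x\<close>,
  would be a nonzero polynomial in \<open>y\<close> with infinitely many zeros.\<close>

lemma irreducible_dvd_if_common_zeros:
  fixes f R :: "complex poly poly" and S :: "(complex \<times> complex) set"
  assumes f: "irreducible f" and S: "infinite (snd ` S)"
    and z: "\<And>x y. (x, y) \<in> S \<Longrightarrow> eval2 f x y = 0" "\<And>x y. (x, y) \<in> S \<Longrightarrow> eval2 R x y = 0"
  shows "f dvd R"
proof (rule ccontr)
  assume R: "\<not> f dvd R"
  have "\<exists>d :: complex poly. d \<noteq> 0 \<and> (\<forall>y\<in>snd ` S. poly d y = 0)"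
  proof (cases "degree f > 0")
    case True
    obtain A B d where d: "d \<noteq> 0" "A * f + B * R = [:d:]"
      by (rule irreducible_eliminant[OF f True R])
    have "poly d y = 0" if "(x, y) \<in> S" for x y
    proof -
      have "poly d y = eval2 (A * f + B * R) x y" unfolding d(2) by simp
      then show ?thesis using z[OF that] by simp
    qed
    then show ?thesis using d(1) by auto
  next
    case False
    then obtain d where d: "f = [:d:]" by (auto elim: degree_eq_zeroE)
    have "d \<noteq> 0" using f d by auto
    then show ?thesis using z(1) d by (intro exI[of _ d]) auto
  qed
  then obtain d where d: "d \<noteq> 0" "snd ` S \<subseteq> {y. poly d y = 0}" by auto
  then show False using S poly_roots_finite[OF d(1)] finite_subset by blast
qed

text \<open>Models polynomials in x, y, \<rho> and 1/\<rho> under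
  \<open>\<rho>\<^sup>2 = q x y\<close>: denominators are powers of \<open>q\<close>, and the normal
  form is linear in \<rho>. The same \<open>A\<close> and \<open>B\<close> serve both roots, which
  makes conjugation possible.\<close>

definition sqrt_polyfun ::
  "(complex \<Rightarrow> complex \<Rightarrow> complex) \<Rightarrow> (complex \<Rightarrow> complex \<Rightarrow> complex \<Rightarrow> complex) \<Rightarrow> bool" where
  "sqrt_polyfun q g \<longleftrightarrow> (\<exists>K A B. polyfun2 A \<and> polyfun2 B \<and>
     (\<forall>x y \<rho>. \<rho> \<noteq> 0 \<longrightarrow> \<rho>\<^sup>2 = q x y \<longrightarrow> q x y ^ K * g x y \<rho> = A x y + \<rho> * B x y))"

lemma sqrt_polyfunE:
  assumes "sqrt_polyfun q g"
  obtains K A B where "polyfun2 A" "polyfun2 B"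
    "\<And>x y \<rho>. \<rho> \<noteq> 0 \<Longrightarrow> \<rho>\<^sup>2 = q x y \<Longrightarrow> q x y ^ K * g x y \<rho> = A x y + \<rho> * B x y"
  using assms unfolding sqrt_polyfun_def by blast

lemma sqrt_polyfun_polyfun2:
  assumes "polyfun2 h" shows "sqrt_polyfun q (\<lambda>x y \<rho>. h x y)"
  unfolding sqrt_polyfun_def
  by (rule exI[of _ 0], rule exI[of _ h], rule exI[of _ "\<lambda>x y. 0"]) (use assms in auto)

lemma sqrt_polyfun_divide:
  assumes "polyfun2 h" shows "sqrt_polyfun q (\<lambda>x y \<rho>. h x y / \<rho>)"
  unfolding sqrt_polyfun_def
proof (rule exI[of _ 1], rule exI[of _ "\<lambda>x y. 0"], rule exI[of _ h], intro conjI allI impI)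
  fix x y \<rho> :: complex assume "\<rho> \<noteq> 0" "\<rho>\<^sup>2 = q x y"
  then show "q x y ^ 1 * (h x y / \<rho>) = 0 + \<rho> * h x y"
    by (simp add: power2_eq_square flip: \<open>\<rho>\<^sup>2 = q x y\<close>)
qed (use assms in auto)

lemma sqrt_polyfun_add:
  assumes q: "polyfun2 q" and "sqrt_polyfun q g" "sqrt_polyfun q h"
  shows "sqrt_polyfun q (\<lambda>x y \<rho>. g x y \<rho> + h x y \<rho>)"
proof -
  obtain K A B where g: "polyfun2 A" "polyfun2 B"
    "\<And>x y \<rho>. \<rho> \<noteq> 0 \<Longrightarrow> \<rho>\<^sup>2 = q x y \<Longrightarrow> q x y ^ K * g x y \<rho> = A x y + \<rho> * B x y"
    using assms(2) by (rule sqrt_polyfunE) blast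
  obtain K' A' B' where h: "polyfun2 A'" "polyfun2 B'"
    "\<And>x y \<rho>. \<rho> \<noteq> 0 \<Longrightarrow> \<rho>\<^sup>2 = q x y \<Longrightarrow> q x y ^ K' * h x y \<rho> = A' x y + \<rho> * B' x y"
    using assms(3) by (rule sqrt_polyfunE) blast
  show ?thesis
    unfolding sqrt_polyfun_def
  proof (rule exI[of _ "K + K'"], rule exI[of _ "\<lambda>x y. q x y ^ K' * A x y + q x y ^ K * A' x y"],
      rule exI[of _ "\<lambda>x y. q x y ^ K' * B x y + q x y ^ K * B' x y"], intro conjI allI impI)
    fix x y \<rho> :: complex assume r: "\<rho> \<noteq> 0" "\<rho>\<^sup>2 = q x y"
    have "q x y ^ (K + K') * (g x y \<rho> + h x y \<rho>) =
        q x y ^ K' * (q x y ^ K * g x y \<rho>) + q x y ^ K * (q x y ^ K' * h x y \<rho>)"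
      by (simp add: power_add algebra_simps)
    then show "q x y ^ (K + K') * (g x y \<rho> + h x y \<rho>) = q x y ^ K' * A x y + q x y ^ K * A' x y +
        \<rho> * (q x y ^ K' * B x y + q x y ^ K * B' x y)"
      unfolding g(3)[OF r] h(3)[OF r] by (simp add: algebra_simps)
  qed (use q g h in \<open>auto intro!: polyfun2_add polyfun2_mult polyfun2_power\<close>)
qed

lemma sqrt_polyfun_mult:
  assumes q: "polyfun2 q" and "sqrt_polyfun q g" "sqrt_polyfun q h"
  shows "sqrt_polyfun q (\<lambda>x y \<rho>. g x y \<rho> * h x y \<rho>)"
proof -
  obtain K A B where g: "polyfun2 A" "polyfun2 B"
    "\<And>x y \<rho>. \<rho> \<noteq> 0 \<Longrightarrow> \<rho>\<^sup>2 = q x y \<Longrightarrow> q x y ^ K * g x y \<rho> = A x y + \<rho> * B x y"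
    using assms(2) by (rule sqrt_polyfunE) blast
  obtain K' A' B' where h: "polyfun2 A'" "polyfun2 B'"
    "\<And>x y \<rho>. \<rho> \<noteq> 0 \<Longrightarrow> \<rho>\<^sup>2 = q x y \<Longrightarrow> q x y ^ K' * h x y \<rho> = A' x y + \<rho> * B' x y"
    using assms(3) by (rule sqrt_polyfunE) blast
  show ?thesis
    unfolding sqrt_polyfun_def
  proof (rule exI[of _ "K + K'"], rule exI[of _ "\<lambda>x y. A x y * A' x y + q x y * (B x y * B' x y)"],
      rule exI[of _ "\<lambda>x y. A x y * B' x y + B x y * A' x y"], intro conjI allI impI)
    fix x y \<rho> :: complex assume r: "\<rho> \<noteq> 0" "\<rho>\<^sup>2 = q x y"
    have "q x y ^ (K + K') * (g x y \<rho> * h x y \<rho>) =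
        (q x y ^ K * g x y \<rho>) * (q x y ^ K' * h x y \<rho>)"
      by (simp add: power_add algebra_simps)
    also have "\<dots> = A x y * A' x y + \<rho>\<^sup>2 * (B x y * B' x y) + \<rho> * (A x y * B' x y + B x y * A' x y)"
      unfolding g(3)[OF r] h(3)[OF r] by (simp add: algebra_simps power2_eq_square)
    finally show "q x y ^ (K + K') * (g x y \<rho> * h x y \<rho>) = A x y * A' x y + q x y * (B x y * B' x y) +
        \<rho> * (A x y * B' x y + B x y * A' x y)"
      unfolding r(2) .
  qed (use q g h in \<open>auto intro!: polyfun2_add polyfun2_mult\<close>)
qed

lemma sqrt_polyfun_poly:
  assumes q: "polyfun2 q" and "sqrt_polyfun q g"
  shows "sqrt_polyfun q (\<lambda>x y \<rho>. poly p (g x y \<rho>))"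
proof (induction p)
  case 0 show ?case using sqrt_polyfun_polyfun2[OF polyfun2_const[of 0]] by simp
next
  case (pCons a p)
  have "sqrt_polyfun q (\<lambda>x y \<rho>. a + g x y \<rho> * poly p (g x y \<rho>))"
    by (rule sqrt_polyfun_add[OF q sqrt_polyfun_polyfun2[OF polyfun2_const] sqrt_polyfun_mult[OF q assms(2) pCons.IH]])
  then show ?case by simp
qed

lemma sqrt_polyfun_eval2:
  assumes q: "polyfun2 q" and "sqrt_polyfun q g" "sqrt_polyfun q h"
  shows "sqrt_polyfun q (\<lambda>x y \<rho>. eval2 p (g x y \<rho>) (h x y \<rho>))"
proof (induction p)
  case 0 show ?case using sqrt_polyfun_polyfun2[OF polyfun2_const[of 0]] by simp
next
  case (pCons a p)
  have "sqrt_polyfun q (\<lambda>x y \<rho>. poly a (h x y \<rho>) + g x y \<rho> * eval2 p (g x y \<rho>) (h x y \<rho>))"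
    by (rule sqrt_polyfun_add[OF q sqrt_polyfun_poly[OF q assms(3)] sqrt_polyfun_mult[OF q assms(2) pCons.IH]])
  then show ?case by simp
qed

text \<open>Multiplying by the conjugate under \<open>\<rho> \<mapsto> - \<rho>\<close> turns a relation involving the square root
  \<open>\<rho>\<close> into a polynomial one, which then propagates along the irreducible curve.\<close>
lemma sqrt_relation_on_curve:
  fixes f :: "complex poly poly"
  assumes f: "irreducible f" and S: "infinite (snd ` S)" and q: "polyfun2 q" and g: "sqrt_polyfun q g"
    and zf: "\<And>x y. (x, y) \<in> S \<Longrightarrow> eval2 f x y = 0"
    and zg: "\<And>x y. (x, y) \<in> S \<Longrightarrow> q x y \<noteq> 0 \<Longrightarrow> \<exists>\<rho>. \<rho>\<^sup>2 = q x y \<and> g x y \<rho> = 0"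
    and xy: "eval2 f x y = 0" "\<rho>\<^sup>2 = q x y" "\<rho> \<noteq> 0"
  shows "g x y \<rho> = 0 \<or> g x y (- \<rho>) = 0"
proof -
  obtain K A B where AB: "polyfun2 A" "polyfun2 B"
    and eq: "\<And>x y \<rho>. \<rho> \<noteq> 0 \<Longrightarrow> \<rho>\<^sup>2 = q x y \<Longrightarrow> q x y ^ K * g x y \<rho> = A x y + \<rho> * B x y"
    using g by (rule sqrt_polyfunE) blast
  \<comment> \<open>The additional factor \<open>q\<close> takes care of the points of
    \<open>S\<close> with \<open>q x y = 0\<close>, where no root \<rho> is supplied.\<close>
  have "polyfun2 (\<lambda>x y. q x y * (A x y ^ 2 - q x y * B x y ^ 2))"
    using AB q by (intro polyfun2_mult polyfun2_diff polyfun2_power)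
  then obtain R where R0: "(\<lambda>x y. q x y * (A x y ^ 2 - q x y * B x y ^ 2)) = eval2 R"
    unfolding polyfun2_def by blast
  have R: "q x y * (A x y ^ 2 - q x y * B x y ^ 2) = eval2 R x y" for x y
    unfolding R0[symmetric] ..
  have "f dvd R"
  proof (rule irreducible_dvd_if_common_zeros[OF f S zf])
    fix x y assume S: "(x, y) \<in> S"
    show "eval2 R x y = 0"
    proof (cases "q x y = 0")
      case True then show ?thesis by (simp flip: R)
    next
      case False
      then obtain \<rho> where \<rho>: "\<rho>\<^sup>2 = q x y" "g x y \<rho> = 0" using zg[OF S] by blast
      then have "\<rho> \<noteq> 0" using False by auto
      then have "A x y = - (\<rho> * B x y)" using eq[of \<rho> x y] \<rho> by (simp add: eq_neg_iff_add_eq_0)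
      then have "A x y ^ 2 = \<rho>\<^sup>2 * B x y ^ 2" by (simp add: power_mult_distrib)
      then show ?thesis unfolding \<rho>(1) by (simp flip: R)
    qed
  qed
  then have "eval2 R x y = 0" using xy(1) by (auto elim!: dvdE)
  moreover have q0: "q x y \<noteq> 0" using xy by auto
  ultimately have 0: "A x y ^ 2 - q x y * B x y ^ 2 = 0" by (simp flip: R)
  have "(q x y ^ K * g x y \<rho>) * (q x y ^ K * g x y (- \<rho>)) = (A x y + \<rho> * B x y) * (A x y + (- \<rho>) * B x y)"
    using eq[of \<rho> x y] eq[of "- \<rho>" x y] xy by simp
  also have "\<dots> = A x y ^ 2 - \<rho>\<^sup>2 * B x y ^ 2" by (simp add: power2_eq_square algebra_simps)
  also have "\<dots> = 0" using 0 xy(2) by simp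
  finally show ?thesis using q0 by simp
qed

section \<open>Branches at infinity\<close>

definition monomials :: "complex poly poly \<Rightarrow> (nat \<times> nat) set" where
  "monomials f = (SIGMA i:{..degree f}. {..degree (coeff f i)})"

abbreviation cf :: "complex poly poly \<Rightarrow> nat \<times> nat \<Rightarrow> complex" where
  "cf f ij \<equiv> coeff (coeff f (fst ij)) (snd ij)"

lemma monomials_degree: "ij \<in> monomials f \<Longrightarrow> fst ij + snd ij \<le> total_degree f"
proof -
  assume ij: "ij \<in> monomials f"
  have "{i + degree (coeff f i) | i. i \<le> degree f} = (\<lambda>i. i + degree (coeff f i)) ` {..degree f}" by auto
  then have "fst ij + degree (coeff f (fst ij)) \<le> total_degree f"
    unfolding total_degree_def using ij by (intro Max_ge) (auto simp: monomials_def)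
  then show ?thesis using ij by (auto simp: monomials_def)
qed

lemma homog_eq:
  "homog f x y z = (\<Sum>ij\<in>monomials f. cf f ij * x ^ fst ij * y ^ snd ij * z ^ (total_degree f - fst ij - snd ij))"
  by (simp add: homog_def monomials_def sum.Sigma case_prod_unfold)

lemma eval2_eq_monomials: "eval2 f x y = (\<Sum>ij\<in>monomials f. cf f ij * x ^ fst ij * y ^ snd ij)"
proof -
  have "eval2 f x y = (\<Sum>i\<le>degree f. \<Sum>j\<le>degree (coeff f i). coeff (coeff f i) j * x ^ i * y ^ j)"
    unfolding eval2_altdef poly_altdef sum_distrib_right by (intro sum.cong refl) (simp add: ac_simps)
  then show ?thesis by (simp add: monomials_def sum.Sigma case_prod_unfold)
qed

lemma homog_dehomogenize:
  assumes "z \<noteq> 0" shows "homog f x y z = z ^ total_degree f * eval2 f (x / z) (y / z)"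
  unfolding homog_eq eval2_eq_monomials sum_distrib_left
proof (intro sum.cong refl)
  fix ij assume ij: "ij \<in> monomials f"
  have "c * x ^ i * y ^ j * z ^ (d - i - j) = z ^ d * (c * (x / z) ^ i * (y / z) ^ j)"
    if ijd: "i + j \<le> d" for c i j d
  proof -
    obtain k where "d = i + j + k" using le_Suc_ex[OF ijd] ..
    then show ?thesis using assms by (simp add: power_add power_divide)
  qed
  note gen = this
  show "cf f ij * x ^ fst ij * y ^ snd ij * z ^ (total_degree f - fst ij - snd ij) =
      z ^ total_degree f * (cf f ij * (x / z) ^ fst ij * (y / z) ^ snd ij)"
    by (rule gen[OF monomials_degree[OF ij]])
qed

text \<open>The truncated exponent \<open>fst ij - 1\<close> is harmless at 0 because of the factor
  \<open>of_nat (fst ij)\<close>; likewise for the other two partial derivatives.\<close>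

definition homog_dx where
  "homog_dx f x y z = (\<Sum>ij\<in>monomials f. cf f ij * (of_nat (fst ij) * x ^ (fst ij - 1)) * y ^ snd ij
     * z ^ (total_degree f - fst ij - snd ij))"

definition homog_dy where
  "homog_dy f x y z = (\<Sum>ij\<in>monomials f. cf f ij * x ^ fst ij * (of_nat (snd ij) * y ^ (snd ij - 1))
     * z ^ (total_degree f - fst ij - snd ij))"

definition homog_dz where
  "homog_dz f x y z = (\<Sum>ij\<in>monomials f. cf f ij * x ^ fst ij * y ^ snd ij *
     (of_nat (total_degree f - fst ij - snd ij) * z ^ (total_degree f - fst ij - snd ij - 1)))"

lemma homog_has_derivative:
  assumes "(gx has_field_derivative gx') (at t)" "(gy has_field_derivative gy') (at t)"
    "(gz has_field_derivative gz') (at t)"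
  shows "((\<lambda>t. homog f (gx t) (gy t) (gz t)) has_field_derivative
     (homog_dx f (gx t) (gy t) (gz t) * gx' + homog_dy f (gx t) (gy t) (gz t) * gy'
      + homog_dz f (gx t) (gy t) (gz t) * gz')) (at t)"
proof -
  have pw: "((\<lambda>t. g t ^ n) has_field_derivative (of_nat n * g t ^ (n - 1) * g')) (at t)"
    if "(g has_field_derivative g') (at t)" for g :: "complex \<Rightarrow> complex" and g' n
    using DERIV_power[OF that, of n] by (simp add: ac_simps)
  have "((\<lambda>t. homog f (gx t) (gy t) (gz t)) has_field_derivative
     (\<Sum>ij\<in>monomials f. cf f ij * (of_nat (fst ij) * gx t ^ (fst ij - 1) * gx' * (gy t ^ snd ij * gz t ^ (total_degree f - fst ij - snd ij))
       + (of_nat (snd ij) * gy t ^ (snd ij - 1) * gy' * gz t ^ (total_degree f - fst ij - snd ij)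
         + of_nat (total_degree f - fst ij - snd ij) * gz t ^ (total_degree f - fst ij - snd ij - 1) * gz' * gy t ^ snd ij) * gx t ^ fst ij))) (at t)"
    unfolding homog_eq mult.assoc
    by (intro DERIV_sum DERIV_cmult DERIV_mult[OF pw[unfolded mult.assoc] DERIV_mult[OF pw[unfolded mult.assoc] pw[unfolded mult.assoc]], unfolded mult.assoc] assms)
  then show ?thesis
    by (rule DERIV_cong)
       (simp add: homog_dx_def homog_dy_def homog_dz_def sum_distrib_left sum_distrib_right sum.distrib algebra_simps)
qed

lemma deriv_homog:
  "deriv (\<lambda>x. homog f x y z) x = homog_dx f x y z"
  "deriv (\<lambda>y. homog f x y z) y = homog_dy f x y z"
proof -
  show "deriv (\<lambda>x. homog f x y z) x = homog_dx f x y z"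
    using homog_has_derivative[of "\<lambda>x. x" 1 x "\<lambda>_. y" 0 "\<lambda>_. z" 0 f]
    by (intro DERIV_imp_deriv) auto
  show "deriv (\<lambda>y. homog f x y z) y = homog_dy f x y z"
    using homog_has_derivative[of "\<lambda>_. x" 0 y "\<lambda>y. y" 1 "\<lambda>_. z" 0 f]
    by (intro DERIV_imp_deriv) auto
qed

lemma homog_euler:
  "x * homog_dx f x y z + y * homog_dy f x y z + z * homog_dz f x y z = of_nat (total_degree f) * homog f x y z"
  unfolding homog_dx_def homog_dy_def homog_dz_def homog_eq sum_distrib_left sum.distrib[symmetric]
proof (intro sum.cong refl)
  fix ij assume ij: "ij \<in> monomials f"
  have pw: "w * (of_nat n * w ^ (n - 1)) = of_nat n * w ^ n" for w :: complex and n by (cases n) auto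
  have "x * (c * (of_nat i * x ^ (i - 1)) * y ^ j * z ^ (d - i - j)) + y * (c * x ^ i * (of_nat j * y ^ (j - 1)) * z ^ (d - i - j))
     + z * (c * x ^ i * y ^ j * (of_nat (d - i - j) * z ^ (d - i - j - 1))) = of_nat d * (c * x ^ i * y ^ j * z ^ (d - i - j))"
    if ijd: "i + j \<le> d" for c i j d
  proof -
    obtain k where d: "d = i + j + k" using le_Suc_ex[OF ijd] ..
    have "x * (c * (of_nat i * x ^ (i - 1)) * y ^ j * z ^ k) + y * (c * x ^ i * (of_nat j * y ^ (j - 1)) * z ^ k)
     + z * (c * x ^ i * y ^ j * (of_nat k * z ^ (k - 1)))
     = c * ((x * (of_nat i * x ^ (i - 1))) * y ^ j * z ^ k + x ^ i * (y * (of_nat j * y ^ (j - 1))) * z ^ k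
        + x ^ i * y ^ j * (z * (of_nat k * z ^ (k - 1))))"
      by (simp only: algebra_simps)
    also have "\<dots> = of_nat (i + j + k) * (c * x ^ i * y ^ j * z ^ k)"
      unfolding pw by (simp add: algebra_simps)
    finally show ?thesis by (simp add: d)
  qed
  note gen = this
  show "x * (cf f ij * (of_nat (fst ij) * x ^ (fst ij - 1)) * y ^ snd ij * z ^ (total_degree f - fst ij - snd ij)) +
     y * (cf f ij * x ^ fst ij * (of_nat (snd ij) * y ^ (snd ij - 1)) * z ^ (total_degree f - fst ij - snd ij)) +
     z * (cf f ij * x ^ fst ij * y ^ snd ij * (of_nat (total_degree f - fst ij - snd ij) * z ^ (total_degree f - fst ij - snd ij - 1))) =
     of_nat (total_degree f) * (cf f ij * x ^ fst ij * y ^ snd ij * z ^ (total_degree f - fst ij - snd ij))"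
    by (rule gen[OF monomials_degree[OF ij]])
qed

text \<open>Both sides come from differentiating \<open>homog_dehomogenize\<close> with
  \<open>z\<close> fixed; the extra factor \<open>z\<close> is the chain rule for
  \<open>x / z\<close> and \<open>y / z\<close>.\<close>

lemma pderiv_dehomogenize:
  assumes z: "z \<noteq> 0"
  shows "homog_dx f x y z * z = z ^ total_degree f * eval2 (pderiv f) (x / z) (y / z)"
    "homog_dy f x y z * z = z ^ total_degree f * eval2 (pderiv2 f) (x / z) (y / z)"
proof -
  have "((\<lambda>x. z ^ total_degree f * eval2 f (x / z) (y / z)) has_field_derivative
     z ^ total_degree f * (eval2 (pderiv f) (x / z) (y / z) * (1 / z) + eval2 (pderiv2 f) (x / z) (y / z) * 0)) (at x)"
    by (intro DERIV_cmult has_field_derivative_eval2) (auto intro!: derivative_eq_intros simp: z)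
  then have "((\<lambda>x. homog f x y z) has_field_derivative
     z ^ total_degree f * (eval2 (pderiv f) (x / z) (y / z) * (1 / z))) (at x)"
    unfolding homog_dehomogenize[OF z] by simp
  from DERIV_imp_deriv[OF this] show "homog_dx f x y z * z = z ^ total_degree f * eval2 (pderiv f) (x / z) (y / z)"
    unfolding deriv_homog using z by simp
  have "((\<lambda>y. z ^ total_degree f * eval2 f (x / z) (y / z)) has_field_derivative
     z ^ total_degree f * (eval2 (pderiv f) (x / z) (y / z) * 0 + eval2 (pderiv2 f) (x / z) (y / z) * (1 / z))) (at y)"
    by (intro DERIV_cmult has_field_derivative_eval2) (auto intro!: derivative_eq_intros simp: z)
  then have "((\<lambda>y. homog f x y z) has_field_derivative
     z ^ total_degree f * (eval2 (pderiv2 f) (x / z) (y / z) * (1 / z))) (at y)"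
    unfolding homog_dehomogenize[OF z] by simp
  from DERIV_imp_deriv[OF this] show "homog_dy f x y z * z = z ^ total_degree f * eval2 (pderiv2 f) (x / z) (y / z)"
    unfolding deriv_homog using z by simp
qed

lemma continuous_on_homog_derivs [continuous_intros]:
  assumes "continuous_on S gx" "continuous_on S gy" "continuous_on S gz"
  shows "continuous_on S (\<lambda>t. homog f (gx t) (gy t) (gz t))"
    "continuous_on S (\<lambda>t. homog_dx f (gx t) (gy t) (gz t))"
    "continuous_on S (\<lambda>t. homog_dy f (gx t) (gy t) (gz t))"
    "continuous_on S (\<lambda>t. homog_dz f (gx t) (gy t) (gz t))"
  unfolding homog_eq homog_dx_def homog_dy_def homog_dz_def by (intro continuous_intros assms)+

lemma tendsto_homog_derivs [tendsto_intros]: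
  assumes "(gx \<longlongrightarrow> a) F" "(gy \<longlongrightarrow> b) F" "(gz \<longlongrightarrow> c) F"
  shows "((\<lambda>t. homog_dx f (gx t) (gy t) (gz t)) \<longlongrightarrow> homog_dx f a b c) F"
    "((\<lambda>t. homog_dy f (gx t) (gy t) (gz t)) \<longlongrightarrow> homog_dy f a b c) F"
    "((\<lambda>t. homog_dz f (gx t) (gy t) (gz t)) \<longlongrightarrow> homog_dz f a b c) F"
  unfolding homog_dx_def homog_dy_def homog_dz_def by (intro tendsto_intros assms)+

text \<open>Transversality to the line at infinity makes the branch of the curve at \<open>(p : q : 0)\<close>
  asymptotic to a line: its points are \<open>(p, q) / z + b (q, - p)\<close> with \<open>b\<close> near a fixed value.\<close>
lemma asymptotic_zero:
  fixes f :: "complex poly poly" and p q :: complex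
  defines "A \<equiv> q * homog_dx f p q 0 - p * homog_dy f p q 0"
  defines "b0 \<equiv> - homog_dz f p q 0 / A"
  assumes h0: "homog f p q 0 = 0" and A: "A \<noteq> 0" and \<epsilon>: "\<epsilon> > 0"
  obtains z b where "z \<noteq> 0" "norm z < \<epsilon>" "norm (b - b0) \<le> \<epsilon>"
    "homog f (p + z * b * q) (q - z * b * p) z = 0"
proof -
  \<comment> \<open>\<open>P b\<close> vanishes at \<open>z = 0\<close> for every \<open>b\<close>,
    and its derivative there is \<open>A * (b - b0)\<close>. This is where the value of
    \<open>b0\<close> comes from.\<close>
  define P where "P = (\<lambda>b z. homog f (p + z * b * q) (q - z * b * p) z)"
  define D where "D = (\<lambda>(b, z). homog_dx f (p + z * b * q) (q - z * b * p) z * (b * q)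
      + homog_dy f (p + z * b * q) (q - z * b * p) z * (- (b * p)) + homog_dz f (p + z * b * q) (q - z * b * p) z)"
  have PD: "(P b has_field_derivative D (b, z)) (at z)" for b z
  proof -
    have 1: "((\<lambda>z. p + z * b * q) has_field_derivative b * q) (at z)" by (auto intro!: derivative_eq_intros)
    have 2: "((\<lambda>z. q - z * b * p) has_field_derivative - (b * p)) (at z)" by (auto intro!: derivative_eq_intros)
    show ?thesis
      using homog_has_derivative[OF 1 2 DERIV_ident, of f] by (simp add: P_def D_def)
  qed
  have D0: "D (b, 0) = A * (b - b0)" for b
  proof -
    have "A * b0 = - homog_dz f p q 0" using A by (simp add: b0_def)
    then have "A * (b - b0) = A * b + homog_dz f p q 0" by (simp add: right_diff_distrib)
    then show ?thesis by (simp add: D_def A_def algebra_simps)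
  qed
  have "continuous_on (cball b0 \<epsilon> \<times> cball 0 1) D"
    unfolding D_def case_prod_unfold by (intro continuous_intros)
  then have "uniformly_continuous_on (cball b0 \<epsilon> \<times> cball 0 1) D"
    by (rule compact_uniformly_continuous) (intro compact_Times compact_cball)
  moreover have "norm A * \<epsilon> > 0" using A \<epsilon> by simp
  ultimately obtain d where d: "d > 0"
    "\<And>x y. x \<in> cball b0 \<epsilon> \<times> cball 0 1 \<Longrightarrow> y \<in> cball b0 \<epsilon> \<times> cball 0 1 \<Longrightarrow> dist y x < d \<Longrightarrow> dist (D y) (D x) < norm A * \<epsilon>"
    unfolding uniformly_continuous_on_def by metis
  define \<eta> where "\<eta> = min (min d 1) \<epsilon> / 2"
  have \<eta>: "\<eta> > 0" "\<eta> < d" "\<eta> \<le> 1" "\<eta> < \<epsilon>" using d \<epsilon> by (auto simp: \<eta>_def min_def)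
  define z :: complex where "z = of_real \<eta>"
  have z: "z \<noteq> 0" "norm z = \<eta>" using \<eta> by (auto simp: z_def)
  have est: "norm (P b z - z * (A * (b - b0))) \<le> norm A * \<epsilon> * \<eta>" if b: "b \<in> cball b0 \<epsilon>" for b
  proof -
    have "norm ((P b z - z * D (b, 0)) - (P b 0 - 0 * D (b, 0))) \<le> norm A * \<epsilon> * norm (z - 0)"
    proof (rule field_differentiable_bound[where S = "cball 0 \<eta>" and f' = "\<lambda>w. D (b, w) - D (b, 0)"])
      fix w :: complex assume w: "w \<in> cball 0 \<eta>"
      show "((\<lambda>z. P b z - z * D (b, 0)) has_field_derivative D (b, w) - D (b, 0)) (at w within cball 0 \<eta>)"
        by (rule has_field_derivative_at_within) (auto intro!: derivative_eq_intros PD)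
      have "dist (D (b, w)) (D (b, 0)) < norm A * \<epsilon>"
        using b w \<eta> by (intro d) (auto simp: dist_Pair_Pair)
      then show "norm (D (b, w) - D (b, 0)) \<le> norm A * \<epsilon>" by (simp add: dist_norm)
    qed (use z \<eta> in auto)
    moreover have "P b 0 = 0" using h0 by (simp add: P_def)
    ultimately show ?thesis using z(2) by (simp add: D0)
  qed
  \<comment> \<open>A Newton step in \<open>b\<close> with the limiting slope \<open>z * A\<close>.
    The estimate makes it a self-map of the ball, and Brouwer's theorem replaces an implicit
    function theorem.\<close>
  define \<phi> where "\<phi> = (\<lambda>b. b - P b z / (z * A))"
  have "continuous_on (cball b0 \<epsilon>) \<phi>"
    unfolding \<phi>_def P_def using z A by (intro continuous_intros) auto
  moreover have "\<phi> \<in> cball b0 \<epsilon> \<rightarrow> cball b0 \<epsilon>"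
  proof
    fix b assume b: "b \<in> cball b0 \<epsilon>"
    have "\<phi> b - b0 = - (P b z - z * (A * (b - b0))) / (z * A)"
      using z A by (simp add: \<phi>_def field_simps)
    then have "norm (\<phi> b - b0) = norm (P b z - z * (A * (b - b0))) / (\<eta> * norm A)"
      by (simp only: norm_divide norm_minus_cancel norm_mult z(2))
    also have "\<dots> \<le> norm A * \<epsilon> * \<eta> / (\<eta> * norm A)"
      using \<eta> by (intro divide_right_mono est b) auto
    also have "\<dots> = \<epsilon>" using \<eta> A by simp
    finally show "\<phi> b \<in> cball b0 \<epsilon>" by (simp add: dist_norm norm_minus_commute)
  qed
  ultimately obtain b where b: "b \<in> cball b0 \<epsilon>" "\<phi> b = b"
    using brouwer[OF compact_cball convex_cball] \<epsilon> by (metis cball_eq_empty not_less_iff_gr_or_eq)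
  then have "P b z = 0" using z A by (simp add: \<phi>_def)
  then show ?thesis
    using that[of z b] z \<eta> b(1) by (simp add: P_def dist_norm norm_minus_commute)
qed

text \<open>In the basis (q, -p), (p, q) the affine gradient is proportional to (K, e), and the unit
  normal is (N2, N1). Transversality gives \<open>K\<close> a nonzero limit, while Euler's relation
  makes \<open>T k * e k\<close> tend to 0, so the normal turns into the direction (q, -p) faster
  than 1 / T.\<close>

lemma asymptotic_branch:
  fixes f :: "complex poly poly" and p q :: complex
  assumes h0: "homog f p q 0 = 0" and Q: "p\<^sup>2 + q\<^sup>2 \<noteq> 0"
    and ns: "\<not> (homog_dx f p q 0 = 0 \<and> homog_dy f p q 0 = 0)"
  obtains T b N1 N2 \<rho> :: "nat \<Rightarrow> complex" and b0 \<omega> :: complex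
  where "\<omega> \<noteq> 0" "b \<longlonglongrightarrow> b0" "N2 \<longlonglongrightarrow> \<omega>" "(\<lambda>k. T k * N1 k) \<longlonglongrightarrow> 0"
    "(\<lambda>k. 1 / T k) \<longlonglongrightarrow> 0" "\<And>k. T k \<noteq> 0"
    "\<And>k. eval2 f (T k * p + b k * q) (T k * q - b k * p) = 0"
    "eventually (\<lambda>k. \<rho> k \<noteq> 0 \<and>
      \<rho> k ^ 2 = (eval2 (pderiv f) (T k * p + b k * q) (T k * q - b k * p))\<^sup>2 +
        (eval2 (pderiv2 f) (T k * p + b k * q) (T k * q - b k * p))\<^sup>2 \<and>
      eval2 (pderiv f) (T k * p + b k * q) (T k * q - b k * p) / \<rho> k = N2 k * q + N1 k * p \<and>
      eval2 (pderiv2 f) (T k * p + b k * q) (T k * q - b k * p) / \<rho> k = N1 k * q - N2 k * p) sequentially"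
proof -
  define hx hy hz where "hx = homog_dx f p q 0" and "hy = homog_dy f p q 0" and "hz = homog_dz f p q 0"
  define A where "A = q * hx - p * hy"
  define Q where "Q = p\<^sup>2 + q\<^sup>2"
  have Q0: "Q \<noteq> 0" using assms(2) by (simp add: Q_def)
  \<comment> \<open>Euler's relation at the point at infinity. Together with \<open>A = 0\<close> it
    would force \<open>hx = hy = 0\<close>, because \<open>Q\<close> is the determinant of the two
    relations up to sign.\<close>
  have eu: "p * hx + q * hy = 0" using homog_euler[of p f q 0] h0 by (simp add: hx_def hy_def)
  have A0: "A \<noteq> 0"
  proof
    assume "A = 0"
    have "Q * hx = p * (p * hx + q * hy) + q * A" "Q * hy = q * (p * hx + q * hy) - p * A"
      by (simp_all add: Q_def A_def power2_eq_square algebra_simps)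
    then have "hx = 0" "hy = 0" using Q0 eu \<open>A = 0\<close> by auto
    then show False using ns by (simp add: hx_def hy_def)
  qed
  define b0 where "b0 = - hz / A"
  have "\<exists>z b. z \<noteq> 0 \<and> norm z < inverse (real (Suc n)) \<and> norm (b - b0) \<le> inverse (real (Suc n)) \<and>
      homog f (p + z * b * q) (q - z * b * p) z = 0" for n
    using asymptotic_zero[OF h0, of "inverse (real (Suc n))"] A0
    unfolding A_def b0_def hx_def hy_def hz_def by (metis inverse_positive_iff_positive of_nat_0_less_iff zero_less_Suc)
  then obtain z b where z0: "\<And>n. z n \<noteq> 0" and zs: "\<And>n. norm (z n) < inverse (real (Suc n))"
    and bs: "\<And>n. norm (b n - b0) \<le> inverse (real (Suc n))"
    and root: "\<And>n. homog f (p + z n * b n * q) (q - z n * b n * p) (z n) = 0"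
    by metis
  have zl: "z \<longlonglongrightarrow> 0"
    by (rule Lim_null_comparison[OF _ LIMSEQ_inverse_real_of_nat]) (intro always_eventually allI less_imp_le zs)
  have "(\<lambda>n. b n - b0) \<longlonglongrightarrow> 0"
    by (rule Lim_null_comparison[OF _ LIMSEQ_inverse_real_of_nat]) (intro always_eventually allI bs)
  then have bl: "b \<longlonglongrightarrow> b0" by (simp add: LIM_zero_iff)
  define X Y where "X = (\<lambda>n. p + z n * b n * q)" and "Y = (\<lambda>n. q - z n * b n * p)"
  have "X \<longlonglongrightarrow> p + 0 * b0 * q" "Y \<longlonglongrightarrow> q - 0 * b0 * p"
    unfolding X_def Y_def by (intro tendsto_intros zl bl)+
  then have XY: "X \<longlonglongrightarrow> p" "Y \<longlonglongrightarrow> q" by simp_all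
  define Hx Hy Hz where "Hx = (\<lambda>n. homog_dx f (X n) (Y n) (z n))" and "Hy = (\<lambda>n. homog_dy f (X n) (Y n) (z n))"
    and "Hz = (\<lambda>n. homog_dz f (X n) (Y n) (z n))"
  have Hl: "Hx \<longlonglongrightarrow> hx" "Hy \<longlonglongrightarrow> hy" "Hz \<longlonglongrightarrow> hz"
    unfolding Hx_def Hy_def Hz_def hx_def hy_def hz_def by (intro tendsto_homog_derivs XY zl)+
  define K e where "K = (\<lambda>n. (q * Hx n - p * Hy n) / Q)" and "e = (\<lambda>n. (p * Hx n + q * Hy n) / Q)"
  have "K \<longlonglongrightarrow> A / Q" unfolding K_def A_def by (intro tendsto_intros Hl Q0)
  note Kl = this
  have "e \<longlonglongrightarrow> (p * hx + q * hy) / Q" unfolding e_def by (intro tendsto_intros Hl Q0)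
  then have el: "e \<longlonglongrightarrow> 0" by (simp add: eu)
  have Hxy: "Hx n = K n * q + e n * p" "Hy n = e n * q - K n * p" for n
  proof -
    have KQ: "K n * Q = q * Hx n - p * Hy n" "e n * Q = p * Hx n + q * Hy n"
      using Q0 by (simp_all add: K_def e_def)
    have "(K n * q + e n * p) * Q = q * (K n * Q) + p * (e n * Q)"
      "(e n * q - K n * p) * Q = q * (e n * Q) - p * (K n * Q)"
      by (simp_all add: algebra_simps)
    then have "(K n * q + e n * p) * Q = Hx n * Q" "(e n * q - K n * p) * Q = Hy n * Q"
      unfolding KQ by (simp_all add: Q_def power2_eq_square algebra_simps)
    then show "Hx n = K n * q + e n * p" "Hy n = e n * q - K n * p" using Q0 by auto
  qed
  define T where "T = (\<lambda>n. 1 / z n)"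
  have T0: "T n \<noteq> 0" for n using z0 by (simp add: T_def)
  \<comment> \<open>Euler's relation at a point of the curve makes \<open>e n\<close> divisible by
    \<open>z n\<close>; the limit of the quotient is 0 by the choice of \<open>b0\<close>.\<close>
  have Te: "T n * e n = - (b n * K n + Hz n / Q)" for n
  proof -
    have "X n * Hx n + Y n * Hy n + z n * Hz n = 0"
      using homog_euler[of "X n" f "Y n" "z n"] root[of n] by (simp add: Hx_def Hy_def Hz_def X_def Y_def)
    then have "(p * Hx n + q * Hy n) + z n * (b n * (q * Hx n - p * Hy n) + Hz n) = 0"
      by (simp add: X_def Y_def algebra_simps)
    then have "p * Hx n + q * Hy n = - (z n * (b n * (q * Hx n - p * Hy n) + Hz n))"
      by (simp add: eq_neg_iff_add_eq_0)
    moreover have "K n * Q = q * Hx n - p * Hy n" "e n * Q = p * Hx n + q * Hy n"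
      using Q0 by (simp_all add: K_def e_def)
    ultimately have "e n * Q = - (z n * (b n * (K n * Q) + Hz n))" by simp
    then have "e n = - (z n * (b n * (K n * Q) + Hz n)) / Q" by (rule iffD2[OF nonzero_eq_divide_eq[OF Q0]])
    also have "\<dots> = - (z n * (b n * K n + Hz n / Q))"
      using Q0 by (simp add: add_divide_distrib diff_divide_distrib algebra_simps)
    finally show ?thesis using z0[of n] by (simp add: T_def)
  qed
  have "(\<lambda>n. - (b n * K n + Hz n / Q)) \<longlonglongrightarrow> - (b0 * (A / Q) + hz / Q)"
    by (intro tendsto_intros bl Kl Hl Q0)
  moreover have "- (b0 * (A / Q) + hz / Q) = 0" using A0 by (simp add: b0_def)
  ultimately have Tel: "(\<lambda>n. T n * e n) \<longlonglongrightarrow> 0" by (simp add: Te)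
  \<comment> \<open>The two roots are taken separately since \<open>Q\<close> may lie on the branch
    cut of \<open>csqrt\<close>; the second radicand tends to 1, where \<open>csqrt\<close> is
    continuous.\<close>
  define \<mu> where "\<mu> = (\<lambda>n. csqrt Q * csqrt (1 + (e n / K n)\<^sup>2))"
  have AQ: "A / Q \<noteq> 0" using A0 Q0 by simp
  have "(\<lambda>n. 1 + (e n / K n)\<^sup>2) \<longlonglongrightarrow> 1 + (0 / (A / Q))\<^sup>2"
    by (intro tendsto_intros el Kl AQ)
  then have ul: "(\<lambda>n. 1 + (e n / K n)\<^sup>2) \<longlonglongrightarrow> 1" by simp
  have "isCont csqrt 1" by (rule continuous_at_csqrt) simp
  then have "(\<lambda>n. csqrt (1 + (e n / K n)\<^sup>2)) \<longlonglongrightarrow> csqrt 1"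
    by (rule isCont_tendsto_compose) (rule ul)
  then have "\<mu> \<longlonglongrightarrow> csqrt Q * csqrt 1" unfolding \<mu>_def by (intro tendsto_intros)
  then have ml: "\<mu> \<longlonglongrightarrow> csqrt Q" by simp
  have sQ: "csqrt Q \<noteq> 0" using Q0 by simp
  have "eventually (\<lambda>n. K n \<noteq> 0) sequentially" by (rule tendsto_imp_eventually_ne[OF Kl AQ])
  moreover have "eventually (\<lambda>n. \<mu> n \<noteq> 0) sequentially" by (rule tendsto_imp_eventually_ne[OF ml sQ])
  ultimately have ev: "eventually (\<lambda>n. K n \<noteq> 0 \<and> \<mu> n \<noteq> 0) sequentially" by (rule eventually_conj)
  \<comment> \<open>The ratio between the affine gradient of \<open>f\<close> and the corresponding
    partial derivatives of its homogenization.\<close>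
  define c where "c = (\<lambda>n. z n / z n ^ total_degree f)"
  have c0: "c n \<noteq> 0" for n using z0 by (simp add: c_def)
  have pts: "T n * p + b n * q = X n / z n" "T n * q - b n * p = Y n / z n" for n
    using z0[of n] by (simp_all add: T_def X_def Y_def field_simps)
  have fxy: "eval2 (pderiv f) (X n / z n) (Y n / z n) = c n * Hx n"
    "eval2 (pderiv2 f) (X n / z n) (Y n / z n) = c n * Hy n" for n
    using pderiv_dehomogenize[OF z0[of n], of f "X n" "Y n"] z0[of n]
    by (simp_all add: c_def Hx_def Hy_def field_simps)
  show ?thesis
  proof (rule that[of "1 / csqrt Q" b b0 "\<lambda>n. 1 / \<mu> n" T "\<lambda>n. e n / (K n * \<mu> n)" "\<lambda>n. c n * K n * \<mu> n"])
    show "1 / csqrt Q \<noteq> 0" using sQ by simp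
    show "(\<lambda>n. 1 / \<mu> n) \<longlonglongrightarrow> 1 / csqrt Q" by (intro tendsto_intros ml sQ)
    have "(\<lambda>n. (T n * e n) / (K n * \<mu> n)) \<longlonglongrightarrow> 0 / (A / Q * csqrt Q)"
      using AQ sQ by (intro tendsto_intros Tel Kl ml) auto
    then show "(\<lambda>n. T n * (e n / (K n * \<mu> n))) \<longlonglongrightarrow> 0" by simp
    show "(\<lambda>n. 1 / T n) \<longlonglongrightarrow> 0" using zl by (simp add: T_def)
    show "eval2 f (T n * p + b n * q) (T n * q - b n * p) = 0" for n
      unfolding pts using root[of n] homog_dehomogenize[OF z0[of n], of f "X n" "Y n"] z0[of n]
      by (simp add: X_def Y_def)
    show "\<forall>\<^sub>F n in sequentially. c n * K n * \<mu> n \<noteq> 0 \<and>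
      (c n * K n * \<mu> n)\<^sup>2 = (eval2 (pderiv f) (T n * p + b n * q) (T n * q - b n * p))\<^sup>2 +
         (eval2 (pderiv2 f) (T n * p + b n * q) (T n * q - b n * p))\<^sup>2 \<and>
      eval2 (pderiv f) (T n * p + b n * q) (T n * q - b n * p) / (c n * K n * \<mu> n) = 1 / \<mu> n * q + e n / (K n * \<mu> n) * p \<and>
      eval2 (pderiv2 f) (T n * p + b n * q) (T n * q - b n * p) / (c n * K n * \<mu> n) = e n / (K n * \<mu> n) * q - 1 / \<mu> n * p"
      using ev
    proof eventually_elim
      case (elim n)
      have m2: "(\<mu> n)\<^sup>2 * (K n)\<^sup>2 = Q * ((K n)\<^sup>2 + (e n)\<^sup>2)"
        using elim by (simp add: \<mu>_def power_mult_distrib power_divide field_simps)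
      have "(c n * K n * \<mu> n)\<^sup>2 = (c n)\<^sup>2 * (Q * ((K n)\<^sup>2 + (e n)\<^sup>2))"
        unfolding m2[symmetric] by (simp add: power_mult_distrib)
      also have "\<dots> = (c n * Hx n)\<^sup>2 + (c n * Hy n)\<^sup>2"
        unfolding Hxy by (simp add: Q_def power2_eq_square algebra_simps)
      finally show ?case
        unfolding pts fxy using elim c0[of n] by (simp add: Hxy field_simps)
    qed
  qed (use bl T0 in auto)
qed

section \<open>Comparison of leading terms along the branch\<close>

lemma poly_difference_quotient:
  fixes p :: "complex poly"
  obtains h where "\<And>x y. poly p x - poly p y = (x - y) * eval2 h x y"
proof -
  have "\<exists>h. \<forall>x y. poly p x - poly p y = (x - y) * eval2 h x y"
  proof (induction p)
    case 0 show ?case by (rule exI[of _ 0]) simp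
  next
    case (pCons a p)
    then obtain h where h: "\<And>x y. poly p x - poly p y = (x - y) * eval2 h x y" by blast
    have "poly (pCons a p) x - poly (pCons a p) y = (x - y) * eval2 ([:p:] + pCons 0 h) x y" for x y
    proof -
      have "poly (pCons a p) x - poly (pCons a p) y = x * (poly p x - poly p y) + (x - y) * poly p y"
        by (simp add: algebra_simps)
      then show ?thesis unfolding h by (simp add: algebra_simps)
    qed
    then show ?case by blast
  qed
  then show ?thesis using that by blast
qed

text \<open>The arguments of \<open>g\<close> are the coordinates along and across the asymptote.
  Between the two points the first differs by \<open>- 2 * \<delta> * N2 k\<close>, of order 1, the
  second only by \<open>2 * \<delta> * N1 k\<close>, which is o(1/T). So the part of degree j in the
  first variable changes by order T^(j-1), through that variable alone, and only the top degree
  survives the scaling.\<close>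

lemma leading_difference:
  fixes T b N1 N2 :: "nat \<Rightarrow> complex" and \<alpha> \<delta> :: complex and g :: "complex poly poly"
  defines "U1 \<equiv> \<lambda>k. T k + \<alpha> * N1 k - \<delta> * N2 k" and "U2 \<equiv> \<lambda>k. T k + \<alpha> * N1 k + \<delta> * N2 k"
    and "V1 \<equiv> \<lambda>k. b k + \<alpha> * N2 k + \<delta> * N1 k" and "V2 \<equiv> \<lambda>k. b k + \<alpha> * N2 k - \<delta> * N1 k"
  assumes bl: "b \<longlonglongrightarrow> b0" and N2: "N2 \<longlonglongrightarrow> w" and TN: "(\<lambda>k. T k * N1 k) \<longlonglongrightarrow> 0"
    and iT: "(\<lambda>k. 1 / T k) \<longlonglongrightarrow> 0" and T0: "\<And>k. T k \<noteq> 0"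
  shows "(\<lambda>k. (eval2 g (U1 k) (V1 k) - eval2 g (U2 k) (V2 k)) * T k / T k ^ degree g)
    \<longlonglongrightarrow> - 2 * of_nat (degree g) * \<delta> * w * poly (lead_coeff g) (b0 + \<alpha> * w)"
proof -
  define m where "m = degree g"
  have "(\<lambda>k. (T k * N1 k) * (1 / T k)) \<longlonglongrightarrow> 0 * 0" by (intro tendsto_intros TN iT)
  then have N1: "N1 \<longlonglongrightarrow> 0" using T0 by simp
  define u1 u2 where "u1 = (\<lambda>k. 1 + (\<alpha> * N1 k - \<delta> * N2 k) * (1 / T k))"
    and "u2 = (\<lambda>k. 1 + (\<alpha> * N1 k + \<delta> * N2 k) * (1 / T k))"
  have "u1 \<longlonglongrightarrow> 1 + (\<alpha> * 0 - \<delta> * w) * 0" "u2 \<longlonglongrightarrow> 1 + (\<alpha> * 0 + \<delta> * w) * 0"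
    unfolding u1_def u2_def by (intro tendsto_intros N1 N2 iT)+
  then have ul: "u1 \<longlonglongrightarrow> 1" "u2 \<longlonglongrightarrow> 1" by simp_all
  have U: "U1 k = T k * u1 k" "U2 k = T k * u2 k" for k
    using T0[of k] by (simp_all add: U1_def U2_def u1_def u2_def field_simps)
  have "V1 \<longlonglongrightarrow> b0 + \<alpha> * w + \<delta> * 0" "V2 \<longlonglongrightarrow> b0 + \<alpha> * w - \<delta> * 0"
    unfolding V1_def V2_def by (intro tendsto_intros bl N1 N2)+
  then have Vl: "V1 \<longlonglongrightarrow> b0 + \<alpha> * w" "V2 \<longlonglongrightarrow> b0 + \<alpha> * w" by simp_all
  define s where "s = (\<lambda>j k. (poly (coeff g j) (V1 k) * U1 k ^ j - poly (coeff g j) (V2 k) * U2 k ^ j) * T k / T k ^ j)"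
  have sl: "s j \<longlonglongrightarrow> - 2 * of_nat j * \<delta> * w * poly (coeff g j) (b0 + \<alpha> * w)" for j
  proof -
    obtain h where h: "\<And>x y. poly (coeff g j) x - poly (coeff g j) y = (x - y) * eval2 h x y"
      by (rule poly_difference_quotient[of "coeff g j"]) blast
    have pc: "(\<lambda>k. poly (coeff g j) (V1 k)) \<longlonglongrightarrow> poly (coeff g j) (b0 + \<alpha> * w)"
      by (intro tendsto_intros Vl)
    have "(\<lambda>k. \<Sum>i<j. u2 k ^ (j - Suc i) * u1 k ^ i) \<longlonglongrightarrow> (\<Sum>i<j. 1 ^ (j - Suc i) * 1 ^ i)"
      by (intro tendsto_intros ul)
    then have S: "(\<lambda>k. \<Sum>i<j. u2 k ^ (j - Suc i) * u1 k ^ i) \<longlonglongrightarrow> of_nat j" by simp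
    have eq: "s j k = poly (coeff g j) (V1 k) * ((- 2 * \<delta> * N2 k) * (\<Sum>i<j. u2 k ^ (j - Suc i) * u1 k ^ i))
        + (2 * \<delta> * (T k * N1 k)) * eval2 h (V1 k) (V2 k) * u2 k ^ j" for k
    proof -
      have "s j k = (poly (coeff g j) (V1 k) * u1 k ^ j - poly (coeff g j) (V2 k) * u2 k ^ j) * T k"
        using T0[of k] by (simp add: s_def U power_mult_distrib field_simps)
      also have "\<dots> = poly (coeff g j) (V1 k) * ((u1 k ^ j - u2 k ^ j) * T k)
          + (poly (coeff g j) (V1 k) - poly (coeff g j) (V2 k)) * T k * u2 k ^ j"
        by (simp add: algebra_simps)
      also have "(u1 k ^ j - u2 k ^ j) * T k = ((u1 k - u2 k) * T k) * (\<Sum>i<j. u2 k ^ (j - Suc i) * u1 k ^ i)"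
        unfolding power_diff_sumr2 by (simp add: ac_simps)
      also have "(u1 k - u2 k) * T k = - 2 * \<delta> * N2 k"
        using T0[of k] by (simp add: u1_def u2_def field_simps)
      also have "(poly (coeff g j) (V1 k) - poly (coeff g j) (V2 k)) * T k =
          (2 * \<delta> * (T k * N1 k)) * eval2 h (V1 k) (V2 k)"
        unfolding h by (simp add: V1_def V2_def algebra_simps)
      finally show ?thesis .
    qed
    have "s j \<longlonglongrightarrow> poly (coeff g j) (b0 + \<alpha> * w) * ((- 2 * \<delta> * w) * of_nat j)
       + (2 * \<delta> * 0) * eval2 h (b0 + \<alpha> * w) (b0 + \<alpha> * w) * 1 ^ j"
      unfolding eq[abs_def] by (intro tendsto_intros pc S N2 TN Vl ul)
    then show ?thesis by (simp add: ac_simps)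
  qed
  have eq: "(eval2 g (U1 k) (V1 k) - eval2 g (U2 k) (V2 k)) * T k / T k ^ degree g =
     (\<Sum>j\<le>m. s j k * (1 / T k) ^ (m - j))" for k
  proof -
    have "s j k * (1 / T k) ^ (m - j) = (poly (coeff g j) (V1 k) * U1 k ^ j - poly (coeff g j) (V2 k) * U2 k ^ j) * T k / T k ^ m"
      if "j \<le> m" for j
    proof -
      have "T k ^ m = T k ^ j * T k ^ (m - j)" using that by (simp flip: power_add)
      then show ?thesis by (simp add: s_def power_divide)
    qed
    then have "(\<Sum>j\<le>m. s j k * (1 / T k) ^ (m - j)) =
       (\<Sum>j\<le>m. (poly (coeff g j) (V1 k) * U1 k ^ j - poly (coeff g j) (V2 k) * U2 k ^ j) * T k / T k ^ m)"
      by (intro sum.cong) auto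
    also have "\<dots> = (eval2 g (U1 k) (V1 k) - eval2 g (U2 k) (V2 k)) * T k / T k ^ m"
      unfolding eval2_altdef m_def by (simp only: sum_subtractf sum_divide_distrib sum_distrib_right left_diff_distrib diff_divide_distrib)
    finally show ?thesis by (simp add: m_def)
  qed
  have "(\<lambda>k. \<Sum>j\<le>m. s j k * (1 / T k) ^ (m - j)) \<longlonglongrightarrow>
     (\<Sum>j\<le>m. (- 2 * of_nat j * \<delta> * w * poly (coeff g j) (b0 + \<alpha> * w)) * 0 ^ (m - j))"
    by (intro tendsto_intros sl iT)
  also have "(\<Sum>j\<le>m. (- 2 * of_nat j * \<delta> * w * poly (coeff g j) (b0 + \<alpha> * w)) * 0 ^ (m - j)) =
     - 2 * of_nat m * \<delta> * w * poly (coeff g m) (b0 + \<alpha> * w)"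
  proof -
    have "(\<Sum>j\<le>m. (- 2 * of_nat j * \<delta> * w * poly (coeff g j) (b0 + \<alpha> * w)) * 0 ^ (m - j)) =
      (\<Sum>j\<in>{m}. (- 2 * of_nat j * \<delta> * w * poly (coeff g j) (b0 + \<alpha> * w)) * 0 ^ (m - j))"
      by (intro sum.mono_neutral_right) auto
    then show ?thesis by simp
  qed
  finally show ?thesis unfolding eq m_def .
qed

text \<open>Equality of \<open>F\<close> at mirror images in the normal line: the offset is
  \<open>\<alpha>\<close> along (n1, n2) and \<open>\<delta>\<close>, with either sign, along the
  tangent direction (n2, -n1). The formula makes sense for complex normals as well.\<close>

definition normal_symmetric where
  "normal_symmetric F \<alpha> \<delta> n1 n2 x y \<longleftrightarrow>
     (F (x + \<alpha> * n1 + \<delta> * n2) (y + \<alpha> * n2 - \<delta> * n1) :: complex) =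
      F (x + \<alpha> * n1 - \<delta> * n2) (y + \<alpha> * n2 + \<delta> * (n1 :: complex))"

text \<open>Near infinity the two points identified by the symmetry differ by about \<open>2 \<delta> \<omega>\<close> along the
  asymptote but only by \<open>o(1/T)\<close> across it, so the leading coefficient of \<open>F\<close> in the asymptotic
  direction has to vanish.\<close>
lemma ridge_direction:
  fixes f :: "complex poly poly" and p q :: complex and F :: "complex \<Rightarrow> complex \<Rightarrow> complex"
  assumes h0: "homog f p q 0 = 0" and Q: "p\<^sup>2 + q\<^sup>2 \<noteq> 0"
    and ns: "\<not> (homog_dx f p q 0 = 0 \<and> homog_dy f p q 0 = 0)"
  obtains b0 \<omega> :: complex where "\<omega> \<noteq> 0"
    "\<And>g \<alpha> \<delta>. \<lbrakk>\<And>U V. F (U * p + V * q) (U * q - V * p) = eval2 g U V;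
       \<And>x y \<rho>. \<lbrakk>eval2 f x y = 0; \<rho>\<^sup>2 = (eval2 (pderiv f) x y)\<^sup>2 + (eval2 (pderiv2 f) x y)\<^sup>2; \<rho> \<noteq> 0\<rbrakk> \<Longrightarrow>
         \<exists>\<rho>'\<in>{\<rho>, - \<rho>}.
          normal_symmetric F \<alpha> \<delta> (eval2 (pderiv f) x y / \<rho>') (eval2 (pderiv2 f) x y / \<rho>') x y;
       degree g \<noteq> 0; \<delta> \<noteq> 0\<rbrakk> \<Longrightarrow>
       poly (lead_coeff g) (b0 + \<alpha> * \<omega>) = 0 \<or> poly (lead_coeff g) (b0 - \<alpha> * \<omega>) = 0"
proof -
  obtain T b N1 N2 \<rho> :: "nat \<Rightarrow> complex" and b0 \<omega> :: complex
  where w: "\<omega> \<noteq> 0" and bl: "b \<longlonglongrightarrow> b0" and N2: "N2 \<longlonglongrightarrow> \<omega>" and TN: "(\<lambda>k. T k * N1 k) \<longlonglongrightarrow> 0"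
    and iT: "(\<lambda>k. 1 / T k) \<longlonglongrightarrow> 0" and T0: "\<And>k. T k \<noteq> 0"
    and on: "\<And>k. eval2 f (T k * p + b k * q) (T k * q - b k * p) = 0"
    and ev: "eventually (\<lambda>k. \<rho> k \<noteq> 0 \<and>
      \<rho> k ^ 2 = (eval2 (pderiv f) (T k * p + b k * q) (T k * q - b k * p))\<^sup>2 +
        (eval2 (pderiv2 f) (T k * p + b k * q) (T k * q - b k * p))\<^sup>2 \<and>
      eval2 (pderiv f) (T k * p + b k * q) (T k * q - b k * p) / \<rho> k = N2 k * q + N1 k * p \<and>
      eval2 (pderiv2 f) (T k * p + b k * q) (T k * q - b k * p) / \<rho> k = N1 k * q - N2 k * p) sequentially"
    by (rule asymptotic_branch[OF h0 Q ns]) blast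
  have "poly (lead_coeff g) (b0 + \<alpha> * \<omega>) = 0 \<or> poly (lead_coeff g) (b0 - \<alpha> * \<omega>) = 0"
    if F: "\<And>U V. F (U * p + V * q) (U * q - V * p) = eval2 g U V"
    and sym: "\<And>x y \<rho>. \<lbrakk>eval2 f x y = 0; \<rho>\<^sup>2 = (eval2 (pderiv f) x y)\<^sup>2 + (eval2 (pderiv2 f) x y)\<^sup>2; \<rho> \<noteq> 0\<rbrakk> \<Longrightarrow>
         \<exists>\<rho>'\<in>{\<rho>, - \<rho>}.
          normal_symmetric F \<alpha> \<delta> (eval2 (pderiv f) x y / \<rho>') (eval2 (pderiv2 f) x y / \<rho>') x y"
    and nz: "degree g \<noteq> 0" "\<delta> \<noteq> 0" for g \<alpha> \<delta>
  proof -
    define E where "E = (\<lambda>N1 N2 k. (eval2 g (T k + \<alpha> * N1 k - \<delta> * N2 k) (b k + \<alpha> * N2 k + \<delta> * N1 k)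
       - eval2 g (T k + \<alpha> * N1 k + \<delta> * N2 k) (b k + \<alpha> * N2 k - \<delta> * N1 k)) * T k / T k ^ degree g)"
    define M1 M2 where "M1 = (\<lambda>k. - N1 k)" and "M2 = (\<lambda>k. - N2 k)"
    have 1: "E N1 N2 \<longlonglongrightarrow> - 2 * of_nat (degree g) * \<delta> * \<omega> * poly (lead_coeff g) (b0 + \<alpha> * \<omega>)"
      unfolding E_def by (rule leading_difference[OF bl N2 TN iT T0])
    have M2: "M2 \<longlonglongrightarrow> - \<omega>" unfolding M2_def by (intro tendsto_intros N2)
    have "(\<lambda>k. T k * M1 k) \<longlonglongrightarrow> 0" using tendsto_minus[OF TN] by (simp add: M1_def)
    then have 2: "E M1 M2 \<longlonglongrightarrow> - 2 * of_nat (degree g) * \<delta> * (- \<omega>) * poly (lead_coeff g) (b0 + \<alpha> * (- \<omega>))"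
      unfolding E_def by (rule leading_difference[OF bl M2 _ iT T0])
    \<comment> \<open>The sign of the normal for which the symmetry holds may vary with
      \<open>k\<close>, so only the product of the two differences is known to vanish.\<close>
    have "eventually (\<lambda>k. E N1 N2 k * E M1 M2 k = 0) sequentially"
      using ev
    proof eventually_elim
      case (elim k)
      define x y where "x = T k * p + b k * q" and "y = T k * q - b k * p"
      have f1: "eval2 (pderiv f) x y / \<rho> k = N2 k * q + N1 k * p" "eval2 (pderiv2 f) x y / \<rho> k = N1 k * q - N2 k * p"
        using elim by (simp_all add: x_def y_def)
      have f2: "eval2 (pderiv f) x y / (- \<rho> k) = M2 k * q + M1 k * p" "eval2 (pderiv2 f) x y / (- \<rho> k) = M1 k * q - M2 k * p"
        unfolding divide_minus_right f1 by (simp_all add: M1_def M2_def)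
      have FE: "F (x + \<alpha> * (n2 * q + n1 * p) + \<delta> * (n1 * q - n2 * p)) (y + \<alpha> * (n1 * q - n2 * p) - \<delta> * (n2 * q + n1 * p))
          = eval2 g (T k + \<alpha> * n1 - \<delta> * n2) (b k + \<alpha> * n2 + \<delta> * n1)" for n1 n2 \<delta>
      proof -
        have "x + \<alpha> * (n2 * q + n1 * p) + \<delta> * (n1 * q - n2 * p) = (T k + \<alpha> * n1 - \<delta> * n2) * p + (b k + \<alpha> * n2 + \<delta> * n1) * q"
          "y + \<alpha> * (n1 * q - n2 * p) - \<delta> * (n2 * q + n1 * p) = (T k + \<alpha> * n1 - \<delta> * n2) * q - (b k + \<alpha> * n2 + \<delta> * n1) * p"
          by (simp_all add: x_def y_def algebra_simps)
        then show ?thesis by (simp only: F)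
      qed
      have FE': "F (x + \<alpha> * (n2 * q + n1 * p) - \<delta> * (n1 * q - n2 * p)) (y + \<alpha> * (n1 * q - n2 * p) + \<delta> * (n2 * q + n1 * p))
          = eval2 g (T k + \<alpha> * n1 + \<delta> * n2) (b k + \<alpha> * n2 - \<delta> * n1)" for n1 n2
        using FE[of n2 n1 "- \<delta>"] by simp
      have "eval2 f x y = 0" using on by (simp add: x_def y_def)
      moreover have "(\<rho> k)\<^sup>2 = (eval2 (pderiv f) x y)\<^sup>2 + (eval2 (pderiv2 f) x y)\<^sup>2" "\<rho> k \<noteq> 0"
        using elim by (simp_all add: x_def y_def)
      ultimately obtain \<rho>' where \<rho>': "\<rho>' = \<rho> k \<or> \<rho>' = - \<rho> k" and
          eq: "normal_symmetric F \<alpha> \<delta> (eval2 (pderiv f) x y / \<rho>') (eval2 (pderiv2 f) x y / \<rho>') x y"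
        using sym[of x y "\<rho> k"] by blast
      from \<rho>' show ?case
      proof
        assume r: "\<rho>' = \<rho> k"
        have "E N1 N2 k = 0" using eq unfolding r f1 normal_symmetric_def FE FE' by (simp add: E_def)
        then show ?thesis by simp
      next
        assume r: "\<rho>' = - \<rho> k"
        have "E M1 M2 k = 0" using eq unfolding r f2 normal_symmetric_def FE FE' by (simp add: E_def)
        then show ?thesis by simp
      qed
    qed
    then have "(\<lambda>k. E N1 N2 k * E M1 M2 k) \<longlonglongrightarrow> 0" by (rule tendsto_eventually)
    from LIMSEQ_unique[OF this tendsto_mult[OF 1 2]] show ?thesis
      using nz w by auto
  qed
  with w that show ?thesis by blast
qed

section \<open>The integral as a function of the Larmor center\<close>

lemma smooth_on_closed_derivative:
  assumes "smooth_on_closed K g"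
  obtains gx gy where
    "\<And>z. z \<in> K \<Longrightarrow> (g has_derivative (\<lambda>h. Re h * gx z + Im h * gy z)) (at z)"
proof -
  obtain U where U: "K \<subseteq> U" "smooth_on2 U g" using assms by (auto simp: smooth_on_closed_def)
  from U(2) obtain gx gy where "\<forall>z\<in>U. (g has_derivative (\<lambda>h. Re h * gx z + Im h * gy z)) (at z)"
    by (cases rule: smooth_on2.cases) auto
  then show ?thesis using U(1) that by blast
qed

lemma has_derivative_of_real_wirtinger:
  assumes "(g has_derivative (\<lambda>h. Re h * gx + Im h * gy)) (at z)"
  shows "((\<lambda>z. complex_of_real (g z)) has_derivative
    (\<lambda>h. Complex (gx / 2) (- gy / 2) * h + Complex (gx / 2) (gy / 2) * cnj h)) (at z)"
proof -
  have "((\<lambda>z. complex_of_real (g z)) has_derivative (\<lambda>h. complex_of_real (Re h * gx + Im h * gy))) (at z)"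
    by (rule bounded_linear.has_derivative[OF bounded_linear_of_real assms])
  then show ?thesis
    by (rule has_derivative_eq_rhs) (simp add: fun_eq_iff complex_eq_iff field_simps)
qed

text \<open>On the unit circle \<open>cnj v = 1 / v\<close>, hence v Re v = (1 + v^2) / 2 and v Im v
  = (\<i> - \<i> v^2) / 2. The factor \<open>v ^ N\<close> removes negative powers from every
  monomial of degree at most \<open>N\<close>.\<close>

definition fourier_poly :: "nat \<Rightarrow> nat \<Rightarrow> nat \<Rightarrow> complex poly" where
  "fourier_poly N k l = monom 1 (N - k - l) * [:1 / 2, 0, 1 / 2:] ^ k * [:\<i> / 2, 0, - \<i> / 2:] ^ l"

lemma degree_fourier_poly:
  assumes "k + l \<le> N" shows "degree (fourier_poly N k l) \<le> 2 * N"
proof -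
  have "degree ([:1 / 2, 0, 1 / 2:] ^ k :: complex poly) \<le> 2 * k"
    by (rule order_trans[OF degree_power_le]) simp
  moreover have "degree ([:\<i> / 2, 0, - \<i> / 2:] ^ l :: complex poly) \<le> 2 * l"
    by (rule order_trans[OF degree_power_le]) simp
  ultimately have "degree (fourier_poly N k l) \<le> (N - k - l) + 2 * k + 2 * l"
    unfolding fourier_poly_def
    by (meson add_mono degree_monom_le degree_mult_le order_trans)
  then show ?thesis using assms by simp
qed

lemma poly_fourier_poly:
  assumes "norm v = 1" "k + l \<le> N"
  shows "poly (fourier_poly N k l) v = v ^ N * (of_real (Re v) ^ k * of_real (Im v) ^ l)"
proof -
  have c: "v * cnj v = 1" using assms(1) by (simp add: complex_norm_square[symmetric])
  have "of_real (Re v) = (v + cnj v) / 2" "of_real (Im v) = - \<i> / 2 * (v - cnj v)"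
    by (simp_all add: complex_eq_iff)
  then have "v * of_real (Re v) = v * ((v + cnj v) / 2)" "v * of_real (Im v) = v * (- \<i> / 2 * (v - cnj v))"
    by (simp_all only:)
  then have "v * of_real (Re v) = (v * v + v * cnj v) / 2" "v * of_real (Im v) = - \<i> / 2 * (v * v - v * cnj v)"
    by (simp_all only: times_divide_eq_right distrib_left right_diff_distrib mult.left_commute)
  then have v: "1 / 2 + v * (v / 2) = v * of_real (Re v)" "\<i> / 2 - v * (v * \<i>) / 2 = v * of_real (Im v)"
    unfolding c by (simp_all add: field_simps)
  have "poly (fourier_poly N k l) v = v ^ (N - k - l) * (v * of_real (Re v)) ^ k * (v * of_real (Im v)) ^ l"
    unfolding fourier_poly_def v[symmetric] by (simp add: poly_monom algebra_simps)
  also have "\<dots> = v ^ (N - k - l + k + l) * (of_real (Re v) ^ k * of_real (Im v) ^ l)"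
    by (simp add: power_add power_mult_distrib)
  finally show ?thesis using assms(2) by simp
qed

abbreviation indices :: "nat \<Rightarrow> (nat \<times> nat) set" where
  "indices N \<equiv> {(k, l). k + l \<le> N}"

definition fourier_coeff :: "nat \<Rightarrow> (nat \<Rightarrow> nat \<Rightarrow> complex \<Rightarrow> real) \<Rightarrow> nat \<Rightarrow> complex \<Rightarrow> complex" where
  "fourier_coeff N a j x = (\<Sum>(k, l)\<in>indices N. of_real (a k l x) * coeff (fourier_poly N k l) j)"

lemma fourier_coeff_eq_0: "j > 2 * N \<Longrightarrow> fourier_coeff N a j x = 0"
  unfolding fourier_coeff_def
  by (intro sum.neutral) (use degree_fourier_poly in \<open>fastforce intro: coeff_eq_0\<close>)

lemma fourier_expansion:
  assumes "norm v = 1"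
  shows "v ^ N * of_real (poly_mom N a x v) = (\<Sum>j\<le>2 * N. fourier_coeff N a j x * v ^ j)"
proof -
  have "(\<Sum>j\<le>2 * N. fourier_coeff N a j x * v ^ j) =
     (\<Sum>(k, l)\<in>indices N. of_real (a k l x) * (\<Sum>j\<le>2 * N. coeff (fourier_poly N k l) j * v ^ j))"
    unfolding fourier_coeff_def sum_distrib_right sum_distrib_left
    by (subst sum.swap) (simp add: case_prod_unfold mult.assoc sum_distrib_left)
  also have "\<dots> = (\<Sum>(k, l)\<in>indices N. of_real (a k l x) * (v ^ N * (of_real (Re v) ^ k * of_real (Im v) ^ l)))"
  proof (intro sum.cong refl, clarify)
    fix k l assume kl: "k + l \<le> N"
    have "poly (fourier_poly N k l) v = (\<Sum>j\<le>2 * N. coeff (fourier_poly N k l) j * v ^ j)"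
      unfolding poly_altdef
      by (rule sum.mono_neutral_left) (use degree_fourier_poly[OF kl] in \<open>auto simp: coeff_eq_0\<close>)
    then show "of_real (a k l x) * (\<Sum>j\<le>2 * N. coeff (fourier_poly N k l) j * v ^ j) =
      of_real (a k l x) * (v ^ N * (of_real (Re v) ^ k * of_real (Im v) ^ l))"
      using poly_fourier_poly[OF assms kl] by simp
  qed
  also have "\<dots> = v ^ N * of_real (poly_mom N a x v)"
    by (simp add: poly_mom_def sum_distrib_left case_prod_unfold algebra_simps)
  finally show ?thesis by simp
qed

lemma fourier_coeff_derivative:
  assumes "\<And>k l. k + l \<le> N \<Longrightarrow> smooth_on_closed K (a k l)"
  obtains d e where
    "\<And>j x. x \<in> K \<Longrightarrow> (fourier_coeff N a j has_derivative (\<lambda>h. d j x * h + e j x * cnj h)) (at x)"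
proof -
  have "\<exists>gx gy. \<forall>z\<in>K. (a k l has_derivative (\<lambda>h. Re h * gx z + Im h * gy z)) (at z)" if "k + l \<le> N" for k l
    using smooth_on_closed_derivative[OF assms[OF that]] by metis
  then obtain gx gy where g: "\<And>k l z. k + l \<le> N \<Longrightarrow> z \<in> K \<Longrightarrow>
      (a k l has_derivative (\<lambda>h. Re h * gx k l z + Im h * gy k l z)) (at z)"
    by metis
  define d where "d = (\<lambda>j z. \<Sum>(k, l)\<in>indices N. Complex (gx k l z / 2) (- gy k l z / 2) * coeff (fourier_poly N k l) j)"
  define e where "e = (\<lambda>j z. \<Sum>(k, l)\<in>indices N. Complex (gx k l z / 2) (gy k l z / 2) * coeff (fourier_poly N k l) j)"
  have "(fourier_coeff N a j has_derivative (\<lambda>h. d j x * h + e j x * cnj h)) (at x)" if x: "x \<in> K" for j x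
  proof -
    have "(fourier_coeff N a j has_derivative (\<lambda>h. \<Sum>kl\<in>indices N.
       (Complex (gx (fst kl) (snd kl) x / 2) (- gy (fst kl) (snd kl) x / 2) * h + Complex (gx (fst kl) (snd kl) x / 2) (gy (fst kl) (snd kl) x / 2) * cnj h)
         * coeff (fourier_poly N (fst kl) (snd kl)) j)) (at x)"
      unfolding fourier_coeff_def[abs_def] case_prod_unfold
      by (intro has_derivative_sum has_derivative_mult_left has_derivative_of_real_wirtinger g x) auto
    then show ?thesis
      by (rule has_derivative_eq_rhs)
         (simp add: fun_eq_iff d_def e_def case_prod_unfold sum_distrib_left sum_distrib_right sum.distrib algebra_simps)
  qed
  then show ?thesis by (rule that)
qed

text \<open>The conserved quantity is differentiated at time 0 and multiplied by \<open>v\<close>: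
  the position moves with velocity \<open>v\<close>, the velocity rotates at rate \<i> / r, and
  \<open>v * cnj v = 1\<close>. Eliminating \<open>c\<close> by the relation at time 0 contributes
  the term with - N.\<close>

lemma transport_equation:
  fixes B :: "nat \<Rightarrow> complex \<Rightarrow> complex"
  assumes r: "r \<noteq> 0" and v: "norm v = 1"
    and B: "\<And>j. (B j has_derivative (\<lambda>h. d j * h + e j * cnj h)) (at x)"
    and const: "eventually (\<lambda>u. (\<Sum>j\<le>M. B j (mag_pos r x v u) * mag_vel r v u ^ j) = c * mag_vel r v u ^ N) (nhds 0)"
  shows "(\<Sum>k\<le>M. e k * v ^ k + d k * v ^ (k + 2) + (\<i> / of_real r * (of_nat k - of_nat N) * B k x) * v ^ (k + 1)) = 0"
proof -
  have pos: "(mag_pos r x v has_vector_derivative v) (at 0)" using mag_pos_deriv[OF r, of x v 0] by simp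
  have vel: "(mag_vel r v has_vector_derivative \<i> / of_real r * v) (at 0)" using mag_vel_deriv[OF r, of v 0] by simp
  have pw: "((\<lambda>u. mag_vel r v u ^ n) has_vector_derivative of_nat n * v ^ (n - 1) * (\<i> / of_real r * v)) (at 0)" for n
  proof -
    have "((\<lambda>w. w ^ n) has_field_derivative of_nat n * v ^ (n - 1)) (at (mag_vel r v 0))"
      by (auto intro!: derivative_eq_intros)
    from field_vector_diff_chain_at[OF vel this] show ?thesis by (simp add: o_def ac_simps)
  qed
  have Bd: "((\<lambda>u. B j (mag_pos r x v u)) has_vector_derivative (d j * v + e j * cnj v)) (at 0)" for j
  proof -
    have "((\<lambda>u. B j (mag_pos r x v u)) has_derivative (\<lambda>h. d j * (h *\<^sub>R v) + e j * cnj (h *\<^sub>R v))) (at 0)"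
      using has_derivative_compose[OF pos[unfolded has_vector_derivative_def], of "B j" "\<lambda>h. d j * h + e j * cnj h"] B[of j]
      by simp
    then show ?thesis unfolding has_vector_derivative_def
      by (rule has_derivative_eq_rhs) (simp add: fun_eq_iff scaleR_conv_of_real algebra_simps)
  qed
  have D1: "((\<lambda>u. \<Sum>j\<le>M. B j (mag_pos r x v u) * mag_vel r v u ^ j) has_vector_derivative
     (\<Sum>j\<le>M. B j x * (of_nat j * v ^ (j - 1) * (\<i> / of_real r * v)) + (d j * v + e j * cnj v) * v ^ j)) (at 0)"
    using has_vector_derivative_mult[OF Bd pw] by (intro has_vector_derivative_sum) simp
  have D2: "((\<lambda>u. c * mag_vel r v u ^ N) has_vector_derivative c * (of_nat N * v ^ (N - 1) * (\<i> / of_real r * v))) (at 0)"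
    by (intro has_vector_derivative_mult_right pw)
  have "((\<lambda>u. \<Sum>j\<le>M. B j (mag_pos r x v u) * mag_vel r v u ^ j) has_vector_derivative
      c * (of_nat N * v ^ (N - 1) * (\<i> / of_real r * v))) (at 0)"
    using D2 unfolding has_vector_derivative_def
  proof (rule has_derivative_transform_eventually)
    show "\<forall>\<^sub>F u in at 0. c * mag_vel r v u ^ N = (\<Sum>j\<le>M. B j (mag_pos r x v u) * mag_vel r v u ^ j)"
      using const by (auto simp: eventually_at_filter elim!: eventually_mono)
    show "c * mag_vel r v 0 ^ N = (\<Sum>j\<le>M. B j (mag_pos r x v 0) * mag_vel r v 0 ^ j)"
      using eventually_nhds_x_imp_x[OF const] by simp
  qed simp
  from vector_derivative_unique_at[OF D1 this]
  have eq: "(\<Sum>j\<le>M. B j x * (of_nat j * v ^ (j - 1) * (\<i> / of_real r * v)) + (d j * v + e j * cnj v) * v ^ j)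
     = c * (of_nat N * v ^ (N - 1) * (\<i> / of_real r * v))" .
  have c0: "c * v ^ N = (\<Sum>j\<le>M. B j x * v ^ j)"
    using eventually_nhds_x_imp_x[OF const] by simp
  have nv: "of_nat n * v ^ (n - 1) * v = of_nat n * v ^ n" for n by (cases n) auto
  have vc: "v * cnj v = 1" using v by (simp add: complex_norm_square[symmetric])
  have "v * (c * (of_nat N * v ^ (N - 1) * (\<i> / of_real r * v))) = v * (\<i> / of_real r) * c * (of_nat N * v ^ (N - 1) * v)"
    by (simp add: algebra_simps)
  also have "\<dots> = v * (\<i> / of_real r) * of_nat N * (c * v ^ N)"
    unfolding nv by (simp add: algebra_simps)
  also have "\<dots> = (\<Sum>j\<le>M. (\<i> / of_real r * of_nat N * B j x) * v ^ (j + 1))"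
    unfolding c0 sum_distrib_left by (simp add: algebra_simps)
  finally have R: "v * (c * (of_nat N * v ^ (N - 1) * (\<i> / of_real r * v))) = \<dots>" .
  have L: "v * (B j x * (of_nat j * v ^ (j - 1) * (\<i> / of_real r * v)) + (d j * v + e j * cnj v) * v ^ j)
     = e j * v ^ j + d j * v ^ (j + 2) + (\<i> / of_real r * of_nat j * B j x) * v ^ (j + 1)" for j
  proof -
    have "v * (B j x * (of_nat j * v ^ (j - 1) * (\<i> / of_real r * v)) + (d j * v + e j * cnj v) * v ^ j)
      = v * (\<i> / of_real r) * B j x * (of_nat j * v ^ (j - 1) * v) + d j * v ^ (j + 2) + e j * (v * cnj v) * v ^ j"
      by (simp add: algebra_simps)
    then show ?thesis unfolding nv vc by (simp add: algebra_simps)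
  qed
  have "(\<Sum>k\<le>M. e k * v ^ k + d k * v ^ (k + 2) + (\<i> / of_real r * (of_nat k - of_nat N) * B k x) * v ^ (k + 1)) =
    (\<Sum>k\<le>M. e k * v ^ k + d k * v ^ (k + 2) + (\<i> / of_real r * of_nat k * B k x) * v ^ (k + 1))
     - (\<Sum>j\<le>M. (\<i> / of_real r * of_nat N * B j x) * v ^ (j + 1))"
    by (simp add: sum_subtractf[symmetric] algebra_simps)
  also have "\<dots> = 0"
    unfolding R[symmetric] L[symmetric] sum_distrib_left[symmetric] eq by simp
  finally show ?thesis .
qed

context magnetic_table
begin

lemma W_subset_annulus: "W \<subseteq> annulus_plus \<gamma> r"
  unfolding W_def annulus_plus_def by force

text \<open>The identity is derived on the open strip \<open>W\<close> and then carried to the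
  closed annulus, because the reflection law is stated on the edge
  \<open>\<tau> = 0\<close>.\<close>

lemma integral_polynomial_in_center:
  assumes int: "is_poly_integral \<gamma> L r N a"
  obtains F where "polyfun2 F"
    "\<And>x v. x \<in> annulus_plus \<gamma> r \<Longrightarrow> norm v = 1 \<Longrightarrow>
      of_real (poly_mom N a x v) = F (x + \<i> * of_real r * v) (cnj (x + \<i> * of_real r * v))"
proof -
  define B where "B = fourier_coeff N a"
  define c :: "nat \<Rightarrow> complex" where "c = (\<lambda>k. \<i> / of_real r * (of_nat k - of_nat N))"
  have r0: "r \<noteq> 0" using r_pos by simp
  obtain d e where dB: "\<And>j x. x \<in> annulus_plus \<gamma> r \<Longrightarrow> (B j has_derivative (\<lambda>h. d j x * h + e j x * cnj h)) (at x)"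
    unfolding B_def using fourier_coeff_derivative[of N "annulus_plus \<gamma> r" a] int
    unfolding is_poly_integral_def by metis
  have dBW: "(B j has_derivative (\<lambda>h. d j x * h + e j x * cnj h)) (at x)" if "x \<in> W" for j x
    using dB W_subset_annulus that by blast
  have B0: "B j x = 0" if "j > 2 * N" for j x unfolding B_def by (rule fourier_coeff_eq_0[OF that])
  have de0: "d j x = 0" "e j x = 0" if "j > 2 * N" "x \<in> W" for j x
  proof -
    have "B j = (\<lambda>x. 0)" using B0[OF that(1)] by (simp add: fun_eq_iff)
    then have "(B j has_derivative (\<lambda>h. 0 * h + 0 * cnj h)) (at x)" by simp
    from wirtinger_unique[OF dBW[OF that(2)] this] show "d j x = 0" "e j x = 0" by auto
  qed
  have trans: "(\<Sum>k\<le>2 * N. e k x * v ^ k + d k x * v ^ (k + 2) + (c k * B k x) * v ^ (k + 1)) = 0"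
    if x: "x \<in> W" and v: "norm v = 1" and out: "mag_pos r x v b \<in> outside crv" for x v b
  proof -
    have "x \<in> inside crv" using x unfolding W_eq by simp
    from backward_orbit[OF this v out]
    obtain s w t1 \<delta> where w: "norm w = 1" "nu s \<bullet> w > 0" and t1: "t1 > 0" "\<delta> > 0"
      and pos: "\<And>u. mag_pos r (\<gamma> s) w (t1 + u) = mag_pos r x v u"
      and vel: "\<And>u. mag_vel r w (t1 + u) = mag_vel r v u"
      and ins: "\<And>u. 0 < u \<Longrightarrow> u < t1 + \<delta> \<Longrightarrow> mag_pos r (\<gamma> s) w u \<in> inside crv" by metis
    have inv: "poly_mom N a (mag_pos r x v u) (mag_vel r v u) = poly_mom N a (\<gamma> s) w"
      if "- t1 < u" "u < \<delta>" for u
    proof -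
      have "poly_mom N a (mag_pos r (\<gamma> s) w (t1 + u)) (mag_vel r w (t1 + u)) = poly_mom N a (\<gamma> s) w"
        using int w ins that t1 unfolding is_poly_integral_def by auto
      then show ?thesis unfolding pos vel .
    qed
    show ?thesis unfolding c_def
    proof (rule transport_equation[OF r0 v dBW[OF x]])
      have "eventually (\<lambda>u. u \<in> {- t1<..<\<delta>}) (nhds 0)"
        using t1 by (intro eventually_nhds_in_open) auto
      then show "\<forall>\<^sub>F u in nhds 0. (\<Sum>j\<le>2 * N. B j (mag_pos r x v u) * mag_vel r v u ^ j) =
          of_real (poly_mom N a (\<gamma> s) w) * mag_vel r v u ^ N"
      proof eventually_elim
        case (elim u)
        have "norm (mag_vel r v u) = 1" using v by simp
        from fourier_expansion[OF this, of N a "mag_pos r x v u"] show ?case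
          using inv[of u] elim unfolding B_def by (simp add: mult.commute)
      qed
    qed
  qed
  have rec: "e 0 x = 0" "e 1 x + c 0 * B 0 x = 0" "d k x + e (k + 2) x + c (k + 1) * B (k + 1) x = 0"
    if x: "x \<in> W" for x k
  proof -
    have *: "\<And>v. v \<in> {v. norm v = 1 \<and> (\<exists>b. mag_pos r x v b \<in> outside crv)} \<Longrightarrow>
      (\<Sum>k\<le>2 * N. e k x * v ^ k + d k x * v ^ (k + 2) + (c k * B k x) * v ^ (k + 1)) = 0"
      using trans[OF x] by blast
    note R = recursion_from_roots[of "2 * N" "\<lambda>k. e k x" "\<lambda>k. c k * B k x" "\<lambda>k. d k x",
        OF de0(2)[OF _ x] _ de0(1)[OF _ x] infinite_orbit_directions[OF x] *]
    show "e 0 x = 0" "e 1 x + c 0 * B 0 x = 0" "d k x + e (k + 2) x + c (k + 1) * B (k + 1) x = 0"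
      using R B0 by auto
  qed
  have "wirtinger_poly W (B k)" for k
    by (rule wirtinger_poly_recursion[OF open_W connected_W dBW B0 rec])
  then obtain P where P: "\<And>k x. x \<in> W \<Longrightarrow> B k x = eval2 (P k) (cnj x) x"
    unfolding wirtinger_poly_def by metis
  \<comment> \<open>\<open>center_function\<close> asks for the zero polynomial above
    \<open>2 * N\<close>, not just for a function vanishing on \<open>W\<close>.\<close>
  define p where "p = (\<lambda>k. if k \<le> 2 * N then P k else 0)"
  have p: "B k x = eval2 (p k) (cnj x) x" if "x \<in> W" for k x
    using P[OF that, of k] B0[of k x] by (cases "k \<le> 2 * N") (simp_all add: p_def)
  have de: "d k x = eval2 (pderiv2 (p k)) (cnj x) x" "e k x = eval2 (pderiv (p k)) (cnj x) x" if "x \<in> W" for k x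
    using wirtinger_derivs_eval2[OF open_W that p dBW[OF that]] by auto
  have rp: "pderiv (p 0) = 0" "pderiv (p 1) + smult [:c 0:] (p 0) = 0"
    "\<And>k. pderiv2 (p k) + pderiv (p (k + 2)) + smult [:c (k + 1):] (p (k + 1)) = 0"
  proof -
    show "pderiv (p 0) = 0"
      by (rule eval2_cnj_eq_0[OF open_W W_ne]) (use rec(1) de in auto)
    show "pderiv (p 1) + smult [:c 0:] (p 0) = 0"
      by (rule eval2_cnj_eq_0[OF open_W W_ne]) (use rec(2) de p in auto)
    show "pderiv2 (p k) + pderiv (p (k + 2)) + smult [:c (k + 1):] (p (k + 1)) = 0" for k
      by (rule eval2_cnj_eq_0[OF open_W W_ne]) (use rec(3) de p in auto)
  qed
  obtain F where F: "polyfun2 F" "\<And>z w v. v \<noteq> 0 \<Longrightarrow> F z w * v ^ N =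
       (\<Sum>k\<le>2 * N. eval2 (p k) (w + \<i> * of_real r / v) (z - \<i> * of_real r * v) * v ^ k)"
    by (rule center_function[of r "2 * N" p N, OF r0 _ rp(1) rp(2,3)[unfolded c_def]]) (auto simp: p_def)
  have onW: "of_real (poly_mom N a x v) = F (x + \<i> * of_real r * v) (cnj (x + \<i> * of_real r * v))"
    if x: "x \<in> W" and v: "norm v = 1" for x v
  proof -
    have v0: "v \<noteq> 0" using v by auto
    have "v * cnj v = 1" using v by (simp add: complex_norm_square[symmetric])
    then have iv: "1 / v = cnj v" using v0 by (simp add: field_simps)
    have "cnj (x + \<i> * of_real r * v) + \<i> * of_real r / v = cnj x"
      using iv by (simp add: divide_inverse[of "\<i> * of_real r"] inverse_eq_divide)
    then have "F (x + \<i> * of_real r * v) (cnj (x + \<i> * of_real r * v)) * v ^ N =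
      (\<Sum>k\<le>2 * N. eval2 (p k) (cnj x) x * v ^ k)"
      unfolding F(2)[OF v0] by simp
    also have "\<dots> = v ^ N * of_real (poly_mom N a x v)"
      unfolding fourier_expansion[OF v] by (simp add: p[OF x, symmetric] B_def)
    finally show ?thesis using v0 by simp
  qed
  have "of_real (poly_mom N a x v) = F (x + \<i> * of_real r * v) (cnj (x + \<i> * of_real r * v))"
    if x: "x \<in> annulus_plus \<gamma> r" and v: "norm v = 1" for x v
  proof -
    obtain s \<tau> where xs: "x = par \<tau> s" "0 \<le> \<tau>" "\<tau> \<le> 2 * r" using x by (auto simp: annulus_plus_def)
    \<comment> \<open>Continuity along the normal segment through \<open>x\<close> reaches both
      edges of the annulus.\<close>
    define \<psi> where "\<psi> = (\<lambda>\<tau>. of_real (poly_mom N a (par \<tau> s) v)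
      - F (par \<tau> s + \<i> * of_real r * v) (cnj (par \<tau> s + \<i> * of_real r * v)))"
    have cp: "continuous_on {0..2 * r} (\<lambda>\<tau>. par \<tau> s)"
      unfolding parallel_curve_def by (intro continuous_intros)
    have "continuous_on {0..2 * r} (\<lambda>\<tau>. a k l (par \<tau> s))" if "k + l \<le> N" for k l
    proof (rule continuous_on_compose2[OF _ cp])
      have "smooth_on_closed (annulus_plus \<gamma> r) (a k l)"
        using int that unfolding is_poly_integral_def by blast
      then show "continuous_on (annulus_plus \<gamma> r) (a k l)"
        using smooth_on_closed_derivative has_derivative_continuous continuous_at_imp_continuous_on by metis
    qed (use annulus_plus_def in auto, blast)
    moreover obtain fp where fp: "F = eval2 fp" using F(1) by (auto simp: polyfun2_def)
    ultimately have "continuous_on {0..2 * r} \<psi>"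
      unfolding \<psi>_def poly_mom_def fp case_prod_unfold
      by (intro continuous_intros cp) auto
    moreover have cl: "closure {0<..<2 * r} = {0..2 * r}" using r_pos by simp
    ultimately have "continuous_on (closure {0<..<2 * r}) \<psi>" by simp
    moreover have "\<psi> \<tau> = 0" if "\<tau> \<in> {0<..<2 * r}" for \<tau>
      using onW[OF _ v, of "par \<tau> s"] that by (auto simp: \<psi>_def W_def)
    ultimately have "\<psi> \<tau> = 0"
      using xs cl by (intro continuous_constant_on_closure[of "{0<..<2 * r}" \<psi> 0 \<tau>]) auto
    then show ?thesis by (simp add: \<psi>_def xs(1))
  qed
  with F(1) that show ?thesis by blast
qed

end

section \<open>The tangency theorem\<close>

context jordan_ccw
begin

lemma kvec_parallel: obtains \<kappa> where "kvec s = of_real \<kappa> * nu s"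
proof -
  have "((\<lambda>u. T u \<bullet> T u) has_vector_derivative (T s \<bullet> kvec s + kvec s \<bullet> T s)) (at s)"
    by (intro bounded_bilinear.has_vector_derivative[OF bounded_bilinear_inner] kvec_deriv)
  moreover have "((\<lambda>u. T u \<bullet> T u) has_vector_derivative 0) (at s)"
    by (simp add: dot_square_norm)
  ultimately have "T s \<bullet> kvec s + kvec s \<bullet> T s = 0" by (rule vector_derivative_unique_at)
  then have orth: "Re (kvec s * cnj (T s)) = 0"
    by (simp add: inner_complex_def mult.commute)
  have TT: "cnj (T s) * T s = 1" by (metis complex_norm_square mult.commute norm_T of_real_1 one_power2)
  define k where "k = Im (kvec s * cnj (T s))"
  have "kvec s * cnj (T s) = of_real k * \<i>"
    using orth unfolding k_def by (intro complex_eqI) simp_all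
  then have "kvec s * (cnj (T s) * T s) = of_real k * nu s"
    unfolding normal_def mult.assoc[symmetric] by (rule arg_cong)
  then have "kvec s = of_real k * nu s" unfolding TT by simp
  then show ?thesis by (rule that)
qed

text \<open>Otherwise the real or the imaginary part of the relation yields a real direction
  \<open>c\<close> parallel to all tangents. Where the linear functional
  \<open>w \<bullet> c\<close> is maximal on the compact curve, the tangent is also orthogonal to
  \<open>c\<close>, hence zero.\<close>

lemma tangent_not_in_complex_line:
  fixes p q :: complex
  assumes "(p, q) \<noteq> (0, 0)"
  obtains s where "q * of_real (Re (T s)) - p * of_real (Im (T s)) \<noteq> 0"
proof -
  have "\<exists>s. q * of_real (Re (T s)) - p * of_real (Im (T s)) \<noteq> 0"
  proof (rule ccontr)
    assume "\<nexists>s. q * of_real (Re (T s)) - p * of_real (Im (T s)) \<noteq> 0"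
    then have 0: "q * of_real (Re (T s)) - p * of_real (Im (T s)) = 0" for s by blast
    have "\<exists>c::complex. c \<noteq> 0 \<and> (\<forall>s. Im c * Re (T s) - Re c * Im (T s) = 0)"
    proof (cases "Complex (Re p) (Re q) = 0")
      case False
      have "Re q * Re (T s) - Re p * Im (T s) = 0" for s
        using arg_cong[OF 0[of s], of Re] by simp
      then show ?thesis using False by (intro exI[of _ "Complex (Re p) (Re q)"]) auto
    next
      case True
      have "Im q * Re (T s) - Im p * Im (T s) = 0" for s
        using arg_cong[OF 0[of s], of Im] by simp
      moreover have "Complex (Im p) (Im q) \<noteq> 0" using True assms by (auto simp: complex_eq_iff)
      ultimately show ?thesis by (intro exI[of _ "Complex (Im p) (Im q)"]) auto
    qed
    then obtain c :: complex where c: "c \<noteq> 0" "\<And>s. Im c * Re (T s) - Re c * Im (T s) = 0" by blast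
    have "continuous_on crv (\<lambda>w. w \<bullet> c)" by (intro continuous_intros)
    then obtain w where w: "w \<in> crv" "\<And>w'. w' \<in> crv \<Longrightarrow> w' \<bullet> c \<le> w \<bullet> c"
      using continuous_attains_sup[OF compact_crv crv_ne] by blast
    then obtain s where s: "w = \<gamma> s" by auto
    have "((\<lambda>u. \<gamma> u \<bullet> c) has_vector_derivative (\<gamma> s \<bullet> 0 + T s \<bullet> c)) (at s)"
      by (intro bounded_bilinear.has_vector_derivative[OF bounded_bilinear_inner] T_deriv has_vector_derivative_const)
    then have D: "((\<lambda>u. \<gamma> u \<bullet> c) has_real_derivative T s \<bullet> c) (at s)"
      by (simp add: has_real_derivative_iff_has_vector_derivative)
    have "\<gamma> u \<bullet> c \<le> \<gamma> s \<bullet> c" for u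
      using w(2)[of "\<gamma> u"] unfolding s crv_range by blast
    then have "T s \<bullet> c = 0" using DERIV_local_max[OF D, of 1] by auto
    then have "Re (T s) * Re c + Im (T s) * Im c = 0" by (simp add: inner_complex_def)
    then have "T s * cnj c = 0" using c(2)[of s] by (simp add: complex_eq_iff algebra_simps)
    then show False using c(1) by simp
  qed
  then show ?thesis using that by blast
qed

end

context tubular_jordan
begin

text \<open>The factor is 1 - \<tau> \<kappa> with the curvature \<kappa>; it is nonzero because the
  tube map is an immersion.\<close>

lemma par_speed:
  assumes "\<bar>\<tau>\<bar> < t"
  obtains \<mu> where "\<mu> \<noteq> 0" "(par \<tau> has_vector_derivative of_real \<mu> * T s) (at s)"
proof -
  obtain \<kappa> where k: "kvec s = of_real \<kappa> * nu s" by (rule kvec_parallel)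
  have eq: "T s + of_real \<tau> * (\<i> * kvec s) = of_real (1 - \<tau> * \<kappa>) * T s"
    unfolding k by (simp add: normal_def algebra_simps)
  show ?thesis
  proof (rule that)
    show "1 - \<tau> * \<kappa> \<noteq> 0" using immersion[OF assms, of s] unfolding eq by (metis mult_zero_left of_real_0)
    show "(par \<tau> has_vector_derivative of_real (1 - \<tau> * \<kappa>) * T s) (at s)"
      using par_deriv[of \<tau> s] unfolding eq .
  qed
qed

lemma linear_form_par:
  fixes p q :: complex
  assumes "\<bar>\<tau>\<bar> < t"
  obtains \<mu> where "\<mu> \<noteq> 0"
    "((\<lambda>s. q * of_real (Re (par \<tau> s)) - p * of_real (Im (par \<tau> s))) has_vector_derivative
       of_real \<mu> * (q * of_real (Re (T s)) - p * of_real (Im (T s)))) (at s)"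
proof -
  obtain \<mu> where m: "\<mu> \<noteq> 0" "(par \<tau> has_vector_derivative of_real \<mu> * T s) (at s)"
    by (rule par_speed[OF assms])
  have bl: "bounded_linear (\<lambda>z. q * of_real (Re z) - p * of_real (Im z))"
    by (intro bounded_linear_sub bounded_linear_mult_right bounded_linear_compose[OF bounded_linear_mult_right]
        bounded_linear_compose[OF bounded_linear_of_real] bounded_linear_Re bounded_linear_Im)
  show ?thesis
  proof (rule that[OF m(1)])
    show "((\<lambda>s. q * of_real (Re (par \<tau> s)) - p * of_real (Im (par \<tau> s))) has_vector_derivative
       of_real \<mu> * (q * of_real (Re (T s)) - p * of_real (Im (T s)))) (at s)"
      using bounded_linear.has_vector_derivative[OF bl m(2)] by (simp add: algebra_simps)
  qed
qed

text \<open>A finite connected range is a single point; the form would be constant along the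
  parallel curve and all tangents would lie in one complex line. Applied both to the second
  coordinate and to the linear form on which \<open>F\<close> finally depends.\<close>

lemma linear_form_par_infinite_range:
  fixes p q :: complex
  assumes \<tau>: "\<bar>\<tau>\<bar> < t" and pq: "(p, q) \<noteq> (0, 0)"
  shows "infinite (range (\<lambda>s. q * of_real (Re (par \<tau> s)) - p * of_real (Im (par \<tau> s))))"
proof
  let ?l = "\<lambda>s. q * of_real (Re (par \<tau> s)) - p * of_real (Im (par \<tau> s))"
  assume fin: "finite (range ?l)"
  have "continuous_on UNIV ?l"
  proof (intro continuous_at_imp_continuous_on ballI)
    fix s
    obtain \<mu> where "(?l has_vector_derivative of_real \<mu> * (q * of_real (Re (T s)) - p * of_real (Im (T s)))) (at s)"
      by (rule linear_form_par[OF \<tau>])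
    then show "isCont ?l s" by (rule has_vector_derivative_continuous)
  qed
  then have "connected (range ?l)" by (intro connected_continuous_image connected_UNIV)
  then obtain c where "range ?l \<subseteq> {c}"
    using fin connected_finite_iff_sing[of "range ?l"] by auto
  then have c: "?l = (\<lambda>s. c)" by (auto simp: fun_eq_iff)
  have "q * of_real (Re (T s)) - p * of_real (Im (T s)) = 0" for s
  proof -
    obtain \<mu> where m: "\<mu> \<noteq> 0" "(?l has_vector_derivative of_real \<mu> * (q * of_real (Re (T s)) - p * of_real (Im (T s)))) (at s)"
      by (rule linear_form_par[OF \<tau>])
    have "(?l has_vector_derivative 0) (at s)" unfolding c by simp
    from vector_derivative_unique_at[OF m(2) this] show ?thesis using m(1) by simp
  qed
  then show False using tangent_not_in_complex_line[OF pq] by metis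
qed

end

lemma even_derivative_zero:
  fixes h :: "real \<Rightarrow> complex"
  assumes "(h has_vector_derivative D) (at 0)" "\<And>x. h (- x) = h x"
  shows "D = 0"
proof -
  have "((\<lambda>x. - x) has_vector_derivative - 1) (at (0::real))" by (auto intro!: derivative_eq_intros)
  moreover have "(h has_vector_derivative D) (at (- 0))" using assms(1) by simp
  ultimately have "(h \<circ> (\<lambda>x. - x) has_vector_derivative - 1 *\<^sub>R D) (at 0)"
    by (rule vector_diff_chain_at)
  then have "(h has_vector_derivative - D) (at 0)" using assms(2) by (simp add: o_def)
  then have "D = - D" using assms(1) by (rule vector_derivative_unique_at[rotated])
  then show ?thesis by simp
qed

context magnetic_table
begin

text \<open>The billiard reflection at \<open>\<gamma> s\<close> acts on Larmor centers as the reflection in the normal line;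
  the centers form the circle of radius \<open>r\<close> about \<open>\<gamma> s\<close>, which is tangent to the parallel curve.\<close>
lemma center_symmetry:
  assumes int: "is_poly_integral \<gamma> L r N a" and \<sigma>: "\<sigma> \<in> {1, -1}"
    and F: "\<And>x v. x \<in> annulus_plus \<gamma> r \<Longrightarrow> norm v = 1 \<Longrightarrow>
      of_real (poly_mom N a x v) = G (x + \<i> * of_real r * v)"
    and cs: "c\<^sup>2 + sn\<^sup>2 = 1"
  shows "G (par (\<sigma> * r) s + of_real (\<sigma> * r * (c - 1)) * nu s + of_real (r * sn) * T s) =
    (G (par (\<sigma> * r) s + of_real (\<sigma> * r * (c - 1)) * nu s - of_real (r * sn) * T s) :: complex)"
proof -
  have \<sigma>2: "\<sigma> * \<sigma> = 1" using \<sigma> by auto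
  have x: "\<gamma> s \<in> annulus_plus \<gamma> r"
    unfolding annulus_plus_def using r_pos
    by (intro CollectI exI[of _ s] exI[of _ 0]) (simp add: parallel_curve_def)
  \<comment> \<open>Chosen so that \<open>\<i> * v e\<close> has component
    \<open>\<sigma> * c\<close> along the normal and \<open>e * sn\<close> along the tangent; the
    reflection exchanges \<open>e = 1\<close> and \<open>e = - 1\<close>. For \<open>c = 1\<close>
    the center is the point of the parallel curve.\<close>
  define v where "v = (\<lambda>e. of_real (\<sigma> * c) * T s - of_real (e * sn) * nu s)"
  have v: "v e = Complex (\<sigma> * c) (- (e * sn)) * T s" for e
    by (simp add: v_def normal_def complex_eq_iff algebra_simps)
  have nv: "norm (v e) = 1" if "e * e = 1" for e
  proof -
    have "(\<sigma> * c)\<^sup>2 + (- (e * sn))\<^sup>2 = (\<sigma> * \<sigma>) * c\<^sup>2 + (e * e) * sn\<^sup>2" by (simp add: power2_eq_square algebra_simps)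
    then have "(\<sigma> * c)\<^sup>2 + (- (e * sn))\<^sup>2 = 1" using cs that \<sigma>2 by simp
    then show ?thesis unfolding v norm_mult norm_T by (simp add: cmod_def)
  qed
  have "reflect (nu s) (v 1) = v (- 1)"
  proof -
    have "(Re (T s))\<^sup>2 + (Im (T s))\<^sup>2 = 1" using cmod_power2[of "T s"] by simp
    moreover have "nu s \<bullet> v 1 = - sn * ((Re (T s))\<^sup>2 + (Im (T s))\<^sup>2)"
      by (simp add: v_def normal_def inner_complex_def power2_eq_square algebra_simps)
    ultimately have nu_v: "nu s \<bullet> v 1 = - sn" by simp
    show ?thesis unfolding reflect_def nu_v by (simp add: v_def algebra_simps)
  qed
  then have "poly_mom N a (\<gamma> s) (v (- 1)) = poly_mom N a (\<gamma> s) (v 1)"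
    using int nv[of 1] unfolding is_poly_integral_def by (metis mult_1)
  then have "G (\<gamma> s + \<i> * of_real r * v (- 1)) = G (\<gamma> s + \<i> * of_real r * v 1)"
    using F[OF x, of "v 1"] F[OF x, of "v (- 1)"] nv[of 1] nv[of "-1"] by simp
  moreover have "\<gamma> s + \<i> * of_real r * v e =
    par (\<sigma> * r) s + of_real (\<sigma> * r * (c - 1)) * nu s + of_real (r * (e * sn)) * T s" for e
    by (simp add: v_def parallel_curve_def normal_def algebra_simps)
  ultimately show ?thesis by simp
qed

end

lemma (in magnetic_table) tangent_to_infinity:
  assumes int: "is_poly_integral \<gamma> L r N a"
    and nonconst: "nonconstant_on_UT (annulus_plus \<gamma> r) (poly_mom N a)"
    and \<sigma>: "\<sigma> \<in> {1, -1}" and f: "irreducible f"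
    and on: "\<And>s. eval2 f (of_real (Re (par (\<sigma> * r) s))) (of_real (Im (par (\<sigma> * r) s))) = 0"
    and pq: "(p, q) \<noteq> (0, 0)" and h0: "homog f p q 0 = 0"
    and iso: "q \<noteq> \<i> * p" "q \<noteq> - \<i> * p"
  shows "homog_dx f p q 0 = 0 \<and> homog_dy f p q 0 = 0"
proof (rule ccontr)
  assume ns: "\<not> (homog_dx f p q 0 = 0 \<and> homog_dy f p q 0 = 0)"
  define \<tau> where "\<tau> = \<sigma> * r"
  have \<tau>: "\<bar>\<tau>\<bar> < t" using \<sigma> r_pos r_tube by (auto simp: \<tau>_def)
  \<comment> \<open>The two linear factors of this quadratic form vanish exactly at the isotropic
    points; its being nonzero makes (p, q) and (q, -p) a basis.\<close>
  have Q: "p\<^sup>2 + q\<^sup>2 \<noteq> 0"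
  proof
    assume "p\<^sup>2 + q\<^sup>2 = 0"
    moreover have "p\<^sup>2 + q\<^sup>2 = (q - \<i> * p) * (q + \<i> * p)" by (simp add: power2_eq_square algebra_simps)
    ultimately show False using iso by (simp add: eq_neg_iff_add_eq_0)
  qed
  obtain F0 where F0: "polyfun2 F0" and F0_eq: "\<And>x v. x \<in> annulus_plus \<gamma> r \<Longrightarrow> norm v = 1 \<Longrightarrow>
      of_real (poly_mom N a x v) = F0 (x + \<i> * of_real r * v) (cnj (x + \<i> * of_real r * v))"
    by (rule integral_polynomial_in_center[OF int]) blast
  obtain F0p where F0p: "F0 = eval2 F0p" using F0 by (auto simp: polyfun2_def)
  define F where "F = (\<lambda>x y. F0 (x + \<i> * y) (x - \<i> * y))"
  have "polyfun2 F"
    unfolding F_def F0p by (intro polyfun2_compose polyfun2_add polyfun2_diff polyfun2_mult polyfun2_const polyfun2_fst polyfun2_snd)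
  then obtain Fp where Fp: "F = eval2 Fp" by (auto simp: polyfun2_def)
  define G where "G = (\<lambda>P. F (of_real (Re P)) (of_real (Im P)))"
  have G: "G P = F0 P (cnj P)" for P
  proof -
    have "of_real (Re P) + \<i> * of_real (Im P) = P" "of_real (Re P) - \<i> * of_real (Im P) = cnj P"
      by (simp_all add: complex_eq_iff)
    then show ?thesis by (simp add: G_def F_def)
  qed
  have sym0: "G (par \<tau> s + of_real (\<tau> * (c - 1)) * nu s + of_real (r * sn) * T s) =
    G (par \<tau> s + of_real (\<tau> * (c - 1)) * nu s - of_real (r * sn) * T s)" if "c\<^sup>2 + sn\<^sup>2 = 1" for c sn s
    unfolding \<tau>_def by (rule center_symmetry[OF int \<sigma> _ that]) (simp add: F0_eq G)
  define X Y n1 n2 where "X = (\<lambda>s. complex_of_real (Re (par \<tau> s)))" and "Y = (\<lambda>s. complex_of_real (Im (par \<tau> s)))"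
    and "n1 = (\<lambda>s. complex_of_real (Re (nu s)))" and "n2 = (\<lambda>s. complex_of_real (Im (nu s)))"
  have Tn: "Re (T s) = Im (nu s)" "Im (T s) = - Re (nu s)" for s by (simp_all add: normal_def)
  have sym: "normal_symmetric F (of_real (\<tau> * (c - 1))) (of_real (r * sn)) (n1 s) (n2 s) (X s) (Y s)"
    if "c\<^sup>2 + sn\<^sup>2 = 1" for c sn s
    using sym0[OF that, of s] by (simp add: normal_symmetric_def G_def X_def Y_def n1_def n2_def Tn)
  have n_unit: "n1 s * n1 s + n2 s * n2 s = 1" for s
  proof -
    have "Re (nu s) * Re (nu s) + Im (nu s) * Im (nu s) = 1"
      using cmod_power2[of "nu s"] by (simp add: power2_eq_square)
    then show ?thesis unfolding n1_def n2_def of_real_mult[symmetric] of_real_add[symmetric] by simp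
  qed
  define fx fy qf where "fx = eval2 (pderiv f)" and "fy = eval2 (pderiv2 f)" and "qf = (\<lambda>x y. fx x y ^ 2 + fy x y ^ 2)"
  \<comment> \<open>\<open>f\<close> is constant along the parallel curve, whose velocity is a
    nonzero multiple of the tangent (n2, -n1).\<close>
  have grad: "fx (X s) (Y s) * n2 s - fy (X s) (Y s) * n1 s = 0" for s
  proof -
    obtain \<mu> where m: "\<mu> \<noteq> 0" "(par \<tau> has_vector_derivative of_real \<mu> * T s) (at s)" by (rule par_speed[OF \<tau>])
    have "(X has_derivative (\<lambda>h. of_real (Re (h *\<^sub>R (of_real \<mu> * T s))))) (at s)"
      "(Y has_derivative (\<lambda>h. of_real (Im (h *\<^sub>R (of_real \<mu> * T s))))) (at s)"
      unfolding X_def Y_def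
      by (intro bounded_linear.has_derivative[OF bounded_linear_of_real] bounded_linear.has_derivative[OF bounded_linear_Re]
          bounded_linear.has_derivative[OF bounded_linear_Im] m(2)[unfolded has_vector_derivative_def])+
    from has_derivative_eval2[OF this, of f] have "((\<lambda>s. eval2 f (X s) (Y s)) has_derivative (\<lambda>h.
       fx (X s) (Y s) * of_real (Re (h *\<^sub>R (of_real \<mu> * T s))) + fy (X s) (Y s) * of_real (Im (h *\<^sub>R (of_real \<mu> * T s))))) (at s)"
      by (simp add: fx_def fy_def)
    moreover have "((\<lambda>s. eval2 f (X s) (Y s)) has_derivative (\<lambda>h. 0)) (at s)"
      using on by (simp add: X_def Y_def \<tau>_def)
    ultimately have "(\<lambda>h. fx (X s) (Y s) * of_real (Re (h *\<^sub>R (of_real \<mu> * T s))) + fy (X s) (Y s) * of_real (Im (h *\<^sub>R (of_real \<mu> * T s))))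
       = (\<lambda>h. 0)"
      by (rule has_derivative_unique)
    from fun_cong[OF this, of 1] have "of_real \<mu> * (fx (X s) (Y s) * n2 s - fy (X s) (Y s) * n1 s) = 0"
      by (simp add: n1_def n2_def Tn algebra_simps)
    then show ?thesis using m(1) by simp
  qed
  define S where "S = range (\<lambda>s. (X s, Y s))"
  have S: "infinite (snd ` S)"
  proof -
    have "snd ` S = range Y" by (auto simp: S_def image_image)
    also have "\<dots> = uminus ` range (\<lambda>s. 0 * of_real (Re (par \<tau> s)) - 1 * of_real (Im (par \<tau> s)))"
      by (auto simp: Y_def image_image)
    finally show ?thesis
      using linear_form_par_infinite_range[OF \<tau>, of 1 0] by (simp add: finite_image_iff)
  qed
  obtain b0 \<omega> :: complex where \<omega>: "\<omega> \<noteq> 0" and ridge: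
    "\<And>g \<alpha> \<delta>. \<lbrakk>\<And>U V. F (U * p + V * q) (U * q - V * p) = eval2 g U V;
       \<And>x y \<rho>. \<lbrakk>eval2 f x y = 0; \<rho>\<^sup>2 = (eval2 (pderiv f) x y)\<^sup>2 + (eval2 (pderiv2 f) x y)\<^sup>2; \<rho> \<noteq> 0\<rbrakk> \<Longrightarrow>
         \<exists>\<rho>'\<in>{\<rho>, - \<rho>}.
          normal_symmetric F \<alpha> \<delta> (eval2 (pderiv f) x y / \<rho>') (eval2 (pderiv2 f) x y / \<rho>') x y;
       degree g \<noteq> 0; \<delta> \<noteq> 0\<rbrakk> \<Longrightarrow>
       poly (lead_coeff g) (b0 + \<alpha> * \<omega>) = 0 \<or> poly (lead_coeff g) (b0 - \<alpha> * \<omega>) = 0"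
    by (rule ridge_direction[OF h0 Q ns, of F]) blast
  have "polyfun2 (\<lambda>U V. F (U * p + V * q) (U * q - V * p))"
    unfolding Fp by (intro polyfun2_compose polyfun2_add polyfun2_diff polyfun2_mult polyfun2_const polyfun2_fst polyfun2_snd)
  then obtain g where g0: "(\<lambda>U V. F (U * p + V * q) (U * q - V * p)) = eval2 g" by (auto simp: polyfun2_def)
  then have g: "F (U * p + V * q) (U * q - V * p) = eval2 g U V" for U V by (metis (no_types, lifting))
  have "degree g = 0"
  proof (rule ccontr)
    assume dg: "degree g \<noteq> 0"
    define lc where "lc = lead_coeff g"
    have "lc \<noteq> 0" using dg by (auto simp: lc_def)
    then have fin: "finite {z. poly lc z = 0}" by (rule poly_roots_finite)
    \<comment> \<open>The values of \<open>c\<close> for which the leading coefficient vanishes at a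
      limit point b0 \<plusminus> \<alpha> \<omega>. There are finitely many since that point
      depends injectively on \<open>c\<close>; picking \<open>c\<close> strictly between -1 and 1
      also keeps \<open>\<delta>\<close> nonzero.\<close>
    define bad where "bad e = (\<lambda>c. b0 + e * (of_real (\<tau> * (c - 1)) * \<omega>)) -` {z. poly lc z = 0}" for e :: complex
    have "finite (bad e)" if "e \<noteq> 0" for e
    proof -
      have "\<tau> \<noteq> 0" using \<sigma> r_pos by (auto simp: \<tau>_def)
      then have "inj (\<lambda>c. b0 + e * (of_real (\<tau> * (c - 1)) * \<omega>))"
        using that \<omega> by (auto simp: inj_def)
      then show ?thesis unfolding bad_def by (intro finite_vimageI fin)
    qed
    then have "finite (bad 1 \<union> bad (- 1))" by simp
    then have "\<not> {-1<..<1} \<subseteq> bad 1 \<union> bad (- 1)"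
      using finite_subset by (metis infinite_Ioo_iff neg_less_iff_less zero_less_one less_trans neg_less_0_iff_less)
    then obtain c :: real where c_bad: "c \<in> {-1<..<1}" "c \<notin> bad 1 \<union> bad (- 1)" by blast
    then have c: "-1 < c" "c < 1" "c \<notin> bad 1" "c \<notin> bad (- 1)" by simp_all
    define sn where "sn = sqrt (1 - c\<^sup>2)"
    have "c\<^sup>2 < 1" using c by (simp add: abs_square_less_1)
    then have sn: "c\<^sup>2 + sn\<^sup>2 = 1" "sn > 0" by (simp_all add: sn_def)
    define \<alpha> \<delta> where "\<alpha> = complex_of_real (\<tau> * (c - 1))" and "\<delta> = complex_of_real (r * sn)"
    define D where "D = (\<lambda>x y \<rho>. F (x + \<alpha> * (fx x y / \<rho>) + \<delta> * (fy x y / \<rho>)) (y + \<alpha> * (fy x y / \<rho>) - \<delta> * (fx x y / \<rho>))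
       - F (x + \<alpha> * (fx x y / \<rho>) - \<delta> * (fy x y / \<rho>)) (y + \<alpha> * (fy x y / \<rho>) + \<delta> * (fx x y / \<rho>)))"
    have qf: "polyfun2 qf" unfolding qf_def fx_def fy_def by (intro polyfun2_add polyfun2_power polyfun2_eval2)
    have lin: "sqrt_polyfun qf (\<lambda>x y \<rho>. h x y + A * (fx x y / \<rho>) + B * (fy x y / \<rho>))" if "polyfun2 h" for h A B
      using that unfolding fx_def fy_def
      by (intro sqrt_polyfun_add sqrt_polyfun_mult qf sqrt_polyfun_polyfun2 sqrt_polyfun_divide polyfun2_const polyfun2_eval2)
    have comp: "sqrt_polyfun qf (\<lambda>x y \<rho>. F (x + A1 * (fx x y / \<rho>) + B1 * (fy x y / \<rho>)) (y + A2 * (fx x y / \<rho>) + B2 * (fy x y / \<rho>)))"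
      for A1 B1 A2 B2
      unfolding Fp by (rule sqrt_polyfun_eval2[OF qf lin[OF polyfun2_fst] lin[OF polyfun2_snd]])
    have Deq: "D = (\<lambda>x y \<rho>. F (x + \<alpha> * (fx x y / \<rho>) + \<delta> * (fy x y / \<rho>)) (y + (- \<delta>) * (fx x y / \<rho>) + \<alpha> * (fy x y / \<rho>))
       + (- 1) * F (x + \<alpha> * (fx x y / \<rho>) + (- \<delta>) * (fy x y / \<rho>)) (y + \<delta> * (fx x y / \<rho>) + \<alpha> * (fy x y / \<rho>)))"
      by (simp add: D_def fun_eq_iff algebra_simps)
    have Dp: "sqrt_polyfun qf D"
      unfolding Deq by (rule sqrt_polyfun_add[OF qf comp sqrt_polyfun_mult[OF qf sqrt_polyfun_polyfun2[OF polyfun2_const] comp]])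
    have rel: "D x y \<rho> = 0 \<or> D x y (- \<rho>) = 0" if xy: "eval2 f x y = 0" "\<rho>\<^sup>2 = qf x y" "\<rho> \<noteq> 0" for x y \<rho>
    proof (rule sqrt_relation_on_curve[OF f S qf Dp _ _ xy])
      show "eval2 f x y = 0" if "(x, y) \<in> S" for x y
        using that on by (auto simp: S_def X_def Y_def \<tau>_def)
      show "\<exists>\<rho>. \<rho>\<^sup>2 = qf x y \<and> D x y \<rho> = 0" if xyS: "(x, y) \<in> S" "qf x y \<noteq> 0" for x y
      proof -
        obtain s where s: "x = X s" "y = Y s" using xyS(1) by (auto simp: S_def)
        \<comment> \<open>At a real point the root is explicit: the gradient is a multiple of the
          unit normal, and \<open>\<rho>\<close> is that multiple.\<close>
        define \<rho> where "\<rho> = fx x y * n1 s + fy x y * n2 s"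
        have "fx x y = fx x y * (n1 s * n1 s + n2 s * n2 s) - n2 s * (fx x y * n2 s - fy x y * n1 s)"
          "fy x y = fy x y * (n1 s * n1 s + n2 s * n2 s) + n1 s * (fx x y * n2 s - fy x y * n1 s)"
          using grad[of s] by (simp_all add: n_unit s)
        then have fn: "fx x y = \<rho> * n1 s" "fy x y = \<rho> * n2 s"
          by (simp_all add: \<rho>_def algebra_simps)
        have "qf x y = \<rho>\<^sup>2 * (n1 s * n1 s + n2 s * n2 s)"
          unfolding qf_def fn by (simp add: power2_eq_square algebra_simps)
        then have \<rho>2: "\<rho>\<^sup>2 = qf x y" by (simp add: n_unit)
        then have "\<rho> \<noteq> 0" using xyS(2) by auto
        then have "fx x y / \<rho> = n1 s" "fy x y / \<rho> = n2 s" using fn by simp_all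
        then have "D x y \<rho> = 0" unfolding D_def \<alpha>_def \<delta>_def
          using sym[OF sn(1), of s] s by (simp add: normal_symmetric_def)
        with \<rho>2 show ?thesis by blast
      qed
    qed
    have "poly lc (b0 + \<alpha> * \<omega>) = 0 \<or> poly lc (b0 - \<alpha> * \<omega>) = 0"
      unfolding lc_def
    proof (rule ridge[OF g _ dg, of \<alpha> \<delta>])
      show "\<delta> \<noteq> 0" using sn r_pos by (simp add: \<delta>_def)
      fix x y \<rho> :: complex
      assume "eval2 f x y = 0" "\<rho>\<^sup>2 = (eval2 (pderiv f) x y)\<^sup>2 + (eval2 (pderiv2 f) x y)\<^sup>2" "\<rho> \<noteq> 0"
      then have "D x y \<rho> = 0 \<or> D x y (- \<rho>) = 0"
        by (intro rel) (simp_all add: qf_def fx_def fy_def)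
      then show "\<exists>\<rho>'\<in>{\<rho>, - \<rho>}.
          normal_symmetric F \<alpha> \<delta> (eval2 (pderiv f) x y / \<rho>') (eval2 (pderiv2 f) x y / \<rho>') x y"
        unfolding D_def fx_def fy_def normal_symmetric_def by auto
    qed
    then show False using c(3,4) by (simp add: bad_def \<alpha>_def)
  qed
  then obtain c0 where c0: "g = [:c0:]" by (rule degree_eq_zeroE)
  \<comment> \<open>The second coordinate of (x, y) in the basis (p, q), (q, -p); \<open>F\<close>
    depends on it alone once \<open>g\<close> is free of the first.\<close>
  define l where "l = (\<lambda>x y. q / (p\<^sup>2 + q\<^sup>2) * x - p / (p\<^sup>2 + q\<^sup>2) * y)"
  have Fl: "F x y = poly c0 (l x y)" for x y
  proof -
    define U V where "U = (p * x + q * y) / (p\<^sup>2 + q\<^sup>2)" and "V = (q * x - p * y) / (p\<^sup>2 + q\<^sup>2)"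
    have "U * p + V * q = ((p\<^sup>2 + q\<^sup>2) * x) / (p\<^sup>2 + q\<^sup>2)" "U * q - V * p = ((p\<^sup>2 + q\<^sup>2) * y) / (p\<^sup>2 + q\<^sup>2)"
      unfolding U_def V_def times_divide_eq_left times_divide_eq_right add_divide_distrib[symmetric] diff_divide_distrib[symmetric]
      by (simp_all add: power2_eq_square algebra_simps)
    then have "U * p + V * q = x" "U * q - V * p = y" using Q by simp_all
    then have "F x y = poly c0 V" using g[of U V] by (simp add: c0)
    also have "V = l x y" by (simp add: V_def l_def diff_divide_distrib)
    finally show ?thesis .
  qed
  define pp qq where "pp = p / (p\<^sup>2 + q\<^sup>2)" and "qq = q / (p\<^sup>2 + q\<^sup>2)"
  have ppqq: "(pp, qq) \<noteq> (0, 0)" using pq Q by (auto simp: pp_def qq_def)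
  define lin where "lin = (\<lambda>z. qq * of_real (Re z) - pp * of_real (Im z))"
  have lin_l: "l (of_real (Re z)) (of_real (Im z)) = lin z" for z by (simp add: l_def lin_def pp_def qq_def)
  have lin_add: "lin (z + w) = lin z + lin w" and lin_diff: "lin (z - w) = lin z - lin w"
    and lin_scale: "lin (of_real u * z) = of_real u * lin z" for z w u
    by (simp_all add: lin_def algebra_simps)
  have Gl: "G P = poly c0 (lin P)" for P by (simp add: G_def Fl lin_l)
  \<comment> \<open>Along the circle of centers \<open>F\<close> is even in the angle measured from
    the tangency point, so its tangential derivative vanishes there. As the circle touches the
    parallel curve, this is also the derivative along that curve up to a factor.\<close>
  have crit: "poly (pderiv c0) (lin (par \<tau> s)) * lin (T s) = 0" for s
  proof -
    define A B C where "A = lin (par \<tau> s)" and "B = lin (nu s)" and "C = lin (T s)"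
    define m where "m = (\<lambda>\<phi>. A + of_real (\<tau> * (cos \<phi> - 1)) * B + of_real (r * sin \<phi>) * C)"
    have ev: "poly c0 (m (- \<phi>)) = poly c0 (m \<phi>)" for \<phi>
      using sym0[of "cos \<phi>" "sin \<phi>" s] unfolding Gl lin_add lin_diff lin_scale
      by (simp add: m_def A_def B_def C_def)
    have "(m has_vector_derivative of_real r * C) (at 0)"
      unfolding m_def by (auto intro!: derivative_eq_intros)
    moreover have "(poly c0 has_field_derivative poly (pderiv c0) A) (at (m 0))"
      using poly_DERIV[of c0 A] by (simp add: m_def)
    ultimately have "(poly c0 \<circ> m has_vector_derivative of_real r * C * poly (pderiv c0) A) (at 0)"
      by (rule field_vector_diff_chain_at)
    then have "of_real r * C * poly (pderiv c0) A = 0"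
      by (rule even_derivative_zero) (simp add: ev)
    then show ?thesis using r_pos by (simp add: A_def C_def mult.commute)
  qed
  have "(\<lambda>s. poly c0 (lin (par \<tau> s))) constant_on UNIV"
  proof -
    have "((\<lambda>s. poly c0 (lin (par \<tau> s))) has_vector_derivative 0) (at s)" for s
    proof -
      obtain \<mu> where m: "\<mu> \<noteq> 0" "((\<lambda>s. lin (par \<tau> s)) has_vector_derivative of_real \<mu> * lin (T s)) (at s)"
        unfolding lin_def by (rule linear_form_par[OF \<tau>])
      from field_vector_diff_chain_at[OF m(2) poly_DERIV[of c0]]
      have "((\<lambda>s. poly c0 (lin (par \<tau> s))) has_vector_derivative of_real \<mu> * lin (T s) * poly (pderiv c0) (lin (par \<tau> s))) (at s)"
        by (simp add: o_def)
      moreover have "of_real \<mu> * lin (T s) * poly (pderiv c0) (lin (par \<tau> s)) = 0" using crit[of s] by auto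
      ultimately show ?thesis by simp
    qed
    then have "\<And>s. ((\<lambda>s. poly c0 (lin (par \<tau> s))) has_derivative (\<lambda>h. 0)) (at s within UNIV)"
      by (simp add: has_vector_derivative_def)
    then show ?thesis
      using has_derivative_zero_constant[of UNIV "\<lambda>s. poly c0 (lin (par \<tau> s))"] by (auto simp: constant_on_def)
  qed
  then obtain K where K: "\<And>s. poly c0 (lin (par \<tau> s)) = K" by (auto simp: constant_on_def)
  \<comment> \<open>The one-variable polynomial \<open>c0\<close> takes the value \<open>K\<close>
    at infinitely many points, so it is constant.\<close>
  have "range (\<lambda>s. lin (par \<tau> s)) \<subseteq> {z. poly (c0 - [:K:]) z = 0}" using K by auto
  then have "c0 - [:K:] = 0"
    using linear_form_par_infinite_range[OF \<tau> ppqq] poly_roots_finite[of "c0 - [:K:]"] finite_subset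
    unfolding lin_def by blast
  then have "c0 = [:K:]" by simp
  then have "of_real (poly_mom N a x v) = K" if "x \<in> annulus_plus \<gamma> r" "norm v = 1" for x v
    using F0_eq[OF that] G[of "x + \<i> * of_real r * v"] unfolding Gl by simp
  then have "poly_mom N a x v = poly_mom N a y w"
    if "x \<in> annulus_plus \<gamma> r" "norm v = 1" "y \<in> annulus_plus \<gamma> r" "norm w = 1" for x v y w
    using that by (metis of_real_eq_iff)
  then show False using nonconst unfolding nonconstant_on_UT_def by blast
qed

theorem theorem5p2:
  fixes \<gamma> :: "real \<Rightarrow> complex" and L r :: real
    and N :: nat and a :: "nat \<Rightarrow> nat \<Rightarrow> complex \<Rightarrow> real"
    and \<sigma> :: real and f :: "complex poly poly"
  assumes "smooth_jordan_ccw \<gamma> L"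
    and "r > 0" and "r < tube_radius \<gamma> L / 2"
    and "is_poly_integral \<gamma> L r N a"
    and "nonconstant_on_UT (annulus_plus \<gamma> r) (poly_mom N a)"
    and "\<sigma> \<in> {1, -1}"
    and "real_coeffs2 f" and "irreducible f"
    and "\<forall>s. eval2 f (of_real (Re (parallel_curve \<gamma> (\<sigma> * r) s)))
                    (of_real (Im (parallel_curve \<gamma> (\<sigma> * r) s))) = 0"
    and "(p, q) \<noteq> (0, 0)" and "homog f p q 0 = 0"
    and "q \<noteq> \<i> * p" and "q \<noteq> - \<i> * p"
    and "nonsingular_pt (homog f) p q 0"
  shows "tangent_to_infinity_line (homog f) p q 0"
proof -
  interpret jordan_ccw \<gamma> L by unfold_locales (rule assms(1))
  have "{t. t > 0 \<and> tube_ok \<gamma> L t} \<noteq> {}" using ex_tube_ok by blast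
  \<comment> \<open>Strictness selects one admissible tube radius \<open>t\<close> above
    \<open>2 * r\<close>; the supremum itself need not be attained.\<close>
  moreover have "2 * r < Sup {t. t > 0 \<and> tube_ok \<gamma> L t}"
    using assms(3) by (simp add: tube_radius_def)
  ultimately obtain t where t: "t > 0" "tube_ok \<gamma> L t" "2 * r < t"
    using less_cSupE[of "2 * r" "{t. t > 0 \<and> tube_ok \<gamma> L t}"] by blast
  interpret magnetic_table \<gamma> L t r
    by unfold_locales (use t assms(2) in auto)
  have "homog_dx f p q 0 = 0 \<and> homog_dy f p q 0 = 0"
    using assms(9) by (intro tangent_to_infinity[OF assms(4,5,6,8) _ assms(10-13)]) blast
  then show ?thesis
    by (simp add: tangent_to_infinity_line_def deriv_homog)
qed

end
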